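(* Let $f:\mathbb{P}^1\to\mathbb{P}^1$ be an endomorphism over $\mathbb{C}$ of degree at least $2$. Assume that $f$ has a linear CER (conformal expanding repeller) $K\subset\mathbb{P}^1(\mathbb{C})$ which is not a finite set. Then $f$ is exceptional.
   Context: Exceptional maps: an endomorphism $f$ of $\mathbb{P}^1$ over $\mathbb{C}$ of degree at least $2$ is Lattès if it is semi-conjugate to an endomorphism of an elliptic curve, i.e. there are an elliptic curve $E$, a morphism $g:E\to E$ and a non-constant morphism $\pi:E\to\mathbb{P}^1$ with $f\circ\pi=\pi\circ g$. It is of monomial type if it is semi-conjugate to $z\mapsto z^n$ on $\mathbb{P}^1$ for some integer $n$ with $|n|\ge 2$, i.e. there is a non-constant morphism $\pi:\mathbb{P}^1\to\mathbb{P}^1$ with $f(\pi(z))=\pi(z^n)$. It is exceptional if it is Lattès or of monomial type. CER: $|df|$ denotes the norm of the derivative with respect to a smooth metric on $\mathbb{P}^1(\mathbb{C})$, e.g. the spherical metric. A compact set $K\subset\mathbb{P}^1(\mathbb{C})$ is called a CER of $f$ if (i) there exist $m\ge1$ and a neighborhood $V$ of $K$ such that $f^m(K)=K$ and $K=\bigcap_{n\ge0}f^{-mn}(V)$; (ii) $f^m:K\to K$ is expanding, i.e. there are constants $C>0$ and $\lambda>1$ such that $|df^{nm}(x)|\ge C\lambda^n$ for every $x\in K$ and $n\ge1$; (iii) $f^m:K\to K$ is topologically exact, i.e. for every nonempty (relatively) open set $U\subset K$ there exists $n\ge0$ such that $f^{mn}(U)=K$. Linear CER: let $K$ be a CER of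 $f$ with $f(K)=K$. $K$ is called linear if one of the following two (equivalent) conditions holds: (a) $\log|df|$ is cohomologous to a locally constant function on $K$, i.e. there is a continuous function $u$ on $K$ such that $\log|df|-(u\circ f-u)$ is locally constant on $K$; (b) there exists an atlas $\{\phi_i\}_{1\le i\le k}$, i.e. a family of holomorphic injections $\phi_i:V_i\to\mathbb{C}$ on open sets $V_i$ with $K\subset\bigcup_{i=1}^kV_i$, such that all the maps $\phi_i\circ\phi_j^{-1}$ and $\phi_i\circ f\circ\phi_j^{-1}$ are affine (where defined). *)

theory Defs
  imports "HOL-Complex_Analysis.Complex_Analysis"
    "HOL-Computational_Algebra.Computational_Algebra"
begin

section \<open>The projective line over the complex numbers\<close>

datatype P1 = Aff complex | Infty

text \<open>The coordinate \<open>z\<close> is inverse to \<open>Aff\<close>, the coordinate \<open>1/z\<close> at infinity is inverse to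
  \<open>Aff_inf\<close>.  The values \<open>coord Infty = 0\<close> and \<open>coord_inf (Aff 0) = 0\<close> are junk: these points lie
  outside the respective chart domains.\<close>

definition Aff_inf :: "complex \<Rightarrow> P1" where
  "Aff_inf w = (if w = 0 then Infty else Aff (1 / w))"

fun coord :: "P1 \<Rightarrow> complex" where
  "coord (Aff z) = z"
| "coord Infty = 0"

fun coord_inf :: "P1 \<Rightarrow> complex" where
  "coord_inf (Aff z) = 1 / z"
| "coord_inf Infty = 0"

instantiation P1 :: topological_space
begin

definition open_P1 :: "P1 set \<Rightarrow> bool" where
  "open_P1 U \<longleftrightarrow> open (Aff -` U) \<and> open (Aff_inf -` U)"

instance
proof
  show "open (UNIV :: P1 set)"
    by (simp add: open_P1_def)
next
  fix S T :: "P1 set"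
  assume "open S" "open T"
  then show "open (S \<inter> T)"
    by (simp add: open_P1_def open_Int)
next
  fix \<K> :: "P1 set set"
  assume "\<forall>S\<in>\<K>. open S"
  then show "open (\<Union>\<K>)"
    by (auto simp: open_P1_def vimage_Union)
qed

end

subsection \<open>Morphisms from the projective line to itself\<close>

text \<open>The map \<open>[p : q]\<close>, where \<open>p\<close> and \<open>q\<close> are homogenised to the degree \<open>max (degree p) (degree q)\<close>.\<close>

fun rat_map :: "complex poly \<Rightarrow> complex poly \<Rightarrow> P1 \<Rightarrow> P1" where
  "rat_map p q (Aff z) = (if poly q z = 0 then Infty else Aff (poly p z / poly q z))"
| "rat_map p q Infty =
     (let d = max (degree p) (degree q)
      in if coeff q d = 0 then Infty else Aff (coeff p d / coeff q d))"

definition P1_morphism_of_degree :: "(P1 \<Rightarrow> P1) \<Rightarrow> nat \<Rightarrow> bool" where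
  "P1_morphism_of_degree f d \<longleftrightarrow>
     (\<exists>p q. coprime p q \<and> max (degree p) (degree q) = d \<and> f = rat_map p q)"

definition P1_morphism :: "(P1 \<Rightarrow> P1) \<Rightarrow> bool" where
  "P1_morphism f \<longleftrightarrow> (\<exists>d. P1_morphism_of_degree f d)"

definition power_map :: "int \<Rightarrow> P1 \<Rightarrow> P1" where
  "power_map n =
     (if n \<ge> 0 then rat_map (monom 1 (nat n)) 1 else rat_map 1 (monom 1 (nat (- n))))"

subsection \<open>Holomorphic functions to and from the projective line\<close>

definition P1_holomorphic_on :: "(P1 \<Rightarrow> complex) \<Rightarrow> P1 set \<Rightarrow> bool" where
  "P1_holomorphic_on \<phi> V \<longleftrightarrow>
     (\<phi> \<circ> Aff) holomorphic_on (Aff -` V) \<and> (\<phi> \<circ> Aff_inf) holomorphic_on (Aff_inf -` V)"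

definition holomorphic_to_P1 :: "(complex \<Rightarrow> P1) \<Rightarrow> bool" where
  "holomorphic_to_P1 \<psi> \<longleftrightarrow>
     (\<forall>z. \<exists>U. open U \<and> z \<in> U \<and>
        (Infty \<notin> \<psi> ` U \<and> (coord \<circ> \<psi>) holomorphic_on U \<or>
         Aff 0 \<notin> \<psi> ` U \<and> (coord_inf \<circ> \<psi>) holomorphic_on U))"

section \<open>Exceptional maps\<close>

definition is_lattice :: "complex set \<Rightarrow> bool" where
  "is_lattice \<Lambda> \<longleftrightarrow>
     (\<exists>\<omega>1 \<omega>2. \<omega>2 / \<omega>1 \<notin> \<real> \<and> \<Lambda> = {of_int a * \<omega>1 + of_int b * \<omega>2 | a b. True})"

text \<open>An elliptic curve over the complex numbers is a complex torus \<open>E = \<complex> / \<Lambda>\<close>.  Its points are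
  the cosets of \<open>\<Lambda>\<close>, and \<open>torus_proj \<Lambda>\<close> is the quotient map, which is a local biholomorphism for
  the complex structure of \<open>E\<close>; so holomorphy of maps on \<open>E\<close> is tested on local lifts.\<close>

definition torus_proj :: "complex set \<Rightarrow> complex \<Rightarrow> complex set" where
  "torus_proj \<Lambda> z = (+) z ` \<Lambda>"

definition torus :: "complex set \<Rightarrow> complex set set" where
  "torus \<Lambda> = range (torus_proj \<Lambda>)"

definition torus_endomorphism :: "complex set \<Rightarrow> (complex set \<Rightarrow> complex set) \<Rightarrow> bool" where
  "torus_endomorphism \<Lambda> g \<longleftrightarrow>
     (\<forall>z. \<exists>U G. open U \<and> z \<in> U \<and> G holomorphic_on U \<and>
        (\<forall>w\<in>U. g (torus_proj \<Lambda> w) = torus_proj \<Lambda> (G w)))"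

definition torus_to_P1_morphism :: "complex set \<Rightarrow> (complex set \<Rightarrow> P1) \<Rightarrow> bool" where
  "torus_to_P1_morphism \<Lambda> \<pi> \<longleftrightarrow> holomorphic_to_P1 (\<pi> \<circ> torus_proj \<Lambda>)"

definition is_Lattes :: "(P1 \<Rightarrow> P1) \<Rightarrow> bool" where
  "is_Lattes f \<longleftrightarrow>
     (\<exists>d\<ge>2. P1_morphism_of_degree f d) \<and>
     (\<exists>\<Lambda> g \<pi>. is_lattice \<Lambda> \<and> torus_endomorphism \<Lambda> g \<and> torus_to_P1_morphism \<Lambda> \<pi> \<and>
        \<not> \<pi> constant_on torus \<Lambda> \<and> (\<forall>x\<in>torus \<Lambda>. f (\<pi> x) = \<pi> (g x)))"

definition is_monomial_type :: "(P1 \<Rightarrow> P1) \<Rightarrow> bool" where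
  "is_monomial_type f \<longleftrightarrow>
     (\<exists>d\<ge>2. P1_morphism_of_degree f d) \<and>
     (\<exists>n \<pi>. \<bar>n\<bar> \<ge> 2 \<and> P1_morphism \<pi> \<and> \<not> \<pi> constant_on UNIV \<and>
        (\<forall>z. f (\<pi> z) = \<pi> (power_map n z)))"

definition is_exceptional :: "(P1 \<Rightarrow> P1) \<Rightarrow> bool" where
  "is_exceptional f \<longleftrightarrow> is_Lattes f \<or> is_monomial_type f"

section \<open>Conformal expanding repellers\<close>

text \<open>The norm of \<open>df\<close> at \<open>x\<close> for the spherical metric, which is \<open>2 |dt| / (1 + |t|\<^sup>2)\<close> in both
  coordinates \<open>t = z\<close> and \<open>t = 1/z\<close>.  The map \<open>F\<close> is \<open>f\<close> written in coordinates around \<open>x\<close> and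
  \<open>f x\<close>.\<close>

definition spherical_deriv :: "(P1 \<Rightarrow> P1) \<Rightarrow> P1 \<Rightarrow> real" where
  "spherical_deriv f x =
     (let chart = (\<lambda>y. if y = Infty then coord_inf else coord);
          param = (\<lambda>y. if y = Infty then Aff_inf else Aff);
          t = chart x x;
          F = chart (f x) \<circ> f \<circ> param x
      in cmod (deriv F t) * (1 + (cmod t)\<^sup>2) / (1 + (cmod (F t))\<^sup>2))"

definition is_CER :: "(P1 \<Rightarrow> P1) \<Rightarrow> P1 set \<Rightarrow> bool" where
  "is_CER f K \<longleftrightarrow> compact K \<and>
     (\<exists>m\<ge>1.
        (\<exists>V. K \<subseteq> interior V \<and> (f ^^ m) ` K = K \<and> K = (\<Inter>n. (f ^^ (m * n)) -` V)) \<and>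
        (\<exists>C>0. \<exists>\<rho>>1. \<forall>x\<in>K. \<forall>n\<ge>1. spherical_deriv (f ^^ (n * m)) x \<ge> C * \<rho> ^ n) \<and>
        (\<forall>U. openin (top_of_set K) U \<and> U \<noteq> {} \<longrightarrow> (\<exists>n. (f ^^ (m * n)) ` U = K)))"

definition locally_constant_on :: "'a::topological_space set \<Rightarrow> ('a \<Rightarrow> 'b) \<Rightarrow> bool" where
  "locally_constant_on S h \<longleftrightarrow>
     (\<forall>x\<in>S. \<exists>U. openin (top_of_set S) U \<and> x \<in> U \<and> (\<forall>y\<in>U. h y = h x))"

definition log_deriv_cohomologous_locally_constant :: "(P1 \<Rightarrow> P1) \<Rightarrow> P1 set \<Rightarrow> bool" where
  "log_deriv_cohomologous_locally_constant f K \<longleftrightarrow>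
     (\<exists>u :: P1 \<Rightarrow> real. continuous_on K u \<and>
        locally_constant_on K (\<lambda>x. ln (spherical_deriv f x) - (u (f x) - u x)))"

text \<open>For \<open>x\<close> in the appropriate domain, \<open>\<phi> j x\<close> ranges over the domain of definition of
  \<open>\<phi>\<^sub>i \<circ> \<phi>\<^sub>j\<^sup>-\<^sup>1\<close>, respectively of \<open>\<phi>\<^sub>i \<circ> f \<circ> \<phi>\<^sub>j\<^sup>-\<^sup>1\<close>.\<close>

definition has_affine_atlas :: "(P1 \<Rightarrow> P1) \<Rightarrow> P1 set \<Rightarrow> bool" where
  "has_affine_atlas f K \<longleftrightarrow>
     (\<exists>(k::nat) V \<phi>.
        (\<forall>i<k. open (V i) \<and> P1_holomorphic_on (\<phi> i) (V i) \<and> inj_on (\<phi> i) (V i)) \<and>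
        K \<subseteq> (\<Union>i<k. V i) \<and>
        (\<forall>i<k. \<forall>j<k. \<exists>a b. \<forall>x \<in> V j \<inter> V i. \<phi> i x = a * \<phi> j x + b) \<and>
        (\<forall>i<k. \<forall>j<k. \<exists>a b. \<forall>x \<in> V j \<inter> f -` V i. \<phi> i (f x) = a * \<phi> j x + b))"

definition is_linear_CER :: "(P1 \<Rightarrow> P1) \<Rightarrow> P1 set \<Rightarrow> bool" where
  "is_linear_CER f K \<longleftrightarrow> is_CER f K \<and> f ` K = K \<and>
     (log_deriv_cohomologous_locally_constant f K \<or> has_affine_atlas f K)"

end

theory Submission
  imports Defs
begin

text \<open>
  The repeller contains a repelling periodic point.  Let \<open>\<psi> : \<complex> \<rightarrow> P\<^sup>1\<close> be its Poincare function,
  \<open>\<psi> (\<rho> z) = f\<^sup>q (\<psi> z)\<close>.  Linearity of the repeller makes every return map to the base point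
  affine in the coordinate \<open>z\<close>, so that \<open>f\<^sup>N (\<psi> z) = \<psi> (a (z - y))\<close> near, and hence for all
  \<open>z\<close>, whenever \<open>\<psi> y\<close> is a point of the repeller close to the base point with
  \<open>f\<^sup>N (\<psi> y) = \<psi> 0\<close>.  Comparing such an identity with the functional equation gives affine
  symmetries of \<open>\<psi>\<close> that do not fix \<open>0\<close>; a commutator with multiplication by \<open>\<rho>\<close> is a
  translation.  Comparing consecutive values of \<open>N\<close> gives an affine map \<open>A\<close> with
  \<open>f \<circ> \<psi> = \<psi> \<circ> A\<close>.  If the periods of \<open>\<psi>\<close> form a lattice, \<open>f\<close> is Lattes.

  Otherwise, after normalisation, the periods are the integers and \<open>f (\<psi> z) = \<psi> (n z)\<close>.
  If \<open>\<psi> \<circ> \<kappa> = \<psi>\<close> for a local map \<open>\<kappa>\<close> with \<open>\<kappa> z\<close> real, then rescaling by the powers of \<open>n\<close>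
  shows that \<open>\<kappa>' z\<close> is a period; so \<open>\<kappa>\<close> is affine with slope 1 or -1, and the fibres of \<open>\<psi>\<close>
  over real points have at most two classes modulo the integers.  By the great Picard theorem
  \<open>\<psi>\<close> is a rational function of \<open>exp (2 \<pi> \<i> z)\<close>, and \<open>f\<close> is of monomial type.
\<close>

section \<open>Charts and holomorphic maps to the projective line\<close>

text \<open>The two forms of linearity are treated separately, without passing from one to the
  other. With an atlas, a chart turning multiplication by \<rho> into an affine map is itself affine
  in \<open>z\<close>. The cohomological form is the obstacle: it only says that an inverse return
  \<open>\<theta>\<close> has |\<theta>'| constant on the trace \<open>E\<close> of \<open>K\<close>
  in the coordinate \<open>z\<close>, possibly a thin set. What helps is that \<open>E\<close> is
  stable near 0 under division by \<rho>: if \<theta>' were not constant, \<open>E\<close> would lie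
  on a line through 0, where \<theta>' is real up to a constant factor and so constant after all.
  Exactness gives returns at every large time \<open>N\<close>; comparing a multiple of the period
  of the base point with its successor is what yields \<open>f\<close> itself and not merely an
  iterate. Returns through 0 are excluded so that the symmetries move 0. In the singly periodic case
  real points are special because their orbits under multiplication by \<open>n\<close> stay bounded
  modulo the integers. Three real values with small fibres suffice for Picard: one is sent to
  infinity, the other two are omitted near both ends of the punctured plane.\<close>

definition proj :: "complex \<Rightarrow> complex \<Rightarrow> P1" where
  "proj a b = (if b = 0 then Infty else Aff (a / b))"

text \<open>The chart \<open>mob p\<close> maps the plane onto the complement of \<open>p\<close>; for \<open>p = Aff c\<close> it is
  \<open>z \<mapsto> c + 1 / z\<close>.  The value \<open>mob_inv p p = 0\<close> is junk.\<close>

definition mob :: "P1 \<Rightarrow> complex \<Rightarrow> P1" where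
  "mob p z = (case p of Infty \<Rightarrow> proj z 1 | Aff c \<Rightarrow> proj (c * z + 1) z)"

definition mob_inv :: "P1 \<Rightarrow> P1 \<Rightarrow> complex" where
  "mob_inv p x = (case p of Infty \<Rightarrow> coord x
     | Aff c \<Rightarrow> (case x of Infty \<Rightarrow> 0 | Aff z \<Rightarrow> 1 / (z - c)))"

lemma Aff_inf_eq_proj: "Aff_inf w = proj 1 w"
  by (simp add: proj_def Aff_inf_def)

lemma mob_Infty: "mob Infty = Aff"
  by (auto simp: mob_def proj_def)

lemma mob_Aff_0: "mob (Aff 0) = Aff_inf"
  by (auto simp: mob_def Aff_inf_eq_proj)

lemma mob_ne [simp]: "mob p z \<noteq> p"
  by (auto simp: mob_def proj_def divide_simps split: P1.split)

lemma mob_inv_mob [simp]: "mob_inv p (mob p z) = z"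
  by (cases p; cases "z = 0") (auto simp: mob_def mob_inv_def proj_def divide_simps)

lemma mob_mob_inv [simp]: "x \<noteq> p \<Longrightarrow> mob p (mob_inv p x) = x"
  by (cases p; cases x) (auto simp: mob_def mob_inv_def proj_def divide_simps)

lemma mob_inv_inject:
  assumes "x \<noteq> p" "y \<noteq> p" "mob_inv p x = mob_inv p y"
  shows "x = y"
  using mob_mob_inv[OF assms(1)] mob_mob_inv[OF assms(2)] unfolding assms(3) by (rule trans[OF sym])

lemma inj_mob [simp]: "inj_on (mob p) S"
  by (metis inj_onI mob_inv_mob)

lemma mob_eq_iff [simp]: "mob p z = mob p w \<longleftrightarrow> z = w"
  by (metis mob_inv_mob)

lemma range_mob: "range (mob p) = - {p}"
proof (intro equalityI subsetI)
  fix x assume "x \<in> - {p}"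
  then have "x = mob p (mob_inv p x)" by simp
  then show "x \<in> range (mob p)" by (rule range_eqI)
qed auto

lemma mob_image_iff: "x \<in> mob p ` W \<longleftrightarrow> x \<noteq> p \<and> mob_inv p x \<in> W"
proof
  assume "x \<noteq> p \<and> mob_inv p x \<in> W"
  then have "x = mob p (mob_inv p x)" "mob_inv p x \<in> W" by simp_all
  then show "x \<in> mob p ` W" by (rule image_eqI)
qed auto

text \<open>Homogeneous coordinates of \<open>mob p\<close>, polynomial of degree at most 1 and with
  Wronskian 1 or -1; this is why the speed of \<open>mob p\<close> will be a bare
  reciprocal.\<close>

definition mob_num :: "P1 \<Rightarrow> complex \<Rightarrow> complex" where
  "mob_num p z = (case p of Infty \<Rightarrow> z | Aff c \<Rightarrow> c * z + 1)"

definition mob_den :: "P1 \<Rightarrow> complex \<Rightarrow> complex" where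
  "mob_den p z = (case p of Infty \<Rightarrow> 1 | Aff c \<Rightarrow> z)"

lemma mob_eq_proj: "mob p z = proj (mob_num p z) (mob_den p z)"
  by (auto simp: mob_def mob_num_def mob_den_def split: P1.split)

lemma mob_num_den_nonzero: "mob_num p z \<noteq> 0 \<or> mob_den p z \<noteq> 0"
  by (auto simp: mob_num_def mob_den_def split: P1.split)

lemma mob_inv_proj:
  assumes "a \<noteq> 0 \<or> b \<noteq> 0"
  shows "mob_inv p (proj a b) = (case p of Infty \<Rightarrow> a / b | Aff c \<Rightarrow> b / (a - c * b))"
    and "proj a b = p \<longleftrightarrow> (case p of Infty \<Rightarrow> b = 0 | Aff c \<Rightarrow> a - c * b = 0)"
  using assms by (auto simp: mob_inv_def proj_def divide_simps split: P1.split)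

text \<open>Holomorphy is encoded by local lifts to a pair without common zero, so poles need no
  case distinction and rational maps act by homogeneous polynomials. The pair lives on a
  neighbourhood of each point, so \<open>P1hol \<psi> {z}\<close> speaks of the germ at
  \<open>z\<close>.\<close>

definition P1hol :: "(complex \<Rightarrow> P1) \<Rightarrow> complex set \<Rightarrow> bool" where
  "P1hol \<psi> S \<longleftrightarrow> (\<forall>z\<in>S. \<exists>U P Q. open U \<and> z \<in> U \<and> P holomorphic_on U \<and> Q holomorphic_on U \<and>
     (\<forall>w\<in>U. (P w \<noteq> 0 \<or> Q w \<noteq> 0) \<and> \<psi> w = proj (P w) (Q w)))"

lemma P1holE:
  assumes "P1hol \<psi> S" "z \<in> S"
  obtains U P Q where "open U" "z \<in> U" "P holomorphic_on U" "Q holomorphic_on U"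
    "\<And>w. w \<in> U \<Longrightarrow> P w \<noteq> 0 \<or> Q w \<noteq> 0" "\<And>w. w \<in> U \<Longrightarrow> \<psi> w = proj (P w) (Q w)"
proof -
  from assms obtain U P Q where "open U \<and> z \<in> U \<and> P holomorphic_on U \<and> Q holomorphic_on U \<and>
     (\<forall>w\<in>U. (P w \<noteq> 0 \<or> Q w \<noteq> 0) \<and> \<psi> w = proj (P w) (Q w))"
    unfolding P1hol_def by (elim ballE exE) auto
  then show thesis
    by (elim conjE) (rule that, assumption+, simp_all)
qed

lemma P1hol_pointI:
  assumes "open U" "z \<in> U" "P holomorphic_on U" "Q holomorphic_on U"
    "\<And>w. w \<in> U \<Longrightarrow> P w \<noteq> 0 \<or> Q w \<noteq> 0" "\<And>w. w \<in> U \<Longrightarrow> \<psi> w = proj (P w) (Q w)"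
  shows "P1hol \<psi> {z}"
  unfolding P1hol_def
  by (rule ballI, rule exI[of _ U], rule exI[of _ P], rule exI[of _ Q]) (use assms in simp)

lemma P1hol_pointwise: "(\<And>z. z \<in> S \<Longrightarrow> P1hol \<psi> {z}) \<Longrightarrow> P1hol \<psi> S"
  unfolding P1hol_def by blast

lemma P1hol_subset: "P1hol \<psi> S \<Longrightarrow> T \<subseteq> S \<Longrightarrow> P1hol \<psi> T"
  unfolding P1hol_def by blast

lemma P1hol_proj:
  assumes "open S" "P holomorphic_on S" "Q holomorphic_on S" "\<And>w. w \<in> S \<Longrightarrow> P w \<noteq> 0 \<or> Q w \<noteq> 0"
  shows "P1hol (\<lambda>w. proj (P w) (Q w)) S"
  by (rule P1hol_pointwise, rule P1hol_pointI[OF assms(1) _ assms(2,3)]) (use assms in auto)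

lemma P1hol_compose:
  assumes "P1hol \<psi> T" "g holomorphic_on S" "open S" "g ` S \<subseteq> T"
  shows "P1hol (\<psi> \<circ> g) S"
proof (rule P1hol_pointwise)
  fix z assume z: "z \<in> S"
  with assms have "g z \<in> T" by auto
  from P1holE[OF assms(1) this] obtain U P Q where U: "open U" "g z \<in> U" "P holomorphic_on U"
    "Q holomorphic_on U" "\<And>w. w \<in> U \<Longrightarrow> P w \<noteq> 0 \<or> Q w \<noteq> 0" "\<And>w. w \<in> U \<Longrightarrow> \<psi> w = proj (P w) (Q w)"
    by metis
  let ?W = "S \<inter> g -` U"
  have o: "open ?W"
    using assms(2,3) U(1) continuous_on_open_vimage holomorphic_on_imp_continuous_on
    by (metis inf_commute)
  have gW: "g holomorphic_on ?W"
    using assms(2) by (rule holomorphic_on_subset) auto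
  show "P1hol (\<psi> \<circ> g) {z}"
    by (rule P1hol_pointI[OF o _ holomorphic_on_compose_gen[OF gW U(3)] holomorphic_on_compose_gen[OF gW U(4)]])
      (use z U in auto)
qed

lemma mob_num_holomorphic [holomorphic_intros]: "mob_num p holomorphic_on S"
  and mob_den_holomorphic [holomorphic_intros]: "mob_den p holomorphic_on S"
  by (cases p; simp add: mob_num_def[abs_def] mob_den_def[abs_def]; intro holomorphic_intros)+

lemma P1hol_mob: "P1hol (mob p) S"
proof (rule P1hol_subset)
  show "P1hol (mob p) UNIV"
    unfolding mob_eq_proj[abs_def]
    by (rule P1hol_proj) (use mob_num_den_nonzero in \<open>auto intro: holomorphic_intros\<close>)
qed auto

lemma P1hol_mob_comp:
  assumes "g holomorphic_on S" "open S"
  shows "P1hol (\<lambda>z. mob p (g z)) S"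
  using P1hol_compose[OF P1hol_mob[of p UNIV] assms] by (simp add: o_def)

text \<open>The bridge to scalar function theory: in the chart missing \<open>p\<close> the map is a
  quotient A / B whose denominator vanishes exactly where \<psi> takes the value
  \<open>p\<close>.\<close>

lemma P1hol_mob_inv:
  assumes "P1hol \<psi> S" "open S"
  shows "open {z\<in>S. \<psi> z \<noteq> p}" and "(\<lambda>z. mob_inv p (\<psi> z)) holomorphic_on {z\<in>S. \<psi> z \<noteq> p}"
proof -
  have *: "\<exists>U. open U \<and> z \<in> U \<and> U \<subseteq> {z\<in>S. \<psi> z \<noteq> p} \<and> (\<lambda>z. mob_inv p (\<psi> z)) holomorphic_on U"
    if z: "z \<in> S" "\<psi> z \<noteq> p" for z
  proof -
    from P1holE[OF assms(1) z(1)] obtain U P Q where U: "open U" "z \<in> U" "P holomorphic_on U"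
      "Q holomorphic_on U" "\<And>w. w \<in> U \<Longrightarrow> P w \<noteq> 0 \<or> Q w \<noteq> 0" "\<And>w. w \<in> U \<Longrightarrow> \<psi> w = proj (P w) (Q w)"
      by metis
    define A where "A = (\<lambda>w. case p of Infty \<Rightarrow> P w | Aff c \<Rightarrow> Q w)"
    define B where "B = (\<lambda>w. case p of Infty \<Rightarrow> Q w | Aff c \<Rightarrow> P w - c * Q w)"
    have A: "A holomorphic_on U" and B: "B holomorphic_on U"
      using U by (cases p; auto simp: A_def B_def intro!: holomorphic_intros)+
    have eqB: "\<psi> w = p \<longleftrightarrow> B w = 0" if "w \<in> U" for w
      using mob_inv_proj(2)[OF U(5)[OF that], of p] U(6)[OF that]
      by (auto simp: B_def split: P1.split)
    have eqA: "mob_inv p (\<psi> w) = A w / B w" if "w \<in> U" for w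
      using mob_inv_proj(1)[OF U(5)[OF that], of p] U(6)[OF that]
      by (auto simp: A_def B_def split: P1.split)
    let ?W = "S \<inter> (U \<inter> B -` (- {0}))"
    have o: "open ?W"
      by (intro open_Int assms(2) continuous_open_preimage holomorphic_on_imp_continuous_on[OF B] U) auto
    show ?thesis
    proof (intro exI[of _ ?W] conjI o)
      show "z \<in> ?W" using z U eqB[of z] by auto
      show "?W \<subseteq> {z\<in>S. \<psi> z \<noteq> p}" using eqB by auto
      have "(\<lambda>w. A w / B w) holomorphic_on ?W"
        by (intro holomorphic_intros holomorphic_on_subset[OF A] holomorphic_on_subset[OF B]) auto
      then show "(\<lambda>z. mob_inv p (\<psi> z)) holomorphic_on ?W"
        by (rule holomorphic_transform) (use eqA in auto)
    qed
  qed
  show 1: "open {z\<in>S. \<psi> z \<noteq> p}"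
    unfolding open_subopen[of "{z\<in>S. \<psi> z \<noteq> p}"] using * by blast
  show "(\<lambda>z. mob_inv p (\<psi> z)) holomorphic_on {z\<in>S. \<psi> z \<noteq> p}"
    unfolding holomorphic_on_open[OF 1]
  proof
    fix z assume "z \<in> {z\<in>S. \<psi> z \<noteq> p}"
    with *[of z] obtain U where "open U" "z \<in> U" "(\<lambda>z. mob_inv p (\<psi> z)) holomorphic_on U"
      by auto
    then show "\<exists>f'. ((\<lambda>z. mob_inv p (\<psi> z)) has_field_derivative f') (at z)"
      using holomorphic_on_open by blast
  qed
qed

lemma holomorphic_to_P1I:
  assumes "P1hol \<psi> UNIV"
  shows "holomorphic_to_P1 \<psi>"
  unfolding holomorphic_to_P1_def
proof
  fix z
  have 1: "coord \<circ> \<psi> = (\<lambda>z. mob_inv Infty (\<psi> z))"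
    by (auto simp: mob_inv_def)
  have 2: "coord_inf x = mob_inv (Aff 0) x" for x
    by (cases x) (auto simp: mob_inv_def)
  have 2: "coord_inf \<circ> \<psi> = (\<lambda>z. mob_inv (Aff 0) (\<psi> z))"
    by (auto simp: 2)
  note * = P1hol_mob_inv[OF assms open_UNIV]
  show "\<exists>U. open U \<and> z \<in> U \<and> (Infty \<notin> \<psi> ` U \<and> coord \<circ> \<psi> holomorphic_on U \<or>
       Aff 0 \<notin> \<psi> ` U \<and> coord_inf \<circ> \<psi> holomorphic_on U)"
  proof (cases "\<psi> z = Infty")
    case True
    then show ?thesis
      using *[of "Aff 0"] unfolding 2 by (intro exI[of _ "{z\<in>UNIV. \<psi> z \<noteq> Aff 0}"]) auto
  next
    case False
    then show ?thesis
      using *[of Infty] unfolding 1 by (intro exI[of _ "{z\<in>UNIV. \<psi> z \<noteq> Infty}"]) auto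
  qed
qed

section \<open>Topology of the projective line\<close>

lemma P1_open_iff: "open (U :: P1 set) \<longleftrightarrow> open (Aff -` U) \<and> open (Aff_inf -` U)"
  by (simp add: open_P1_def)

lemma open_mob_image:
  assumes "open W"
  shows "open (mob p ` W)"
proof -
  have *: "open (mob q -` (mob p ` W))" for q
  proof -
    have "mob q -` (mob p ` W) = {z\<in>UNIV. mob q z \<noteq> p} \<inter> (\<lambda>z. mob_inv p (mob q z)) -` W"
      by (simp add: set_eq_iff mob_image_iff)
    moreover have "open \<dots>"
      by (intro continuous_open_preimage holomorphic_on_imp_continuous_on
          P1hol_mob_inv[OF P1hol_mob] assms) auto
    ultimately show ?thesis by simp
  qed
  show ?thesis
    unfolding P1_open_iff using *[of Infty] *[of "Aff 0"] by (simp add: mob_Infty mob_Aff_0)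
qed

text \<open>Any two points lie in a common chart, the one missing a third point.\<close>

lemma ex_not_in_pair: "\<exists>p::P1. p \<noteq> x \<and> p \<noteq> y"
proof -
  have "infinite (range Aff)"
    by (simp add: inj_def finite_image_iff infinite_UNIV_char_0)
  then have "\<not> range Aff \<subseteq> {x, y}"
    using finite_subset by blast
  then obtain p where "p \<notin> {x, y}" by (meson subsetI)
  then show ?thesis by blast
qed

instance P1 :: t2_space
proof
  fix x y :: P1
  assume xy: "x \<noteq> y"
  obtain p where p: "p \<noteq> x" "p \<noteq> y"
    using ex_not_in_pair by blast
  have "mob_inv p x \<noteq> mob_inv p y"
  proof
    assume "mob_inv p x = mob_inv p y"
    then have "mob p (mob_inv p x) = mob p (mob_inv p y)" by simp
    then show False
      using xy mob_mob_inv[OF p(1)[symmetric]] mob_mob_inv[OF p(2)[symmetric]] by simp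
  qed
  from hausdorff[OF this] obtain U V where UV: "open U" "open V" "mob_inv p x \<in> U" "mob_inv p y \<in> V" "U \<inter> V = {}"
    by (elim exE conjE)
  have "mob p ` U \<inter> mob p ` V = {}"
    unfolding image_Int[OF inj_mob, symmetric] UV(5) by simp
  moreover have "x \<in> mob p ` U" "y \<in> mob p ` V"
    unfolding mob_image_iff using UV(3,4) p(1,2) by (simp_all add: not_sym)
  ultimately show "\<exists>U V. open U \<and> open V \<and> x \<in> U \<and> y \<in> V \<and> U \<inter> V = {}"
    using open_mob_image[OF UV(1)] open_mob_image[OF UV(2)] by (intro exI conjI)
qed

lemma P1_open_mob_vimage:
  assumes "open (U :: P1 set)"
  shows "open (mob p -` U)"
proof -
  have *: "open ({z\<in>UNIV. mob p z \<noteq> q} \<inter> (\<lambda>z. mob_inv q (mob p z)) -` (mob q -` U))"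
    if "open (mob q -` U)" for q
    by (intro continuous_open_preimage holomorphic_on_imp_continuous_on
        P1hol_mob_inv[OF P1hol_mob] that) auto
  have eq: "{z\<in>UNIV. mob p z \<noteq> q} \<inter> (\<lambda>z. mob_inv q (mob p z)) -` (mob q -` U) =
    mob p -` U \<inter> {z. mob p z \<noteq> q}" for q
    by auto
  have "open (mob Infty -` U)" "open (mob (Aff 0) -` U)"
    using assms by (simp_all add: mob_Infty mob_Aff_0 P1_open_iff)
  then have "open ((mob p -` U \<inter> {z. mob p z \<noteq> Infty}) \<union> (mob p -` U \<inter> {z. mob p z \<noteq> Aff 0}))"
    using *[of Infty] *[of "Aff 0"] unfolding eq by (intro open_Un)
  also have "(mob p -` U \<inter> {z. mob p z \<noteq> Infty}) \<union> (mob p -` U \<inter> {z. mob p z \<noteq> Aff 0}) = mob p -` U"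
    by auto
  finally show ?thesis .
qed

lemma continuous_on_mob: "continuous_on S (mob p)"
  using continuous_on_open_vimage[OF open_UNIV, of "mob p"] P1_open_mob_vimage continuous_on_subset
  by (metis inf_top_right subset_UNIV)

lemma continuous_on_mob_inv: "continuous_on (- {p}) (mob_inv p)"
proof -
  have o: "open (- {p})"
    using open_mob_image[OF open_UNIV, of p] by (simp add: range_mob)
  have "mob_inv p -` W \<inter> - {p} = mob p ` W" for W
    by (auto simp: set_eq_iff mob_image_iff)
  then show ?thesis
    using open_mob_image continuous_on_open_vimage[OF o, of "mob_inv p"] by simp
qed

lemma P1hol_continuous:
  assumes "P1hol \<psi> S" "open S"
  shows "continuous_on S \<psi>"
  unfolding continuous_on_open_vimage[OF assms(2)]
proof (intro allI impI)
  fix B :: "P1 set" assume B: "open B"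
  have eq: "\<psi> -` B \<inter> S = (\<Union>p\<in>{Infty, Aff 0}. {z\<in>S. \<psi> z \<noteq> p} \<inter> (\<lambda>z. mob_inv p (\<psi> z)) -` (mob p -` B))"
  proof (rule set_eqI)
    fix z show "z \<in> \<psi> -` B \<inter> S \<longleftrightarrow> z \<in> (\<Union>p\<in>{Infty, Aff 0}. {z\<in>S. \<psi> z \<noteq> p} \<inter> (\<lambda>z. mob_inv p (\<psi> z)) -` (mob p -` B))"
      by (cases "\<psi> z = Infty") auto
  qed
  show "open (\<psi> -` B \<inter> S)"
    unfolding eq
    by (intro open_UN ballI continuous_open_preimage holomorphic_on_imp_continuous_on
        P1hol_mob_inv[OF assms] P1_open_mob_vimage[OF B])
qed

lemma P1hol_local_chart:
  assumes "P1hol \<psi> S" "open S" "z \<in> S" "\<psi> z \<noteq> p"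
  obtains e where "e > 0" "ball z e \<subseteq> S" "(\<lambda>w. mob_inv p (\<psi> w)) holomorphic_on ball z e"
    "\<And>w. w \<in> ball z e \<Longrightarrow> \<psi> w \<noteq> p"
proof -
  note * = P1hol_mob_inv[OF assms(1,2), of p]
  obtain e where "e > 0" "ball z e \<subseteq> {z \<in> S. \<psi> z \<noteq> p}"
    using *(1) assms(3,4) open_contains_ball by (metis (mono_tags, lifting) mem_Collect_eq)
  then show ?thesis
    using that holomorphic_on_subset[OF *(2)] by blast
qed

lemma P1hol_cong:
  assumes "P1hol \<psi> S" "open S" "\<And>z. z \<in> S \<Longrightarrow> \<psi> z = \<phi> z"
  shows "P1hol \<phi> S"
proof (rule P1hol_pointwise)
  fix z assume "z \<in> S"
  from P1holE[OF assms(1) this] obtain U P Q where U: "open U" "z \<in> U" "P holomorphic_on U"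
      "Q holomorphic_on U" "\<And>w. w \<in> U \<Longrightarrow> P w \<noteq> 0 \<or> Q w \<noteq> 0" "\<And>w. w \<in> U \<Longrightarrow> \<psi> w = proj (P w) (Q w)"
    by metis
  show "P1hol \<phi> {z}"
  proof (rule P1hol_pointI[of "U \<inter> S" z P Q])
    show "open (U \<inter> S)" using U(1) assms(2) by (rule open_Int)
    show "z \<in> U \<inter> S" using U(2) \<open>z \<in> S\<close> by simp
    show "P holomorphic_on U \<inter> S" "Q holomorphic_on U \<inter> S"
      using U(3,4) holomorphic_on_subset by blast+
    show "P w \<noteq> 0 \<or> Q w \<noteq> 0" "\<phi> w = proj (P w) (Q w)" if "w \<in> U \<inter> S" for w
      using U(5)[of w] U(6)[of w] assms(3)[of w] that by auto
  qed
qed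

section \<open>Identity theorem for maps into the projective line\<close>

lemma islimpt_Int_open:
  fixes x :: "'a::topological_space"
  assumes "x islimpt E" "open U" "x \<in> U"
  shows "x islimpt (E \<inter> U)"
proof (rule islimptI)
  fix T assume "x \<in> T" "open T"
  then have "x \<in> T \<inter> U" "open (T \<inter> U)" using assms(2,3) by auto
  from islimptE[OF assms(1) this] obtain y where "y \<in> E" "y \<in> T \<inter> U" "y \<noteq> x" by metis
  then show "\<exists>y\<in>E \<inter> U. y \<in> T \<and> y \<noteq> x" by blast
qed

lemma P1hol_coincidence_closed:
  assumes hol: "P1hol \<psi> S" "P1hol \<phi> S" and S: "open S"
    and x: "x \<in> S" "x islimpt {z\<in>S. \<psi> z = \<phi> z}"
  shows "\<psi> x = \<phi> x"
proof (rule ccontr)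
  assume "\<psi> x \<noteq> \<phi> x"
  from hausdorff[OF this] obtain U V where UV: "open U" "open V" "\<psi> x \<in> U" "\<phi> x \<in> V" "U \<inter> V = {}"
    by (elim exE conjE)
  have "open ((S \<inter> \<psi> -` U) \<inter> (S \<inter> \<phi> -` V))"
    by (intro open_Int continuous_open_preimage P1hol_continuous hol S UV)
  moreover have "x \<in> (S \<inter> \<psi> -` U) \<inter> (S \<inter> \<phi> -` V)" using x UV by simp
  ultimately obtain y where "y \<in> {z\<in>S. \<psi> z = \<phi> z}" "y \<in> (S \<inter> \<psi> -` U) \<inter> (S \<inter> \<phi> -` V)"
    using islimptE[OF x(2)] by metis
  then show False using UV(5) by auto
qed

lemma P1hol_identity_local:
  assumes hol: "P1hol \<psi> S" "P1hol \<phi> S" and S: "open S"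
    and x: "x \<in> S" "x islimpt {z\<in>S. \<psi> z = \<phi> z}"
  shows "\<exists>e>0. ball x e \<subseteq> {z\<in>S. \<psi> z = \<phi> z}"
proof -
  define E where "E = {z\<in>S. \<psi> z = \<phi> z}"
  obtain p where p: "p \<noteq> \<psi> x" using ex_not_in_pair by blast
  have p2: "\<phi> x \<noteq> p" "\<psi> x \<noteq> p"
    using P1hol_coincidence_closed[OF assms] p by simp_all
  obtain e2 where e2: "e2 > 0" "ball x e2 \<subseteq> S" "(\<lambda>w. mob_inv p (\<phi> w)) holomorphic_on ball x e2"
    "\<And>w. w \<in> ball x e2 \<Longrightarrow> \<phi> w \<noteq> p"
    by (rule P1hol_local_chart[OF hol(2) S x(1) p2(1)]) (rule that)
  obtain e1 where e1: "e1 > 0" "ball x e1 \<subseteq> S" "(\<lambda>w. mob_inv p (\<psi> w)) holomorphic_on ball x e1"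
    "\<And>w. w \<in> ball x e1 \<Longrightarrow> \<psi> w \<noteq> p"
    by (rule P1hol_local_chart[OF hol(1) S x(1) p2(2)]) (rule that)
  define e where "e = min e1 e2"
  have sub: "ball x e \<subseteq> ball x e1" "ball x e \<subseteq> ball x e2" by (auto simp: e_def)
  have e: "e > 0" using e1 e2 by (auto simp: e_def)
  have lim: "x islimpt (E \<inter> ball x e)"
    unfolding E_def by (rule islimpt_Int_open[OF x(2) open_ball]) (use e in simp)
  have hd: "(\<lambda>w. mob_inv p (\<psi> w) - mob_inv p (\<phi> w)) holomorphic_on ball x e"
    using holomorphic_on_subset[OF e1(3) sub(1)] holomorphic_on_subset[OF e2(3) sub(2)]
    by (intro holomorphic_on_diff)
  have eq: "\<psi> w = \<phi> w" if w: "w \<in> ball x e" for w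
  proof -
    have "mob_inv p (\<psi> w) - mob_inv p (\<phi> w) = 0"
      by (rule analytic_continuation[OF hd open_ball connected_ball _ _ lim _ w])
        (use e in \<open>auto simp: E_def\<close>)
    then have "mob p (mob_inv p (\<psi> w)) = mob p (mob_inv p (\<phi> w))" by simp
    moreover have w12: "w \<in> ball x e1" "w \<in> ball x e2" using w sub by blast+
    ultimately show ?thesis
      using mob_mob_inv[OF e1(4)[OF w12(1)]] mob_mob_inv[OF e2(4)[OF w12(2)]] by simp
  qed
  have "ball x e \<subseteq> {z\<in>S. \<psi> z = \<phi> z}"
    using sub(1) e1(2) eq by blast
  then show ?thesis using e by blast
qed

text \<open>Connectedness is applied to the limit points of the coincidence set: they form a closed
  set, and an open one by the local identity theorem. The coincidence set itself need not be
  open.\<close>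

lemma P1hol_identity:
  assumes hol: "P1hol \<psi> S" "P1hol \<phi> S" and S: "open S" "connected S"
    and \<xi>: "\<xi> \<in> S" "\<xi> islimpt {z\<in>S. \<psi> z = \<phi> z}" and z: "z \<in> S"
  shows "\<psi> z = \<phi> z"
proof -
  define E where "E = {z\<in>S. \<psi> z = \<phi> z}"
  define L where "L = {x\<in>S. x islimpt E}"
  have "open L"
    unfolding open_contains_ball
  proof
    fix x assume "x \<in> L"
    then have x: "x \<in> S" "x islimpt {z\<in>S. \<psi> z = \<phi> z}" by (auto simp: L_def E_def)
    obtain e where e: "e > 0" "ball x e \<subseteq> E"
      using P1hol_identity_local[OF hol S(1) x] unfolding E_def by (elim exE conjE)
    have "ball x e \<subseteq> L"
    proof
      fix y assume y: "y \<in> ball x e"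
      have "y islimpt ball x e"
        using y e(1) by (simp add: islimpt_ball)
      then have "y islimpt E" using e(2) by (rule islimpt_subset)
      then show "y \<in> L" using y e by (auto simp: L_def E_def)
    qed
    then show "\<exists>e>0. ball x e \<subseteq> L" using e(1) by blast
  qed
  then have "openin (top_of_set S) L"
    using S(1) by (simp add: openin_open_eq L_def)
  moreover have "closedin (top_of_set S) L"
  proof -
    have "L = S \<inter> {x. x islimpt E}" by (auto simp: L_def)
    then show ?thesis
      using closed_limpts[of E] closedin_closed by metis
  qed
  moreover have "\<xi> \<in> L" using \<xi> by (auto simp: L_def E_def)
  ultimately have "L = S"
    using S(2) unfolding connected_clopen by (metis empty_iff)
  then have "z \<in> L" using z by simp
  then show ?thesis
    using P1hol_coincidence_closed[OF hol S(1) z] by (simp add: L_def E_def)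
qed

lemma P1hol_identity_open:
  assumes "P1hol \<psi> UNIV" "P1hol \<phi> UNIV" "e > 0" "\<And>z. z \<in> ball \<xi> e \<Longrightarrow> \<psi> z = \<phi> z"
  shows "\<psi> = \<phi>"
proof
  fix z
  have "\<xi> islimpt ball \<xi> e" using assms(3) by (simp add: islimpt_ball)
  then have "\<xi> islimpt {z\<in>UNIV. \<psi> z = \<phi> z}"
    by (rule islimpt_subset) (use assms(4) in auto)
  then show "\<psi> z = \<phi> z"
    using P1hol_identity[OF assms(1,2) open_UNIV connected_UNIV UNIV_I _ UNIV_I] by blast
qed

text \<open>Only the stability of holomorphic germs under postcomposition is retained. This passes
  to iterates at once, with no need to track degrees or coprimality of numerators and
  denominators.\<close>

definition P1_endo :: "(P1 \<Rightarrow> P1) \<Rightarrow> bool" where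
  "P1_endo g \<longleftrightarrow> (\<forall>\<psi> z. P1hol \<psi> {z} \<longrightarrow> P1hol (g \<circ> \<psi>) {z})"

lemma P1_endoD: "P1_endo g \<Longrightarrow> P1hol \<psi> S \<Longrightarrow> P1hol (g \<circ> \<psi>) S"
  by (rule P1hol_pointwise) (use P1hol_subset[of \<psi> S] in \<open>simp add: P1_endo_def\<close>)

lemma P1_endo_comp: "P1_endo g \<Longrightarrow> P1_endo h \<Longrightarrow> P1_endo (g \<circ> h)"
  unfolding P1_endo_def by (simp add: comp_assoc)

lemma P1_endo_id: "P1_endo id"
  by (simp add: P1_endo_def)

lemma P1_endo_funpow: "P1_endo g \<Longrightarrow> P1_endo (g ^^ n)"
  by (induction n) (simp_all add: P1_endo_id P1_endo_comp)

definition homog :: "nat \<Rightarrow> complex poly \<Rightarrow> complex \<Rightarrow> complex \<Rightarrow> complex" where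
  "homog d p a b = (\<Sum>i\<le>d. coeff p i * a ^ i * b ^ (d - i))"

lemma homog_1: 
  assumes "degree p \<le> d" 
  shows "homog d p z 1 = poly p z"
proof -
  have "poly p z = (\<Sum>i\<le>degree p. coeff p i * z ^ i)" by (rule poly_altdef)
  also have "\<dots> = (\<Sum>i\<le>d. coeff p i * z ^ i)"
    by (rule sum.mono_neutral_left) (use assms in \<open>auto simp: coeff_eq_0\<close>)
  finally show ?thesis by (simp add: homog_def)
qed

lemma homog_0: "homog d p a 0 = coeff p d * a ^ d"
proof -
  have "homog d p a 0 = (\<Sum>i\<le>d. if i = d then coeff p i * a ^ i else 0)"
    unfolding homog_def by (rule sum.cong) auto
  also have "\<dots> = coeff p d * a ^ d" by simp
  finally show ?thesis .
qed

lemma homog_scale: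
  assumes "b \<noteq> 0"
  shows "homog d p a b = b ^ d * homog d p (a / b) 1"
  unfolding homog_def sum_distrib_left
  by (rule sum.cong) (use assms in \<open>auto simp: field_simps simp flip: power_add\<close>)

text \<open>Coprimality excludes a common zero of the two forms at finite points; at infinity it is
  excluded because one of the polynomials attains the degree \<open>d\<close>.\<close>

lemma rat_map_proj:
  assumes "coprime p q" "a \<noteq> 0 \<or> b \<noteq> 0"
  defines "d \<equiv> max (degree p) (degree q)"
  shows "rat_map p q (proj a b) = proj (homog d p a b) (homog d q a b)"
    and "homog d p a b \<noteq> 0 \<or> homog d q a b \<noteq> 0"
proof -
  have dle: "degree p \<le> d" "degree q \<le> d" by (auto simp: d_def)
  have "rat_map p q (proj a b) = proj (homog d p a b) (homog d q a b) \<and>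
    (homog d p a b \<noteq> 0 \<or> homog d q a b \<noteq> 0)"
  proof (cases "b = 0")
    case True
    then have a: "a \<noteq> 0" using assms by auto
    have pq: "p \<noteq> 0 \<or> q \<noteq> 0" using assms(1) by auto
    have "coeff p d \<noteq> 0 \<or> coeff q d \<noteq> 0"
    proof (cases "degree p = d")
      case True
      show ?thesis
      proof (cases "p = 0")
        case p0: True
        then have "degree q = d" using True dle d_def by simp
        then have "coeff q d = lead_coeff q" by simp
        with pq p0 show ?thesis by simp
      next
        case False
        with True show ?thesis by (metis leading_coeff_0_iff)
      qed
    next
      case False
      then have "degree q = d" "degree q > 0" by (auto simp: d_def)
      then show ?thesis by (metis leading_coeff_0_iff degree_0 less_nat_zero_code)
    qed
    then show ?thesis
      using a True by (auto simp: homog_0 proj_def d_def[symmetric] Let_def)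
  next
    case False
    have "poly p (a / b) \<noteq> 0 \<or> poly q (a / b) \<noteq> 0"
      using assms(1) coprime_poly_0 by blast
    then show ?thesis
      using False by (simp add: homog_scale[OF False] homog_1[OF dle(1)] homog_1[OF dle(2)] proj_def)
  qed
  then show "rat_map p q (proj a b) = proj (homog d p a b) (homog d q a b)"
    and "homog d p a b \<noteq> 0 \<or> homog d q a b \<noteq> 0" by auto
qed

lemma P1_endo_rat_map:
  assumes "coprime p q"
  shows "P1_endo (rat_map p q)"
  unfolding P1_endo_def
proof (intro allI impI)
  fix \<psi> z assume "P1hol \<psi> {z}"
  from P1holE[OF this, of z] obtain U P Q where U: "open U" "z \<in> U" "P holomorphic_on U" "Q holomorphic_on U"
    "\<And>w. w \<in> U \<Longrightarrow> P w \<noteq> 0 \<or> Q w \<noteq> 0" "\<And>w. w \<in> U \<Longrightarrow> \<psi> w = proj (P w) (Q w)"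
    by auto
  let ?d = "max (degree p) (degree q)"
  show "P1hol (rat_map p q \<circ> \<psi>) {z}"
  proof (rule P1hol_pointI[OF U(1,2)])
    show "(\<lambda>w. homog ?d p (P w) (Q w)) holomorphic_on U" "(\<lambda>w. homog ?d q (P w) (Q w)) holomorphic_on U"
      unfolding homog_def by (intro holomorphic_intros U)+
  qed (use rat_map_proj[OF assms U(5)] U(6) in auto)
qed

lemma P1_morphism_endo: "P1_morphism_of_degree f d \<Longrightarrow> P1_endo f"
  unfolding P1_morphism_of_degree_def using P1_endo_rat_map by blast

lemma continuous_on_P1_iff:
  fixes g :: "P1 \<Rightarrow> 'a::topological_space"
  assumes "open S"
  shows "continuous_on S g \<longleftrightarrow> (\<forall>p. continuous_on (mob p -` S) (g \<circ> mob p))"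
proof safe
  fix p assume "continuous_on S g"
  then show "continuous_on (mob p -` S) (g \<circ> mob p)"
    by (intro continuous_on_compose continuous_on_mob) (auto elim: continuous_on_subset)
next
  assume *: "\<forall>p. continuous_on (mob p -` S) (g \<circ> mob p)"
  show "continuous_on S g"
    unfolding continuous_on_open_vimage[OF assms]
  proof (intro allI impI)
    fix B :: "'a set" assume B: "open B"
    have eq: "mob p -` (g -` B \<inter> S) = mob p -` S \<inter> (g \<circ> mob p) -` B" for p by auto
    have "open (mob p -` (g -` B \<inter> S))" for p
      unfolding eq by (rule continuous_open_preimage) (use * B P1_open_mob_vimage assms in auto)
    from this[of Infty] this[of "Aff 0"] show "open (g -` B \<inter> S)"
      unfolding P1_open_iff by (simp add: mob_Infty mob_Aff_0)
  qed
qed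

lemma P1_endo_continuous:
  assumes "P1_endo g"
  shows "continuous_on S g"
proof -
  have "continuous_on UNIV g"
    unfolding continuous_on_P1_iff[OF open_UNIV]
    using P1hol_continuous[OF P1_endoD[OF assms P1hol_mob[of _ UNIV]] open_UNIV] by simp
  then show ?thesis by (rule continuous_on_subset) auto
qed

section \<open>Spherical derivatives\<close>

text \<open>The speed of \<open>\<psi>\<close> from the flat to the spherical metric (without the factor 2).\<close>

definition spd :: "(complex \<Rightarrow> P1) \<Rightarrow> complex \<Rightarrow> real" where
  "spd \<psi> z = (let c = (if \<psi> z = Infty then coord_inf else coord)
     in cmod (deriv (c \<circ> \<psi>) z) / (1 + (cmod (c (\<psi> z)))\<^sup>2))"

lemma spd_cong:
  assumes "eventually (\<lambda>w. \<psi> w = \<phi> w) (nhds z)"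
  shows "spd \<psi> z = spd \<phi> z"
proof -
  have "\<psi> z = \<phi> z" using assms by (rule eventually_nhds_x_imp_x)
  moreover have "deriv (c \<circ> \<psi>) z = deriv (c \<circ> \<phi>) z" for c :: "P1 \<Rightarrow> complex"
    by (rule deriv_cong_ev) (use assms in \<open>auto elim: eventually_mono\<close>)
  ultimately show ?thesis by (simp add: spd_def)
qed

text \<open>The Fubini-Study formula: Wronskian of a lift over its squared norm. It is symmetric in
  the two homogeneous coordinates, so both charts used in \<open>spd\<close> lead to the same
  expression.\<close>

lemma spd_proj:
  assumes U: "open U" "z \<in> U" "P holomorphic_on U" "Q holomorphic_on U"
    and nz: "\<And>w. w \<in> U \<Longrightarrow> P w \<noteq> 0 \<or> Q w \<noteq> 0" and eq: "\<And>w. w \<in> U \<Longrightarrow> \<psi> w = proj (P w) (Q w)"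
  shows "spd \<psi> z = cmod (deriv P z * Q z - P z * deriv Q z) / ((cmod (P z))\<^sup>2 + (cmod (Q z))\<^sup>2)"
proof -
  have P: "(P has_field_derivative deriv P z) (at z)" and Q: "(Q has_field_derivative deriv Q z) (at z)"
    using U holomorphic_derivI by blast+
  have evU: "eventually (\<lambda>w. w \<in> U) (nhds z)"
    using U eventually_nhds by blast
  show ?thesis
  proof (cases "Q z = 0")
    case False
    have "eventually (\<lambda>w. Q w \<noteq> 0) (nhds z)"
      using DERIV_isCont[OF Q] False by (simp add: isCont_def tendsto_imp_eventually_ne eventually_nhds_conv_at)
    then have "eventually (\<lambda>w. (coord \<circ> \<psi>) w = P w / Q w) (nhds z)"
      using evU by eventually_elim (simp add: eq proj_def)
    then have "deriv (coord \<circ> \<psi>) z = deriv (\<lambda>w. P w / Q w) z"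
      by (rule deriv_cong_ev) simp
    also have "\<dots> = (deriv P z * Q z - P z * deriv Q z) / (Q z * Q z)"
      by (rule DERIV_imp_deriv) (rule DERIV_divide[OF P Q False])
    finally have d: "deriv (coord \<circ> \<psi>) z = (deriv P z * Q z - P z * deriv Q z) / (Q z * Q z)" .
    have pz: "\<psi> z = Aff (P z / Q z)" using eq[OF U(2)] False by (simp add: proj_def)
    have *: "x / (b * b) / (1 + (a / b)\<^sup>2) = x / (a\<^sup>2 + b\<^sup>2)" if "b > 0" for x a b :: real
    proof -
      have "1 + (a / b)\<^sup>2 = (a\<^sup>2 + b\<^sup>2) / (b * b)"
        using that by (simp add: field_simps power2_eq_square)
      then show ?thesis using that by simp
    qed
    show ?thesis using False
      by (simp only: spd_def pz Let_def P1.distinct if_False coord.simps d norm_divide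
          norm_mult[of "Q z" "Q z"] * zero_less_norm_iff not_False_eq_True)
  next
    case True
    then have Pz: "P z \<noteq> 0" using nz U by blast
    have "eventually (\<lambda>w. P w \<noteq> 0) (nhds z)"
      using DERIV_isCont[OF P] Pz by (simp add: isCont_def tendsto_imp_eventually_ne eventually_nhds_conv_at)
    then have "eventually (\<lambda>w. (coord_inf \<circ> \<psi>) w = Q w / P w) (nhds z)"
      using evU by eventually_elim (simp add: eq proj_def)
    then have "deriv (coord_inf \<circ> \<psi>) z = deriv (\<lambda>w. Q w / P w) z"
      by (rule deriv_cong_ev) simp
    also have "\<dots> = (deriv Q z * P z - Q z * deriv P z) / (P z * P z)"
      by (rule DERIV_imp_deriv) (rule DERIV_divide[OF Q P Pz])
    finally have d: "deriv (coord_inf \<circ> \<psi>) z = deriv Q z * P z / (P z * P z)" using True by simp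
    have pz: "\<psi> z = Infty" using eq[OF U(2)] True by (simp add: proj_def)
    show ?thesis using Pz True
      by (simp add: spd_def pz d norm_divide norm_mult field_simps power2_eq_square)
  qed
qed

lemma spd_nonneg: "spd \<psi> z \<ge> 0"
  by (simp add: spd_def Let_def)

text \<open>The density of the spherical metric in the chart \<open>mob p\<close>, again without the
  factor 2.\<close>

definition mob_wt :: "P1 \<Rightarrow> complex \<Rightarrow> real" where
  "mob_wt p z = 1 / ((cmod (mob_num p z))\<^sup>2 + (cmod (mob_den p z))\<^sup>2)"

lemma mob_wt_pos: "mob_wt p z > 0"
  using mob_num_den_nonzero[of p z] by (auto simp: mob_wt_def add_pos_nonneg add_nonneg_pos)

lemma continuous_on_mob_wt: "continuous_on S (mob_wt p)"
  unfolding mob_wt_def[abs_def]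
  by (intro continuous_intros holomorphic_on_imp_continuous_on mob_num_holomorphic mob_den_holomorphic)
    (use mob_num_den_nonzero[of p] in \<open>auto simp: add_nonneg_eq_0_iff\<close>)

lemma spd_mob: "spd (mob p) z = mob_wt p z"
proof -
  have "deriv (mob_num p) z * mob_den p z - mob_num p z * deriv (mob_den p) z \<in> {1, -1}"
    by (cases p) (auto simp: mob_num_def[abs_def] mob_den_def[abs_def] algebra_simps)
  then have *: "cmod (deriv (mob_num p) z * mob_den p z - mob_num p z * deriv (mob_den p) z) = 1"
    by auto
  show ?thesis
    unfolding spd_proj[OF open_UNIV UNIV_I mob_num_holomorphic mob_den_holomorphic mob_num_den_nonzero mob_eq_proj]
    by (simp add: * mob_wt_def)
qed

lemma spd_compose:
  assumes "P1hol \<psi> {g z}" "g holomorphic_on S" "open S" "z \<in> S"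
  shows "spd (\<psi> \<circ> g) z = cmod (deriv g z) * spd \<psi> (g z)"
proof -
  from P1holE[OF assms(1), of "g z"] obtain U P Q where U: "open U" "g z \<in> U" "P holomorphic_on U" "Q holomorphic_on U"
    "\<And>w. w \<in> U \<Longrightarrow> P w \<noteq> 0 \<or> Q w \<noteq> 0" "\<And>w. w \<in> U \<Longrightarrow> \<psi> w = proj (P w) (Q w)"
    by auto
  let ?W = "S \<inter> g -` U"
  have o: "open ?W"
    by (intro continuous_open_preimage holomorphic_on_imp_continuous_on assms U)
  have zW: "z \<in> ?W" using assms U by auto
  have gW: "g holomorphic_on ?W"
    using assms(2) by (rule holomorphic_on_subset) auto
  have PQ: "P \<circ> g holomorphic_on ?W" "Q \<circ> g holomorphic_on ?W"
    by (rule holomorphic_on_compose_gen[OF gW U(3)], auto, rule holomorphic_on_compose_gen[OF gW U(4)], auto)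
  have g': "(g has_field_derivative deriv g z) (at z)"
    using gW o zW holomorphic_derivI by blast
  have dP: "deriv (P \<circ> g) z = deriv P (g z) * deriv g z"
    by (rule DERIV_imp_deriv, rule DERIV_chain[OF _ g']) (use U holomorphic_derivI in blast)
  have dQ: "deriv (Q \<circ> g) z = deriv Q (g z) * deriv g z"
    by (rule DERIV_imp_deriv, rule DERIV_chain[OF _ g']) (use U holomorphic_derivI in blast)
  have 1: "spd (\<psi> \<circ> g) z = cmod (deriv (P \<circ> g) z * (Q \<circ> g) z - (P \<circ> g) z * deriv (Q \<circ> g) z) /
      ((cmod ((P \<circ> g) z))\<^sup>2 + (cmod ((Q \<circ> g) z))\<^sup>2)"
    by (rule spd_proj[OF o zW PQ]) (use U(5,6) in auto)
  have 2: "deriv P (g z) * deriv g z * Q (g z) - P (g z) * (deriv Q (g z) * deriv g z) =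
      deriv g z * (deriv P (g z) * Q (g z) - P (g z) * deriv Q (g z))"
    by (simp add: algebra_simps)
  have 3: "spd \<psi> (g z) = cmod (deriv P (g z) * Q (g z) - P (g z) * deriv Q (g z)) /
      ((cmod (P (g z)))\<^sup>2 + (cmod (Q (g z)))\<^sup>2)"
    by (rule spd_proj[OF U])
  show ?thesis
    unfolding 1 3 dP dQ o_apply 2 norm_mult by simp
qed

lemma spd_chart:
  assumes "P1hol \<psi> S" "open S" "z \<in> S" "\<psi> z \<noteq> p"
  shows "spd \<psi> z = cmod (deriv (\<lambda>w. mob_inv p (\<psi> w)) z) * mob_wt p (mob_inv p (\<psi> z))"
proof -
  note * = P1hol_mob_inv[OF assms(1,2), of p]
  have z: "z \<in> {z \<in> S. \<psi> z \<noteq> p}" using assms by auto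
  have "eventually (\<lambda>w. w \<in> {z \<in> S. \<psi> z \<noteq> p}) (nhds z)"
    using *(1) z eventually_nhds by blast
  then have "eventually (\<lambda>w. \<psi> w = (mob p \<circ> (\<lambda>w. mob_inv p (\<psi> w))) w) (nhds z)"
    by (rule eventually_mono) simp
  then have "spd \<psi> z = spd (mob p \<circ> (\<lambda>w. mob_inv p (\<psi> w))) z" by (rule spd_cong)
  also have "\<dots> = cmod (deriv (\<lambda>w. mob_inv p (\<psi> w)) z) * spd (mob p) (mob_inv p (\<psi> z))"
    by (rule spd_compose[OF P1hol_mob *(2,1) z])
  finally show ?thesis by (simp add: spd_mob)
qed

lemma sderiv_spd:
  "spherical_deriv f (Aff t) = spd (f \<circ> Aff) t * (1 + (cmod t)\<^sup>2)"
  "spherical_deriv f Infty = spd (f \<circ> Aff_inf) 0"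
  by (simp_all add: spherical_deriv_def spd_def Let_def Aff_inf_def comp_def)

lemma spd_endo:
  assumes g: "P1_endo g" and \<psi>: "P1hol \<psi> S" and S: "open S" "z \<in> S"
  shows "spd (g \<circ> \<psi>) z = spherical_deriv g (\<psi> z) * spd \<psi> z"
proof -
  \<comment> \<open>With this choice \<open>mob q\<close> is the very parametrisation that
    \<open>spherical_deriv\<close> uses at \<psi> z.\<close>
  define q where "q = (if \<psi> z = Infty then Aff 0 else Infty)"
  have q: "\<psi> z \<noteq> q" by (simp add: q_def)
  define h where "h = (\<lambda>w. mob_inv q (\<psi> w))"
  note * = P1hol_mob_inv[OF \<psi> S(1), of q, folded h_def]
  have z: "z \<in> {z \<in> S. \<psi> z \<noteq> q}" using S q by auto
  have "eventually (\<lambda>w. w \<in> {z \<in> S. \<psi> z \<noteq> q}) (nhds z)"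
    using *(1) z eventually_nhds by blast
  then have "eventually (\<lambda>w. (g \<circ> \<psi>) w = ((g \<circ> mob q) \<circ> h) w) (nhds z)"
    by (rule eventually_mono) (simp add: h_def)
  then have "spd (g \<circ> \<psi>) z = spd ((g \<circ> mob q) \<circ> h) z" by (rule spd_cong)
  also have "\<dots> = cmod (deriv h z) * spd (g \<circ> mob q) (h z)"
    by (rule spd_compose[OF P1_endoD[OF g P1hol_mob] *(2,1) z])
  finally have 1: "spd (g \<circ> \<psi>) z = cmod (deriv h z) * spd (g \<circ> mob q) (h z)" .
  have 2: "spd \<psi> z = cmod (deriv h z) * mob_wt q (h z)"
    using spd_chart[OF \<psi> S q] by (simp add: h_def)
  have 3: "spherical_deriv g (\<psi> z) * mob_wt q (h z) = spd (g \<circ> mob q) (h z)"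
  proof (cases "\<psi> z")
    case Infty
    then show ?thesis
      by (simp add: sderiv_spd q_def h_def mob_Aff_0 mob_wt_def mob_num_def mob_den_def mob_inv_def)
  next
    case (Aff t)
    have "1 + (cmod t)\<^sup>2 \<noteq> 0" by (metis add_nonneg_eq_0_iff zero_le_one zero_le_power2 zero_neq_one)
    then show ?thesis using Aff
      by (simp add: sderiv_spd q_def h_def mob_Infty mob_wt_def mob_num_def mob_den_def mob_inv_def
          add.commute)
  qed
  show ?thesis unfolding 1 2 3[symmetric] by simp
qed

lemma P1_point_mob: obtains q t where "x = mob q t"
proof -
  obtain q where "q \<noteq> x" using ex_not_in_pair by blast
  then have "x = mob q (mob_inv q x)" using mob_mob_inv by metis
  then show thesis by (rule that)
qed

text \<open>Both sides are tested along a chart through \<open>x\<close>; its speed is positive and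
  cancels.\<close>

lemma sderiv_comp:
  assumes "P1_endo g" "P1_endo h"
  shows "spherical_deriv (g \<circ> h) x = spherical_deriv g (h x) * spherical_deriv h x"
proof -
  obtain q t where x: "x = mob q t" by (rule P1_point_mob)
  have pos: "spd (mob q) t > 0" by (simp add: spd_mob mob_wt_pos)
  have "spherical_deriv (g \<circ> h) x * spd (mob q) t = spd ((g \<circ> h) \<circ> mob q) t"
    using spd_endo[OF P1_endo_comp[OF assms] P1hol_mob open_UNIV UNIV_I, of q t] x by simp
  also have "\<dots> = spd (g \<circ> (h \<circ> mob q)) t" by (simp add: comp_assoc)
  also have "\<dots> = spherical_deriv g (h x) * (spherical_deriv h x * spd (mob q) t)"
    using spd_endo[OF assms(1) P1_endoD[OF assms(2) P1hol_mob] open_UNIV UNIV_I, of q t]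
      spd_endo[OF assms(2) P1hol_mob open_UNIV UNIV_I, of q t] x by simp
  finally show ?thesis using pos by simp
qed

lemma sderiv_nonneg: "spherical_deriv g x \<ge> 0"
  by (cases x) (simp_all add: sderiv_spd spd_nonneg)

section \<open>Critical points of rational maps\<close>

definition wronskian :: "complex poly \<Rightarrow> complex poly \<Rightarrow> complex poly" where
  "wronskian p q = pderiv p * q - p * pderiv q"

lemma coeff_wronskian_top:
  assumes "degree p > degree q" "q \<noteq> 0"
  shows "coeff (wronskian p q) (degree p + degree q - 1) =
    of_nat (degree p - degree q) * lead_coeff p * lead_coeff q"
proof -
  have "degree p + degree q - 1 = degree (pderiv p) + degree q"
    using assms by (simp add: degree_pderiv)
  then have 1: "coeff (pderiv p * q) (degree p + degree q - 1) = lead_coeff (pderiv p) * lead_coeff q"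
    by (simp add: coeff_mult_degree_sum)
  have 2: "lead_coeff (pderiv p) = of_nat (degree p) * lead_coeff p"
    using assms by (simp add: degree_pderiv coeff_pderiv)
  have 3: "coeff (p * pderiv q) (degree p + degree q - 1) = of_nat (degree q) * lead_coeff p * lead_coeff q"
  proof (cases "degree q = 0")
    case True
    then show ?thesis by (simp add: pderiv_eq_0_iff[THEN iffD2])
  next
    case False
    then have "degree p + degree q - 1 = degree p + degree (pderiv q)"
      by (simp add: degree_pderiv)
    then have "coeff (p * pderiv q) (degree p + degree q - 1) = lead_coeff p * lead_coeff (pderiv q)"
      by (simp add: coeff_mult_degree_sum)
    also have "lead_coeff (pderiv q) = of_nat (degree q) * lead_coeff q"
      using False by (simp add: degree_pderiv coeff_pderiv)
    finally show ?thesis by simp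
  qed
  show ?thesis
    using assms unfolding wronskian_def coeff_diff 1 2 3 by (simp add: of_nat_diff algebra_simps)
qed

text \<open>For different degrees the leading terms of p' q and p q' do not cancel, so the Wronskian
  has degree at least 1.\<close>

lemma wronskian_root_gt:
  assumes "degree p > degree q" "degree p \<ge> 2"
  shows "\<exists>z. poly (wronskian p q) z = 0"
proof (cases "q = 0")
  case True
  then show ?thesis by (simp add: wronskian_def)
next
  case False
  have p: "p \<noteq> 0" using assms by auto
  have "coeff (wronskian p q) (degree p + degree q - 1) \<noteq> 0"
    unfolding coeff_wronskian_top[OF assms(1) False] using assms p False by auto
  then have "degree (wronskian p q) \<ge> degree p + degree q - 1"
    by (rule le_degree)
  then have "degree (wronskian p q) \<noteq> 0" using assms by linarith
  then have "\<not> constant (poly (wronskian p q))"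
    by (simp add: constant_degree)
  then show ?thesis by (rule fundamental_theorem_of_algebra)
qed

lemma wronskian_root:
  assumes "max (degree p) (degree q) \<ge> 2"
  shows "\<exists>z. poly (wronskian p q) z = 0"
proof -
  have swap: "wronskian a b = - wronskian b a" for a b
    by (simp add: wronskian_def algebra_simps)
  consider "degree p > degree q" | "degree p < degree q" | "degree p = degree q" by linarith
  then show ?thesis
  proof cases
    case 1
    then show ?thesis using wronskian_root_gt assms by simp
  next
    case 2
    then show ?thesis using wronskian_root_gt[of p q] assms swap[of p q] by simp
  next
    case 3
    then have d: "degree p \<ge> 2" using assms by simp
    then have q0: "lead_coeff q \<noteq> 0" using 3 by auto
    \<comment> \<open>Subtracting a multiple of \<open>q\<close> from \<open>p\<close> leaves the
      Wronskian unchanged and makes the degrees different.\<close>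
    define r where "r = p - smult (lead_coeff p / lead_coeff q) q"
    have "degree r \<le> degree p" unfolding r_def
      by (rule degree_diff_le) (use 3 in simp_all)
    moreover have "coeff r (degree p) = 0" using 3 q0 by (simp add: r_def)
    ultimately have "degree r < degree p \<or> r = 0"
      by (metis le_neq_implies_less leading_coeff_0_iff)
    then have "degree r < degree q" using 3 d by auto
    moreover have "wronskian p q = - wronskian q r"
      by (simp add: wronskian_def r_def pderiv_diff pderiv_smult algebra_simps)
    ultimately show ?thesis using wronskian_root_gt[of r q] 3 d by simp
  qed
qed

text \<open>A critical point cannot lie in an expanding set; this is what will show that a repeller
  is not the whole projective line.\<close>

lemma sderiv_has_zero:
  assumes "P1_morphism_of_degree f d" "d \<ge> 2"
  obtains x where "spherical_deriv f x = 0"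
proof -
  obtain p q where pq: "coprime p q" "max (degree p) (degree q) = d" "f = rat_map p q"
    using assms(1) unfolding P1_morphism_of_degree_def by blast
  obtain z where z: "poly (wronskian p q) z = 0"
    using wronskian_root[of p q] pq assms by auto
  have "spd (f \<circ> Aff) z = cmod (deriv (poly p) z * poly q z - poly p z * deriv (poly q) z) /
      ((cmod (poly p z))\<^sup>2 + (cmod (poly q z))\<^sup>2)"
  proof (rule spd_proj[OF open_UNIV UNIV_I])
    show "poly p w \<noteq> 0 \<or> poly q w \<noteq> 0" for w
      using pq(1) coprime_poly_0 by blast
    show "(f \<circ> Aff) w = proj (poly p w) (poly q w)" for w
      by (simp add: pq(3) proj_def)
  qed (auto intro: holomorphic_intros)
  also have "deriv (poly p) z * poly q z - poly p z * deriv (poly q) z = 0"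
    using z by (simp add: wronskian_def DERIV_imp_deriv[OF poly_DERIV])
  finally have 0: "spd (f \<circ> Aff) z = 0" by (simp only: norm_zero div_0)
  have "spherical_deriv f (Aff z) = 0" unfolding sderiv_spd 0 by (rule mult_zero_left)
  then show ?thesis by (rule that)
qed

section \<open>Periodic points of expanding maps\<close>

text \<open>Where \<open>deriv F\<close> differs from \<open>deriv F x\<close> by at most 1, the map
  \<open>F\<close> minus its linear part is 1-Lipschitz, so 3 of the expansion factor 4 survives on
  a whole ball. Compactness makes the radius uniform.\<close>

lemma expanding_map_local:
  assumes S: "open S" "F holomorphic_on S" and X: "compact X" "X \<subseteq> S"
    and exp: "\<And>x. x \<in> X \<Longrightarrow> cmod (deriv F x) \<ge> 4"
  obtains r0 where "r0 > 0" "\<And>x. x \<in> X \<Longrightarrow> cball x r0 \<subseteq> S"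
    "\<And>x z w. x \<in> X \<Longrightarrow> z \<in> cball x r0 \<Longrightarrow> w \<in> cball x r0 \<Longrightarrow> 3 * dist z w \<le> dist (F z) (F w)"
proof -
  obtain e where e: "e > 0" "(\<Union>x\<in>X. cball x e) \<subseteq> S"
    using compact_subset_open_imp_cball_epsilon_subset[OF X(1) S(1) X(2)] by blast
  define C where "C = (\<Union>x\<in>X. cball x e)"
  have "C = {x + y | x y. x \<in> X \<and> y \<in> cball 0 e}"
  proof (intro set_eqI iffI)
    fix z assume "z \<in> C"
    then obtain x where "x \<in> X" "dist x z \<le> e" by (auto simp: C_def)
    then show "z \<in> {x + y | x y. x \<in> X \<and> y \<in> cball 0 e}"
      by (intro CollectI exI[of _ x] exI[of _ "z - x"]) (auto simp: dist_norm norm_minus_commute)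
  next
    fix z assume "z \<in> {x + y | x y. x \<in> X \<and> y \<in> cball 0 e}"
    then obtain x y where "z = x + y" "x \<in> X" "norm y \<le> e" by auto
    then show "z \<in> C" unfolding C_def by (intro UN_I[of x]) (auto simp: dist_norm)
  qed
  then have "compact C"
    using compact_sums[OF X(1) compact_cball[of 0 e]] by simp
  moreover have "continuous_on C (deriv F)"
    using continuous_on_subset[OF holomorphic_on_imp_continuous_on[OF holomorphic_deriv[OF S(2,1)]] e(2)]
    by (simp add: C_def)
  ultimately have "uniformly_continuous_on C (deriv F)"
    using compact_uniformly_continuous by blast
  then obtain \<delta> where \<delta>: "\<delta> > 0" "\<And>x y. x \<in> C \<Longrightarrow> y \<in> C \<Longrightarrow> dist y x < \<delta> \<Longrightarrow> dist (deriv F y) (deriv F x) < 1"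
    unfolding uniformly_continuous_on_def by (metis zero_less_one)
  define r0 where "r0 = min e (\<delta> / 2)"
  have r0: "r0 > 0" "r0 \<le> e" "r0 < \<delta>" using e \<delta> by (auto simp: r0_def)
  show ?thesis
  proof (rule that[OF r0(1)])
    show sub: "cball x r0 \<subseteq> S" if "x \<in> X" for x
      using e(2) subset_cball[OF r0(2), of x] that by blast
    fix x z w assume x: "x \<in> X" and z: "z \<in> cball x r0" and w: "w \<in> cball x r0"
    have "cmod ((\<lambda>u. F u - deriv F x * u) z - (\<lambda>u. F u - deriv F x * u) w) \<le> 1 * cmod (z - w)"
    proof (rule field_differentiable_bound[OF convex_cball _ _ z w])
      fix u assume u: "u \<in> cball x r0"
      then have "u \<in> S" using sub[OF x] by blast
      then have "(F has_field_derivative deriv F u) (at u)"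
        using S holomorphic_derivI by blast
      then show "((\<lambda>u. F u - deriv F x * u) has_field_derivative deriv F u - deriv F x) (at u within cball x r0)"
        by (auto intro!: derivative_eq_intros intro: has_field_derivative_at_within)
      have "u \<in> C" "x \<in> C" "dist u x < \<delta>"
        using x u r0 e(1) by (auto simp: C_def dist_commute intro!: bexI[of _ x])
      then show "cmod (deriv F u - deriv F x) \<le> 1"
        using \<delta>(2)[of x u] by (simp add: dist_norm)
    qed
    then have a: "cmod (F z - F w - deriv F x * (z - w)) \<le> cmod (z - w)"
      by (simp add: algebra_simps)
    have b: "cmod (deriv F x * (z - w)) \<ge> 4 * cmod (z - w)"
      using exp[OF x] by (simp add: norm_mult mult_right_mono)
    have "cmod (deriv F x * (z - w)) \<le> cmod (F z - F w) + cmod (F z - F w - deriv F x * (z - w))"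
      by (metis norm_triangle_sub norm_minus_commute)
    with a b show "3 * dist z w \<le> dist (F z) (F w)"
      unfolding dist_norm by linarith
  qed
qed

text \<open>The branch of the inverse of F^n along the orbit of \<open>y\<close>: by induction, the
  branch along the orbit of \<open>F y\<close> is followed by the local inverse of \<open>F\<close>
  at \<open>y\<close>. The radius does not shrink with \<open>n\<close> because \<open>F\<close>
  expands.\<close>

lemma expanding_map_inverse_branch:
  assumes S: "open S" "F holomorphic_on S" and X: "X \<subseteq> S" "F ` X \<subseteq> X"
    and r0: "r0 > 0" "\<And>x. x \<in> X \<Longrightarrow> cball x r0 \<subseteq> S"
    and exp: "\<And>x z w. x \<in> X \<Longrightarrow> z \<in> cball x r0 \<Longrightarrow> w \<in> cball x r0 \<Longrightarrow> 3 * dist z w \<le> dist (F z) (F w)"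
    and r: "0 < r" "r \<le> r0" and y: "y \<in> X"
  shows "\<exists>G. G ((F ^^ n) y) = y \<and>
    (\<forall>w\<in>ball ((F ^^ n) y) r. (F ^^ n) (G w) = w \<and> (\<forall>i\<le>n. (F ^^ i) (G w) \<in> ball ((F ^^ i) y) r)) \<and>
    (\<forall>w\<in>ball ((F ^^ n) y) r. \<forall>w'\<in>ball ((F ^^ n) y) r. 3 ^ n * dist (G w) (G w') \<le> dist w w')"
  using y
proof (induction n arbitrary: y)
  case 0
  show ?case by (rule exI[of _ id]) auto
next
  case (Suc n)
  have Fy: "F y \<in> X" using Suc.prems X by auto
  from Suc.IH[OF Fy] obtain G' where G': "G' ((F ^^ n) (F y)) = F y"
    "\<And>w. w \<in> ball ((F ^^ n) (F y)) r \<Longrightarrow> (F ^^ n) (G' w) = w"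
    "\<And>w i. w \<in> ball ((F ^^ n) (F y)) r \<Longrightarrow> i \<le> n \<Longrightarrow> (F ^^ i) (G' w) \<in> ball ((F ^^ i) (F y)) r"
    "\<And>w w'. w \<in> ball ((F ^^ n) (F y)) r \<Longrightarrow> w' \<in> ball ((F ^^ n) (F y)) r \<Longrightarrow>
       3 ^ n * dist (G' w) (G' w') \<le> dist w w'"
    by (elim exE conjE) (rule that, assumption, simp_all)
  have eq: "(F ^^ Suc i) z = (F ^^ i) (F z)" for i z
    by (simp add: funpow_swap1)
  have inj: "inj_on F (cball y r0)"
  proof (rule inj_onI)
    fix a b assume "a \<in> cball y r0" "b \<in> cball y r0" "F a = F b"
    then have "3 * dist a b \<le> 0" using exp[OF Suc.prems, of a b] by simp
    then show "a = b" by simp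
  qed
  \<comment> \<open>The sphere of radius r/2 about \<open>y\<close> is sent to distance at least
    3r/2 from \<open>F y\<close>, so the image of the half-size ball covers a full ball of radius
    \<open>r\<close>.\<close>
  have cover: "ball (F y) r \<subseteq> F ` ball y (r / 2)"
  proof (rule ball_subset_open_map_image)
    have sub: "cball y (r / 2) \<subseteq> cball y r0" using r by (intro subset_cball) auto
    then have hol: "F holomorphic_on cball y (r / 2)"
      using S(2) r0(2)[OF Suc.prems] by (meson holomorphic_on_subset order.trans)
    then show "continuous_on (closure (ball y (r / 2))) F"
      using r by (simp add: holomorphic_on_imp_continuous_on)
    have "inj_on F (ball y (r/2))"
      using inj sub by (meson ball_subset_cball inj_on_subset order.trans)
    then show "open (F ` interior (ball y (r / 2)))"
      using open_mapping_thm3[of F "ball y (r/2)"] hol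
      by (simp add: interior_open) (meson ball_subset_cball holomorphic_on_subset)
    show "r \<le> cmod (F z - F y)" if "z \<in> frontier (ball y (r / 2))" for z
    proof -
      have "dist y z = r / 2" using that r by (simp add: frontier_ball)
      moreover from this have "z \<in> cball y r0" "y \<in> cball y r0" using r r0 by auto
      ultimately have "3 * (r / 2) \<le> dist (F z) (F y)"
        using exp[OF Suc.prems, of z y] by (simp add: dist_commute)
      then show ?thesis using r by (simp add: dist_norm)
    qed
  qed (use r in auto)
  define B where "B = ball ((F ^^ Suc n) y) r"
  have B: "B = ball ((F ^^ n) (F y)) r" by (simp only: B_def eq)
  define G where "G w = (SOME u. u \<in> ball y (r / 2) \<and> F u = G' w)" for w
  have G: "G w \<in> ball y (r / 2) \<and> F (G w) = G' w" if "w \<in> B" for w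
  proof -
    have "G' w \<in> ball (F y) r" using G'(3)[of w 0] that B by simp
    then obtain u where "u \<in> ball y (r / 2) \<and> F u = G' w" using cover by auto
    then show ?thesis unfolding G_def by (rule someI)
  qed
  have Gr: "G w \<in> ball y r" "G w \<in> cball y r0" if "w \<in> B" for w
    using G[OF that] r by auto
  show ?case unfolding B_def[symmetric]
  proof (intro exI[of _ G] conjI ballI allI impI)
    have "(F ^^ Suc n) y \<in> B" using r by (simp add: B_def)
    from G[OF this] Gr(2)[OF this] have "F (G ((F ^^ Suc n) y)) = F y" "G ((F ^^ Suc n) y) \<in> cball y r0"
      using G'(1) unfolding eq by auto
    then show "G ((F ^^ Suc n) y) = y" using inj r r0 by (auto dest: inj_onD)
    fix w assume w: "w \<in> B"
    show "(F ^^ Suc n) (G w) = w"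
      unfolding eq using G[OF w] G'(2) w B by simp
    show "(F ^^ i) (G w) \<in> ball ((F ^^ i) y) r" if "i \<le> Suc n" for i
    proof (cases i)
      case 0
      then show ?thesis using Gr[OF w] by simp
    next
      case (Suc j)
      then show ?thesis unfolding Suc eq using G[OF w] G'(3)[of w j] w B that Suc by simp
    qed
    fix w' assume w': "w' \<in> B"
    have "3 ^ Suc n * dist (G w) (G w') = 3 ^ n * (3 * dist (G w) (G w'))" by simp
    also have "\<dots> \<le> 3 ^ n * dist (G' w) (G' w')"
      using exp[OF Suc.prems Gr(2)[OF w] Gr(2)[OF w']] G[OF w] G[OF w'] by (intro mult_left_mono) auto
    also have "\<dots> \<le> dist w w'" using G'(4) w w' B by simp
    finally show "3 ^ Suc n * dist (G w) (G w') \<le> dist w w'" .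
  qed
qed

text \<open>A closing lemma: the inverse branch along an almost closed orbit contracts by 1/3 and
  maps a ball into itself, so it has a fixed point, whose orbit shadows that of
  \<open>y\<close>.\<close>

lemma expanding_map_periodic_point:
  assumes S: "open S" "F holomorphic_on S" and X: "X \<subseteq> S" "F ` X \<subseteq> X"
    and r0: "r0 > 0" "\<And>x. x \<in> X \<Longrightarrow> cball x r0 \<subseteq> S"
    and exp: "\<And>x z w. x \<in> X \<Longrightarrow> z \<in> cball x r0 \<Longrightarrow> w \<in> cball x r0 \<Longrightarrow> 3 * dist z w \<le> dist (F z) (F w)"
    and r: "0 < r" "r \<le> r0" and y: "y \<in> X" and n: "n \<ge> 1" and d: "dist y ((F ^^ n) y) < r / 2"
  obtains u where "(F ^^ n) u = u" "\<And>i. i \<le> n \<Longrightarrow> (F ^^ i) u \<in> ball ((F ^^ i) y) r"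
proof -
  define x where "x = (F ^^ n) y"
  have "\<exists>G. G x = y \<and>
    (\<forall>w\<in>ball x r. (F ^^ n) (G w) = w \<and> (\<forall>i\<le>n. (F ^^ i) (G w) \<in> ball ((F ^^ i) y) r)) \<and>
    (\<forall>w\<in>ball x r. \<forall>w'\<in>ball x r. 3 ^ n * dist (G w) (G w') \<le> dist w w')"
    unfolding x_def
    by (rule expanding_map_inverse_branch[OF S X r0(1)]) (use r0(2) exp r y in blast)+
  then obtain G where G0: "G x = y \<and>
    (\<forall>w\<in>ball x r. (F ^^ n) (G w) = w \<and> (\<forall>i\<le>n. (F ^^ i) (G w) \<in> ball ((F ^^ i) y) r)) \<and>
    (\<forall>w\<in>ball x r. \<forall>w'\<in>ball x r. 3 ^ n * dist (G w) (G w') \<le> dist w w')"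
    by (rule exE)
  have G: "G x = y" "\<And>w. w \<in> ball x r \<Longrightarrow> (F ^^ n) (G w) = w"
    "\<And>w i. w \<in> ball x r \<Longrightarrow> i \<le> n \<Longrightarrow> (F ^^ i) (G w) \<in> ball ((F ^^ i) y) r"
    "\<And>w w'. w \<in> ball x r \<Longrightarrow> w' \<in> ball x r \<Longrightarrow> 3 ^ n * dist (G w) (G w') \<le> dist w w'"
    using G0 by blast+
  have G3: "dist (G w) (G w') \<le> dist w w' / 3" if "w \<in> ball x r" "w' \<in> ball x r" for w w'
  proof -
    have "(3::real) ^ 1 \<le> 3 ^ n" using n by (intro power_increasing) auto
    then have "3 * dist (G w) (G w') \<le> 3 ^ n * dist (G w) (G w')"
      by (intro mult_right_mono) auto
    with G(4)[OF that] show ?thesis by simp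
  qed
  \<comment> \<open>A radius s is needed with r/2 + s/3 <= s and s < r; any s from 3r/4 up to but
    excluding r would serve.\<close>
  have sub: "cball x (5 * r / 6) \<subseteq> ball x r" using r by auto
  have xr: "x \<in> ball x r" using r by simp
  have "\<exists>!u\<in>cball x (5 * r / 6). G u = u"
  proof (rule Banach_fix)
    show "complete (cball x (5 * r / 6))" by (simp add: complete_eq_closed)
    show "cball x (5 * r / 6) \<noteq> {}" using r by simp
    show "0 \<le> (1/3::real)" "(1/3::real) < 1" by simp_all
    show "G ` cball x (5 * r / 6) \<subseteq> cball x (5 * r / 6)"
    proof safe
      fix w assume w: "w \<in> cball x (5 * r / 6)"
      have "dist (G w) y \<le> dist w x / 3"
        using G3[OF subsetD[OF sub w] xr] G(1) by simp
      moreover have "dist w x \<le> 5 * r / 6" using w by (simp add: dist_commute)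
      moreover have "dist x (G w) \<le> dist y x + dist (G w) y"
        by (metis dist_commute dist_triangle add.commute)
      ultimately have "dist x (G w) \<le> 5 * r / 6"
        using d r unfolding x_def[symmetric] by linarith
      then show "G w \<in> cball x (5 * r / 6)" by simp
    qed
    show "dist (G a) (G b) \<le> 1 / 3 * dist a b" if "a \<in> cball x (5 * r / 6)" "b \<in> cball x (5 * r / 6)" for a b
      using G3[OF subsetD[OF sub that(1)] subsetD[OF sub that(2)]] by simp
  qed
  then obtain u where u: "u \<in> cball x (5 * r / 6)" "G u = u" by auto
  then have "u \<in> ball x r" using sub by auto
  then show ?thesis using that[of u] G(2)[of u] G(3)[of u] u(2) by simp
qed

section \<open>Linearization at a repelling fixed point\<close>

lemma holomorphic_second_order_bound:
  assumes "open S" "G holomorphic_on S" "cball 0 s \<subseteq> S" "s > 0" "G 0 = 0"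
  obtains C where "C > 0" "\<And>z. z \<in> cball 0 s \<Longrightarrow> cmod (G z - deriv G 0 * z) \<le> C * (cmod z)\<^sup>2"
proof -
  have hol: "(deriv ^^ 2) G holomorphic_on S" "deriv G holomorphic_on S"
    using assms holomorphic_higher_deriv holomorphic_deriv by blast+
  have "compact ((deriv ^^ 2) G ` cball 0 s)"
    by (intro compact_continuous_image holomorphic_on_imp_continuous_on holomorphic_on_subset[OF hol(1)] assms) auto
  from compact_imp_bounded[OF this] obtain B
    where "B > 0 \<and> (\<forall>x\<in>(deriv ^^ 2) G ` cball 0 s. cmod x \<le> B)"
    unfolding bounded_pos by (rule exE)
  then have B: "B > 0" "cmod ((deriv ^^ 2) G z) \<le> B" if "z \<in> cball 0 s" for z :: complex
    using that by (blast, blast)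
  have "cmod (G z - deriv G 0 * z) \<le> B * (cmod z)\<^sup>2" if z: "z \<in> cball 0 s" for z :: complex
  proof -
    have "cmod ((deriv ^^ 0) G z - (\<Sum>i\<le>1. (deriv ^^ i) G 0 * (z - 0) ^ i / fact i)) \<le> B * cmod (z - 0) ^ Suc 1 / fact 1"
    proof (rule complex_Taylor[OF convex_cball])
      fix i :: nat and x :: complex assume x: "x \<in> cball 0 s"
      have "((deriv ^^ i) G has_field_derivative deriv ((deriv ^^ i) G) x) (at x)"
        using holomorphic_derivI[OF holomorphic_higher_deriv[OF assms(2,1)] assms(1)] x assms(3) by blast
      then show "((deriv ^^ i) G has_field_derivative (deriv ^^ Suc i) G x) (at x within cball 0 s)"
        by (simp add: has_field_derivative_at_within)
    next
      fix x :: complex assume "x \<in> cball 0 s"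
      then show "cmod ((deriv ^^ Suc 1) G x) \<le> B" using B(2) by (simp add: numeral_2_eq_2)
    qed (use assms z in auto)
    then show ?thesis using assms(5) by (simp add: power2_eq_square)
  qed
  moreover have "B > 0" using B(1)[of 0] assms(4) by simp
  ultimately show ?thesis using that by blast
qed

text \<open>Koenigs' theorem: \<phi> is the limit of G^n / \<mu>^n. The quadratic error in
  \<open>G z - \<mu> * z\<close>, divided by \<mu>^n, is summable along the orbit.\<close>

lemma koenigs_linearization:
  fixes \<mu> :: complex and G :: "complex \<Rightarrow> complex" and S :: "complex set"
  assumes "open S" "G holomorphic_on S" "0 \<in> S" "G 0 = 0" and \<mu>: "deriv G 0 = \<mu>" "\<mu> \<noteq> 0" "cmod \<mu> < 1"
  obtains \<phi> :: "complex \<Rightarrow> complex" and s :: real where "s > 0" "cball 0 s \<subseteq> S" "\<phi> holomorphic_on ball 0 s" "\<phi> 0 = 0" "deriv \<phi> 0 = 1"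
    "\<And>z::complex. z \<in> ball 0 s \<Longrightarrow> cmod (G z) \<le> cmod z \<and> \<phi> (G z) = \<mu> * \<phi> z"
proof -
  obtain s1 where s1: "s1 > 0" "cball 0 s1 \<subseteq> S"
    using assms(1,3) open_contains_cball by blast
  obtain C where C: "C > 0" "\<And>z. z \<in> cball 0 s1 \<Longrightarrow> cmod (G z - \<mu> * z) \<le> C * (cmod z)\<^sup>2"
    using holomorphic_second_order_bound[OF assms(1,2) s1(2,1) assms(4)] \<mu> by metis
  have m: "0 < cmod \<mu>" "cmod \<mu> < sqrt (cmod \<mu>)" "sqrt (cmod \<mu>) < 1"
  proof -
    show m0: "0 < cmod \<mu>" using \<mu> by simp
    have "cmod \<mu> * cmod \<mu> < cmod \<mu>" using m0 \<mu>(3) by (simp add: mult_less_cancel_left2)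
    then show "cmod \<mu> < sqrt (cmod \<mu>)"
      by (intro real_less_rsqrt) (simp add: power2_eq_square)
    show "sqrt (cmod \<mu>) < 1" using \<mu> by simp
  qed
  \<comment> \<open>The contraction rate \<open>c\<close> lies slightly above |\<mu>| but has c^2 <
    |\<mu>|: errors of size c^(2k), divided by |\<mu>|^k, then decay geometrically.\<close>
  then obtain c where c: "cmod \<mu> < c" "c < sqrt (cmod \<mu>)" using dense by blast
  have c01: "0 < c" "c < 1" using c m by linarith+
  have c2: "c\<^sup>2 < cmod \<mu>"
  proof -
    have "c\<^sup>2 < (sqrt (cmod \<mu>))\<^sup>2" using c(2) c01 by (intro power_strict_mono) auto
    then show ?thesis by simp
  qed
  define s where "s = min s1 ((c - cmod \<mu>) / C)"
  have s: "s > 0" "s \<le> s1" "C * s \<le> c - cmod \<mu>"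
  proof -
    show "s > 0" "s \<le> s1" using s1 C c by (auto simp: s_def)
    have "s \<le> (c - cmod \<mu>) / C" by (simp add: s_def)
    then show "C * s \<le> c - cmod \<mu>" using C by (simp add: field_simps)
  qed
  have Gc: "cmod (G z) \<le> c * cmod z" if "z \<in> cball 0 s" for z :: complex
  proof -
    have "cmod (G z) \<le> cmod (\<mu> * z) + cmod (G z - \<mu> * z)" by (rule norm_triangle_sub)
    also have "\<dots> \<le> cmod \<mu> * cmod z + C * cmod z * cmod z"
      using C(2)[of z] that s by (simp add: norm_mult power2_eq_square)
    also have "C * cmod z * cmod z \<le> (c - cmod \<mu>) * cmod z"
    proof -
      have "C * cmod z \<le> C * s" using that C by simp
      then show ?thesis using s(3) by (intro mult_right_mono) auto
    qed
    finally show ?thesis by (simp add: algebra_simps)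
  qed
  have Gk: "cmod ((G ^^ k) z) \<le> c ^ k * cmod z" "(G ^^ k) z \<in> cball 0 s" if "z \<in> cball 0 s" for z :: complex and k
  proof (induction k)
    case 0 
    { case 1 show ?case by simp }
    { case 2 show ?case using that by simp }
  next
    case (Suc k)
    have *: "cmod ((G ^^ Suc k) z) \<le> c * cmod ((G ^^ k) z)" using Gc[OF Suc(2)] by simp
    { case 1
      show ?case using * Suc(1) c01 by (smt (verit) mult.assoc mult_left_mono power_Suc) }
    { case 2
      have "c * cmod ((G ^^ k) z) \<le> 1 * cmod ((G ^^ k) z)" using c01 by (intro mult_right_mono) auto
      then show ?case using * Suc(2) by simp }
  qed
  \<comment> \<open>The increments of the sequence G^k / \<mu>^k, so that the limit becomes a series
    accessible to the Weierstrass test.\<close>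
  define u where "u k z = (G ^^ Suc k) z / \<mu> ^ Suc k - (G ^^ k) z / \<mu> ^ k" for k :: nat and z :: complex
  define q where "q = c\<^sup>2 / cmod \<mu>"
  have q: "0 \<le> q" "q < 1" using c2 m by (auto simp: q_def)
  have ub: "cmod (u k z) \<le> (C / cmod \<mu> * (cmod z)\<^sup>2) * q ^ k" if z: "z \<in> cball 0 s" for k :: nat and z :: complex
  proof -
    let ?w = "(G ^^ k) z"
    have "u k z = (G ?w - \<mu> * ?w) / \<mu> ^ Suc k"
      using \<mu> by (simp add: u_def field_simps)
    then have "cmod (u k z) = cmod (G ?w - \<mu> * ?w) / cmod \<mu> ^ Suc k"
      by (simp add: norm_divide norm_power norm_mult)
    also have "\<dots> \<le> (C * (c ^ k * cmod z)\<^sup>2) / cmod \<mu> ^ Suc k"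
    proof (intro divide_right_mono)
      have "cmod (G ?w - \<mu> * ?w) \<le> C * (cmod ?w)\<^sup>2" using C(2) Gk(2)[OF z, of k] s by simp
      also have "\<dots> \<le> C * (c ^ k * cmod z)\<^sup>2"
        using Gk(1)[OF z, of k] C by (intro mult_left_mono power_mono) auto
      finally show "cmod (G ?w - \<mu> * ?w) \<le> C * (c ^ k * cmod z)\<^sup>2" .
    qed auto
    also have "\<dots> = (C / cmod \<mu> * (cmod z)\<^sup>2) * q ^ k"
      by (simp add: q_def power_mult_distrib power_divide field_simps flip: power_mult)
    finally show ?thesis .
  qed
  have sumq: "summable (\<lambda>k. q ^ k)" using q by (intro summable_geometric) auto
  define \<phi> where "\<phi> z = z + (\<Sum>k. u k z)" for z :: complex
  define ph where "ph n z = (G ^^ n) z / \<mu> ^ n" for n :: nat and z :: complex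
  have ph_sum: "ph n z = z + (\<Sum>k<n. u k z)" for n :: nat and z :: complex
    unfolding u_def by (subst sum_lessThan_telescope) (simp add: ph_def)
  have ul: "uniform_limit (cball 0 s) ph \<phi> sequentially"
  proof -
    have "uniform_limit (cball 0 s) (\<lambda>n z. \<Sum>k<n. u k z) (\<lambda>z. \<Sum>k. u k z) sequentially"
    proof (rule Weierstrass_m_test)
      show "summable (\<lambda>k. (C / cmod \<mu> * s\<^sup>2) * q ^ k)" by (intro summable_mult sumq)
      fix n :: nat and z :: complex assume z: "z \<in> cball 0 s"
      then have "(cmod z)\<^sup>2 \<le> s\<^sup>2" by (intro power_mono) auto
      then have "(C / cmod \<mu> * (cmod z)\<^sup>2) * q ^ n \<le> (C / cmod \<mu> * s\<^sup>2) * q ^ n"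
        using C q by (intro mult_right_mono mult_left_mono) auto
      with ub[OF z, of n] show "cmod (u n z) \<le> (C / cmod \<mu> * s\<^sup>2) * q ^ n" by linarith
    qed
    then have "uniform_limit (cball 0 s) (\<lambda>n z. z + (\<Sum>k<n. u k z)) (\<lambda>z. z + (\<Sum>k. u k z)) sequentially"
      by (intro uniform_limit_intros) 
    then show ?thesis by (simp add: ph_sum[abs_def] \<phi>_def[abs_def])
  qed
  have Gkhol: "(G ^^ n) holomorphic_on ball 0 s1 \<inter> ball 0 s" for n
  proof (induction n)
    case (Suc n)
    have "G \<circ> (G ^^ n) holomorphic_on ball 0 s1 \<inter> ball 0 s"
    proof (rule holomorphic_on_compose_gen[OF Suc.IH assms(2)])
      show "(G ^^ n) ` (ball 0 s1 \<inter> ball 0 s) \<subseteq> S"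
      proof (rule image_subsetI)
        fix z :: complex assume "z \<in> ball 0 s1 \<inter> ball 0 s"
        then have "(G ^^ n) z \<in> cball 0 s" by (intro Gk(2)) auto
        then show "(G ^^ n) z \<in> S" using subset_cball[OF s(2), of 0] s1(2) by blast
      qed
    qed
    then show ?case by (simp add: comp_def)
  qed (simp add: holomorphic_on_ident id_def)
  have bs: "ball 0 s1 \<inter> ball 0 s = ball (0::complex) s" using s by auto
  have hol: "\<phi> holomorphic_on ball 0 s"
  proof (rule holomorphic_uniform_sequence[OF open_ball])
    show "ph n holomorphic_on ball 0 s" for n
      unfolding ph_def using Gkhol[of n] \<mu> unfolding bs by (intro holomorphic_intros) auto
    fix x :: complex assume "x \<in> ball 0 s"
    then obtain d where d: "d > 0" "cball x d \<subseteq> ball 0 s"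
      using open_contains_cball open_ball by blast
    then have "uniform_limit (cball x d) ph \<phi> sequentially"
      using ul by (meson ball_subset_cball order.trans uniform_limit_on_subset)
    with d show "\<exists>d. 0 < d \<and> cball x d \<subseteq> ball 0 s \<and> uniform_limit (cball x d) ph \<phi> sequentially"
      by blast
  qed
  have G0: "(G ^^ n) 0 = 0" for n by (induction n) (simp_all add: assms(4))
  have \<phi>0: "\<phi> 0 = 0" unfolding \<phi>_def u_def G0 by simp
  define D where "D = C / cmod \<mu> * (\<Sum>k. q ^ k)"
  have D: "cmod (\<phi> z - z) \<le> D * (cmod z)\<^sup>2" if z: "z \<in> cball 0 s" for z :: complex
  proof -
    have "cmod (\<Sum>k. u k z) \<le> (\<Sum>k. (C / cmod \<mu> * (cmod z)\<^sup>2) * q ^ k)"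
      by (rule norm_suminf_le[OF ub[OF z] summable_mult[OF sumq]])
    also have "\<dots> = D * (cmod z)\<^sup>2"
      by (subst suminf_mult[OF sumq]) (simp add: D_def)
    finally show ?thesis by (simp add: \<phi>_def)
  qed
  have "(\<phi> has_field_derivative 1) (at 0)"
    unfolding DERIV_def
  proof (rule LIM_zero_cancel, rule Lim_null_comparison)
    show "eventually (\<lambda>h. norm ((\<phi> (0 + h) - \<phi> 0) / h - 1) \<le> D * cmod h) (at 0)"
      unfolding eventually_at
    proof (intro exI[of _ s] conjI ballI impI)
      fix h :: complex assume h: "h \<noteq> 0 \<and> dist h 0 < s"
      have "(\<phi> (0 + h) - \<phi> 0) / h - 1 = (\<phi> h - h) / h" using h \<phi>0 by (simp add: field_simps)
      then have "norm ((\<phi> (0 + h) - \<phi> 0) / h - 1) = cmod (\<phi> h - h) / cmod h" by (simp add: norm_divide)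
      also have "\<dots> \<le> D * (cmod h)\<^sup>2 / cmod h" using h by (intro divide_right_mono D) auto
      also have "\<dots> = D * cmod h" using h by (simp add: power2_eq_square)
      finally show "norm ((\<phi> (0 + h) - \<phi> 0) / h - 1) \<le> D * cmod h" .
    qed (use s in auto)
    show "((\<lambda>h. D * cmod h) \<longlongrightarrow> 0) (at 0)"
      by (auto intro!: tendsto_eq_intros)
  qed
  then have d1: "deriv \<phi> 0 = 1" by (rule DERIV_imp_deriv)
  show ?thesis
  proof (rule that[OF s(1) _ hol \<phi>0 d1])
    show "cball 0 s \<subseteq> S" using subset_cball[OF s(2), of 0] s1(2) by blast
    fix z :: complex assume z: "z \<in> ball 0 s"
    have "cmod (G z) \<le> c * cmod z" using Gc z by simp
    also have "\<dots> \<le> 1 * cmod z" using c01 by (intro mult_right_mono) auto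
    finally have le: "cmod (G z) \<le> cmod z" by simp
    then have Gz: "G z \<in> cball 0 s" using z by simp
    have 1: "(\<lambda>n. ph n (G z)) \<longlonglongrightarrow> \<phi> (G z)"
      by (rule tendsto_uniform_limitI[OF ul Gz])
    have 2: "(\<lambda>n. ph n (G z)) = (\<lambda>n. \<mu> * ph (Suc n) z)"
      using \<mu> by (simp add: ph_def funpow_swap1)
    have "z \<in> cball 0 s" using z by simp
    then have 3: "(\<lambda>n. \<mu> * ph (Suc n) z) \<longlonglongrightarrow> \<mu> * \<phi> z"
      by (intro tendsto_mult_left LIMSEQ_Suc tendsto_uniform_limitI[OF ul])
    have "\<phi> (G z) = \<mu> * \<phi> z"
      by (rule LIMSEQ_unique[OF 1[unfolded 2] 3])
    with le show "cmod (G z) \<le> cmod z \<and> \<phi> (G z) = \<mu> * \<phi> z" by simp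
  qed
qed

text \<open>Koenigs' theorem is applied to the local inverse of \<open>h\<close>, moved to 0, whose
  multiplier is 1 / \<rho>; the parametrisation \<open>b\<close> inverts the linearising map and
  moves back to \<open>u\<close>.\<close>

lemma repelling_linearization:
  assumes S: "open S" "h holomorphic_on S" "u \<in> S" "h u = u" and \<rho>: "deriv h u = \<rho>" "cmod \<rho> > 1"
  obtains r b where "r > 0" "b holomorphic_on ball 0 r" "inj_on b (ball 0 r)" "b 0 = u"
    "b ` ball 0 r \<subseteq> S" "\<And>z. \<rho> * z \<in> ball 0 r \<Longrightarrow> h (b z) = b (\<rho> * z)"
proof -
  have \<rho>0: "\<rho> \<noteq> 0" using \<rho> by auto
  obtain r1 where r1: "r1 > 0" "ball u r1 \<subseteq> S" "open (h ` ball u r1)" "inj_on h (ball u r1)"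
    using has_complex_derivative_locally_invertible[OF S(2,3,1)] \<rho> \<rho>0 by metis
  have hh: "h holomorphic_on ball u r1" using S(2) r1(2) holomorphic_on_subset by blast
  obtain g where g: "g holomorphic_on (h ` ball u r1)" "\<And>z. z \<in> ball u r1 \<Longrightarrow> deriv h z * deriv g (h z) = 1"
    "\<And>z. z \<in> ball u r1 \<Longrightarrow> g (h z) = z"
    using holomorphic_has_inverse[OF hh open_ball r1(4)] by metis
  define W where "W = (\<lambda>z. u + z) -` (h ` ball u r1)"
  define G where "G z = g (u + z) - u" for z :: complex
  have W: "open W" unfolding W_def by (intro open_vimage r1 continuous_intros)
  have ub: "u \<in> ball u r1" using r1 by simp
  then have "u \<in> h ` ball u r1" using S(4) by (metis imageI)
  then have W0: "0 \<in> W" by (simp add: W_def)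
  have gu: "g u = u" using g(3)[OF ub] S(4) by simp
  have GW: "G holomorphic_on W"
  proof -
    have "g \<circ> (\<lambda>z. u + z) holomorphic_on W"
      by (rule holomorphic_on_compose_gen[OF _ g(1)]) (auto simp: W_def intro!: holomorphic_intros)
    then show ?thesis unfolding G_def by (auto simp: comp_def intro!: holomorphic_intros)
  qed
  have dG: "deriv G 0 = 1 / \<rho>"
  proof -
    have dg: "(g has_field_derivative deriv g u) (at u)"
      using g(1) r1(3) \<open>u \<in> h ` ball u r1\<close> holomorphic_derivI by blast
    have "(G has_field_derivative deriv g u) (at 0)"
    proof -
      have "((\<lambda>z. g (z + u)) has_field_derivative deriv g u) (at 0)"
        using dg DERIV_shift[of g "deriv g u" 0 u] by simp
      then have "((\<lambda>z. g (z + u) - u) has_field_derivative deriv g u - 0) (at 0)"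
        by (rule DERIV_diff) (rule DERIV_const)
      then show ?thesis by (simp add: G_def[abs_def] add.commute)
    qed
    moreover have "\<rho> * deriv g u = 1" using g(2)[OF ub] S(4) \<rho>(1) by simp
    ultimately show ?thesis using \<rho>0 by (metis DERIV_imp_deriv nonzero_mult_div_cancel_left)
  qed
  have Gu: "G 0 = 0" by (simp add: G_def gu)
  have \<mu>: "1 / \<rho> \<noteq> 0" "cmod (1 / \<rho>) < 1" using \<rho> \<rho>0 by (auto simp: norm_divide)
  obtain \<phi> s where \<phi>: "s > 0" "cball 0 s \<subseteq> W" "\<phi> holomorphic_on ball 0 s" "\<phi> 0 = 0" "deriv \<phi> 0 = 1"
    "\<And>z. z \<in> ball 0 s \<Longrightarrow> cmod (G z) \<le> cmod z \<and> \<phi> (G z) = 1 / \<rho> * \<phi> z"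
    using koenigs_linearization[OF W GW W0 Gu dG \<mu>] by metis
  define s' where "s' = min s r1"
  have s': "s' > 0" "s' \<le> s" "s' \<le> r1" using \<phi> r1 by (auto simp: s'_def)
  have \<phi>': "\<phi> holomorphic_on ball 0 s'" using \<phi>(3) s' by (meson holomorphic_on_subset subset_ball)
  obtain r2 where r2: "r2 > 0" "ball 0 r2 \<subseteq> ball (0::complex) s'" "open (\<phi> ` ball 0 r2)" "inj_on \<phi> (ball 0 r2)"
  proof (rule has_complex_derivative_locally_invertible[OF \<phi>' _ open_ball])
    show "0 \<in> ball (0::complex) s'" using s' by simp
    show "deriv \<phi> 0 \<noteq> 0" using \<phi>(5) by simp
  qed (rule that)
  have \<phi>2: "\<phi> holomorphic_on ball 0 r2" using \<phi>' r2 holomorphic_on_subset by blast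
  obtain c where c: "c holomorphic_on (\<phi> ` ball 0 r2)" "\<And>z. z \<in> ball 0 r2 \<Longrightarrow> c (\<phi> z) = z"
    using holomorphic_has_inverse[OF \<phi>2 open_ball r2(4)] by metis
  have "0 \<in> \<phi> ` ball 0 r2" using r2(1) \<phi>(4) by (metis centre_in_ball imageI)
  then obtain r where r: "r > 0" "ball 0 r \<subseteq> \<phi> ` ball 0 r2"
    using r2(3) open_contains_ball by blast
  have cr: "c z \<in> ball 0 r2 \<and> \<phi> (c z) = z" if "z \<in> ball 0 r" for z :: complex
  proof -
    from that r(2) obtain v where "v \<in> ball 0 r2" "z = \<phi> v" by blast
    with c(2)[of v] show ?thesis by simp
  qed
  define b where "b z = u + c z" for z :: complex
  show ?thesis
  proof (rule that[OF r(1), of b])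
    show "b holomorphic_on ball 0 r"
      unfolding b_def using holomorphic_on_subset[OF c(1) r(2)] by (intro holomorphic_intros)
    show "inj_on b (ball 0 r)"
    proof (rule inj_onI)
      fix v w assume vw: "v \<in> ball 0 r" "w \<in> ball 0 r" "b v = b w"
      then have "c v = c w" by (simp add: b_def)
      then show "v = w" using cr[OF vw(1)] cr[OF vw(2)] by (elim conjE) metis
    qed
    show "b 0 = u" using c(2)[of 0] r2(1) unfolding b_def \<phi>(4) by simp
    show "b ` ball 0 r \<subseteq> S"
    proof safe
      fix z :: complex assume "z \<in> ball 0 r"
      then have "c z \<in> ball 0 s'" using cr[of z] r2(2) by blast
      then have "b z \<in> ball u r1" using s' by (simp add: b_def dist_norm)
      then show "b z \<in> S" using r1(2) by blast
    qed
    fix z assume z: "\<rho> * z \<in> ball 0 r"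
    define w where "w = c (\<rho> * z)"
    have "cmod z \<le> cmod \<rho> * cmod z" using \<rho> by (simp add: mult_le_cancel_right1)
    then have zr: "z \<in> ball 0 r" using z by (simp add: norm_mult)
    have w: "w \<in> ball 0 r2" "\<phi> w = \<rho> * z" using cr[OF z] by (auto simp: w_def)
    have ws: "w \<in> ball 0 s"
    proof -
      have "w \<in> ball 0 s'" using w(1) r2(2) by blast
      then show ?thesis using s'(2) by simp
    qed
    have "\<phi> (G w) = z" using \<phi>(6)[OF ws] \<rho>0 unfolding w(2) by simp
    moreover have "G w \<in> ball 0 r2" using \<phi>(6)[OF ws] w by simp
    ultimately have cz: "c z = G w" using c(2)[of "G w"] by simp
    have "w \<in> cball 0 s" using ws by simp
    then have "u + w \<in> h ` ball u r1" using \<phi>(2) unfolding W_def by blast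
    then obtain v where v: "v \<in> ball u r1" "u + w = h v" by blast
    have "b z = v" unfolding b_def cz G_def v(2) using g(3)[OF v(1)] by simp
    then have "h (b z) = u + w" unfolding v(2) by simp
    then show "h (b z) = b (\<rho> * z)" by (simp only: b_def w_def)
  qed
qed

section \<open>Discrete subgroups of the plane\<close>

lemma finite_uniformly_discrete:
  fixes A :: "complex set"
  assumes r: "r > 0" and sep: "\<And>x y. x \<in> A \<Longrightarrow> y \<in> A \<Longrightarrow> dist x y < r \<Longrightarrow> x = y" and "bounded A"
  shows "finite A"
proof (rule ccontr)
  assume inf: "infinite A"
  obtain l where l: "l islimpt A"
    using Heine_Borel_imp_Bolzano_Weierstrass[OF _ inf closure_subset] assms(3) compact_closure by blast
  obtain x where x: "x \<in> A" "x \<noteq> l" "dist x l < r / 2"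
    using l r unfolding islimpt_approachable by (meson half_gt_zero)
  have d: "dist x l > 0" using x by simp
  obtain y where y: "y \<in> A" "y \<noteq> l" "dist y l < dist x l"
    using l d unfolding islimpt_approachable by meson
  have "dist x y \<le> dist x l + dist y l" by (rule dist_triangle2)
  then have "dist x y < r" using x y by linarith
  then have "x = y" using sep x y by simp
  with y(3) show False by simp
qed

text \<open>Division with remainder, twice: a shortest nonzero element \<omega> generates all
  elements on its real line, and an element of least positive height over that line supplies the
  second generator.\<close>

lemma discrete_subgroup_cases:
  fixes T :: "complex set"
  assumes diff: "\<And>s t. s \<in> T \<Longrightarrow> t \<in> T \<Longrightarrow> s - t \<in> T"
    and r: "r > 0" and disc: "\<And>t. t \<in> T \<Longrightarrow> cmod t < r \<Longrightarrow> t = 0" and t0: "t0 \<in> T" "t0 \<noteq> 0"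
  shows "(\<exists>\<omega>. \<omega> \<noteq> 0 \<and> T = range (\<lambda>n::int. of_int n * \<omega>)) \<or> is_lattice T"
proof -
  have z: "0 \<in> T" using diff[OF t0(1) t0(1)] by simp
  have um: "- t \<in> T" if "t \<in> T" for t using diff[OF z that] by simp
  have add: "s + t \<in> T" if "s \<in> T" "t \<in> T" for s t using diff[OF that(1) um[OF that(2)]] by simp
  have nat_mult: "of_nat n * t \<in> T" if "t \<in> T" for n t
    using that by (induction n) (auto simp: z add algebra_simps)
  have int_mult: "of_int n * t \<in> T" if "t \<in> T" for n t
  proof (cases "n \<ge> 0")
    case True
    then show ?thesis using nat_mult[OF that, of "nat n"] by simp
  next
    case False
    then have "of_int n * t = - (of_nat (nat (- n)) * t)" by simp
    then show ?thesis using um[OF nat_mult[OF that, of "nat (- n)"]] by metis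
  qed
  have fin: "finite {t\<in>T. cmod t \<le> R}" for R
  proof (rule finite_uniformly_discrete[OF r])
    fix x y assume "x \<in> {t \<in> T. cmod t \<le> R}" "y \<in> {t \<in> T. cmod t \<le> R}" "dist x y < r"
    then show "x = y" using disc[OF diff[of x y]] by (simp add: dist_norm)
  next
    show "bounded {t \<in> T. cmod t \<le> R}" by (rule boundedI[of _ R]) simp
  qed
  have ex_min: "\<exists>a\<in>B. \<forall>t\<in>B. f a \<le> f t" if "B \<noteq> {}" "B \<subseteq> {t\<in>T. cmod t \<le> R}" for B R and f :: "complex \<Rightarrow> real"
  proof -
    have "finite B" using that(2) fin finite_subset by blast
    then have "arg_min_on f B \<in> B" "\<forall>t\<in>B. f (arg_min_on f B) \<le> f t"
      using that(1) arg_min_if_finite(1)[of B f] arg_min_least[of B _ f] by auto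
    then show ?thesis by blast
  qed
  have "\<exists>a\<in>{t\<in>T. cmod t \<le> cmod t0 \<and> t \<noteq> 0}. \<forall>t\<in>{t\<in>T. cmod t \<le> cmod t0 \<and> t \<noteq> 0}. cmod a \<le> cmod t"
    by (rule ex_min[of _ "cmod t0"]) (use t0 in auto)
  then obtain \<omega> where \<omega>: "\<omega> \<in> T" "\<omega> \<noteq> 0" "cmod \<omega> \<le> cmod t0"
    "\<And>t. t \<in> T \<Longrightarrow> cmod t \<le> cmod t0 \<Longrightarrow> t \<noteq> 0 \<Longrightarrow> cmod \<omega> \<le> cmod t"
    by auto
  have min: "t = 0" if "t \<in> T" "cmod t < cmod \<omega>" for t
    using \<omega>(3) \<omega>(4)[OF that(1)] that(2) by (cases "t = 0") auto
  have real_mult: "\<exists>n::int. t = of_int n * \<omega>" if t: "t \<in> T" "Im (t / \<omega>) = 0" for t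
  proof -
    define x where "x = Re (t / \<omega>)"
    have tx: "t / \<omega> = of_real x" using t(2) by (simp add: x_def complex_eq_iff)
    then have tx: "t = of_real x * \<omega>" using \<omega>(2) by (simp add: field_simps)
    let ?t = "t - of_int \<lfloor>x\<rfloor> * \<omega>"
    have "?t \<in> T" by (intro diff t int_mult \<omega>)
    moreover have "?t = of_real (x - of_int \<lfloor>x\<rfloor>) * \<omega>" unfolding tx by (simp add: algebra_simps)
    then have "cmod ?t = \<bar>x - of_int \<lfloor>x\<rfloor>\<bar> * cmod \<omega>" by (simp only: norm_mult norm_of_real)
    moreover have "\<bar>x - of_int \<lfloor>x\<rfloor>\<bar> < 1" by linarith
    ultimately have "?t = 0" using \<omega>(2) by (intro min) auto
    then show ?thesis by auto
  qed
  show ?thesis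
  proof (cases "\<forall>t\<in>T. Im (t / \<omega>) = 0")
    case True
    have "T = range (\<lambda>n::int. of_int n * \<omega>)"
      using real_mult True int_mult[OF \<omega>(1)] by blast
    then show ?thesis using \<omega>(2) by blast
  next
    case False
    then obtain t1 where "t1 \<in> T" "Im (t1 / \<omega>) \<noteq> 0" by blast
    then obtain t2 where t2: "t2 \<in> T" "Im (t2 / \<omega>) > 0"
      using um[of t1] by (cases "Im (t1 / \<omega>) > 0") auto
    define h where "h = Im (t2 / \<omega>)"
    \<comment> \<open>Translation by multiples of \<omega> brings elements into the strip 0 <= Re <=
      1; the cap \<open>h\<close> on the height then leaves finitely many, so a minimum
      exists.\<close>
    define B where "B = {t\<in>T. 0 \<le> Re (t / \<omega>) \<and> Re (t / \<omega>) \<le> 1 \<and> 0 < Im (t / \<omega>) \<and> Im (t / \<omega>) \<le> h}"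
    have shift: "\<exists>s\<in>T. Im (s / \<omega>) = Im (t / \<omega>) \<and> 0 \<le> Re (s / \<omega>) \<and> Re (s / \<omega>) \<le> 1" if "t \<in> T" for t
    proof (intro bexI[of _ "t - of_int \<lfloor>Re (t / \<omega>)\<rfloor> * \<omega>"] diff that int_mult \<omega>(1))
      have "(t - of_int \<lfloor>Re (t / \<omega>)\<rfloor> * \<omega>) / \<omega> = t / \<omega> - of_int \<lfloor>Re (t / \<omega>)\<rfloor>"
        using \<omega>(2) by (simp add: field_simps)
      then show "Im ((t - of_int \<lfloor>Re (t / \<omega>)\<rfloor> * \<omega>) / \<omega>) = Im (t / \<omega>) \<and>
        0 \<le> Re ((t - of_int \<lfloor>Re (t / \<omega>)\<rfloor> * \<omega>) / \<omega>) \<and> Re ((t - of_int \<lfloor>Re (t / \<omega>)\<rfloor> * \<omega>) / \<omega>) \<le> 1"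
        by (simp add: minus_complex.simps) linarith
    qed
    have "\<exists>a\<in>B. \<forall>t\<in>B. Im (a / \<omega>) \<le> Im (t / \<omega>)"
    proof (rule ex_min[of _ "(1 + h) * cmod \<omega>"])
      show "B \<noteq> {}"
      proof -
        obtain s where "s \<in> T" "Im (s / \<omega>) = h" "0 \<le> Re (s / \<omega>)" "Re (s / \<omega>) \<le> 1"
          using shift[OF t2(1)] unfolding h_def by blast
        then have "s \<in> B" using t2(2) by (simp add: B_def h_def)
        then show ?thesis by blast
      qed
      show "B \<subseteq> {t \<in> T. cmod t \<le> (1 + h) * cmod \<omega>}"
      proof
        fix t assume t: "t \<in> B"
        have "cmod (t / \<omega>) \<le> \<bar>Re (t / \<omega>)\<bar> + \<bar>Im (t / \<omega>)\<bar>" by (rule cmod_le)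
        also have "\<dots> \<le> 1 + h" using t by (auto simp: B_def)
        finally have "cmod t / cmod \<omega> \<le> 1 + h" by (simp add: norm_divide)
        then have "cmod t \<le> (1 + h) * cmod \<omega>" using \<omega>(2) by (simp add: pos_divide_le_eq)
        then show "t \<in> {t \<in> T. cmod t \<le> (1 + h) * cmod \<omega>}" using t by (simp add: B_def)
      qed
    qed
    then obtain \<omega>2 where \<omega>2: "\<omega>2 \<in> B" "\<And>t. t \<in> B \<Longrightarrow> Im (\<omega>2 / \<omega>) \<le> Im (t / \<omega>)" by blast
    then have \<omega>2T: "\<omega>2 \<in> T" "0 < Im (\<omega>2 / \<omega>)" "Im (\<omega>2 / \<omega>) \<le> h" by (auto simp: B_def)
    \<comment> \<open>No element has height strictly between 0 and that of \<omega>2; this applies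
      to the remainder on division by \<omega>2.\<close>
    have small: "Im (t / \<omega>) = 0" if t: "t \<in> T" "0 \<le> Im (t / \<omega>)" "Im (t / \<omega>) < Im (\<omega>2 / \<omega>)" for t
    proof (rule ccontr)
      assume ne: "Im (t / \<omega>) \<noteq> 0"
      obtain s where s: "s \<in> T" "Im (s / \<omega>) = Im (t / \<omega>)" "0 \<le> Re (s / \<omega>)" "Re (s / \<omega>) \<le> 1"
        using shift[OF t(1)] by blast
      have "s \<in> B" unfolding B_def using s t ne \<omega>2T(3) by auto
      from \<omega>2(2)[OF this] s t show False by simp
    qed
    have "T = {of_int a * \<omega> + of_int b * \<omega>2 | a b. True}"
    proof (intro equalityI subsetI)
      fix t assume t: "t \<in> T"
      define y where "y = Im (t / \<omega>) / Im (\<omega>2 / \<omega>)"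
      define s where "s = t - of_int \<lfloor>y\<rfloor> * \<omega>2"
      have s: "s \<in> T" unfolding s_def by (intro diff t int_mult \<omega>2T)
      have "s / \<omega> = t / \<omega> - of_int \<lfloor>y\<rfloor> * (\<omega>2 / \<omega>)"
        unfolding s_def by (simp add: diff_divide_distrib)
      moreover have "Im (of_int n * a) = of_int n * Im a" for n :: int and a by simp
      ultimately have "Im (s / \<omega>) = Im (t / \<omega>) - of_int \<lfloor>y\<rfloor> * Im (\<omega>2 / \<omega>)"
        by (simp only: minus_complex.simps)
      also have "\<dots> = (y - of_int \<lfloor>y\<rfloor>) * Im (\<omega>2 / \<omega>)"
        using \<omega>2T(2) unfolding y_def by (simp add: left_diff_distrib)
      finally have im: "Im (s / \<omega>) = (y - of_int \<lfloor>y\<rfloor>) * Im (\<omega>2 / \<omega>)" .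
      have y01: "0 \<le> y - of_int \<lfloor>y\<rfloor>" "y - of_int \<lfloor>y\<rfloor> < 1" by linarith+
      have "(y - of_int \<lfloor>y\<rfloor>) * Im (\<omega>2 / \<omega>) < 1 * Im (\<omega>2 / \<omega>)"
        using y01 \<omega>2T(2) by (intro mult_strict_right_mono)
      moreover have "0 \<le> (y - of_int \<lfloor>y\<rfloor>) * Im (\<omega>2 / \<omega>)"
        using y01 \<omega>2T(2) by (intro mult_nonneg_nonneg) auto
      ultimately have "Im (s / \<omega>) = 0" using im by (intro small s) linarith+
      then obtain n where n: "s = of_int n * \<omega>" using real_mult[OF s] by blast
      have "t = of_int n * \<omega> + of_int \<lfloor>y\<rfloor> * \<omega>2" using n by (simp add: s_def algebra_simps)
      then show "t \<in> {of_int a * \<omega> + of_int b * \<omega>2 | a b. True}" by blast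
    next
      fix t assume "t \<in> {of_int a * \<omega> + of_int b * \<omega>2 | a b. True}"
      then obtain a b where "t = of_int a * \<omega> + of_int b * \<omega>2" by blast
      then show "t \<in> T" using add int_mult \<omega>(1) \<omega>2T(1) by simp
    qed
    moreover have "\<omega>2 / \<omega> \<notin> \<real>" using \<omega>2T(2) complex_is_Real_iff by auto
    ultimately have "is_lattice T" unfolding is_lattice_def by blast
    then show ?thesis by blast
  qed
qed

section \<open>Self-similar sets\<close>

lemma tendsto_divide_power:
  fixes z \<rho> :: complex
  assumes "cmod \<rho> > 1"
  shows "(\<lambda>j. z / \<rho> ^ j) \<longlonglongrightarrow> 0"
proof -
  have "0 < cmod \<rho>" using assms by linarith
  then have "cmod (1 / \<rho>) < 1" using assms by (simp add: norm_divide divide_less_eq_1_pos)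
  then have "(\<lambda>j. z * (1 / \<rho>) ^ j) \<longlonglongrightarrow> z * 0" by (intro tendsto_mult_left LIMSEQ_power_zero)
  then show ?thesis by (simp add: power_divide)
qed

text \<open>Points of the unit circle whose real parts tend to 0 have squares tending to -1.
  Comparing consecutive squares gives w^2 = 1, so the squares are constantly v^2 = -1.\<close>

lemma unit_rotation_limit:
  fixes v w :: complex
  assumes v: "cmod v = 1" and w: "cmod w = 1" and lim: "(\<lambda>j. Re (v * w ^ j)) \<longlonglongrightarrow> 0"
  shows "Re v = 0"
proof -
  define x where "x j = v * w ^ j" for j :: nat
  have nx: "cmod (x j) = 1" for j using v w by (simp add: x_def norm_mult norm_power)
  have sq: "Re ((x j)\<^sup>2) = 2 * (Re (x j))\<^sup>2 - 1" for j
  proof -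
    have "(Re (x j))\<^sup>2 + (Im (x j))\<^sup>2 = 1" using nx[of j] cmod_power2[of "x j"] by simp
    then show ?thesis by (simp add: power2_eq_square)
  qed
  have imsq: "\<bar>Im ((x j)\<^sup>2)\<bar> \<le> 2 * \<bar>Re (x j)\<bar>" for j
  proof -
    have "\<bar>Im (x j)\<bar> \<le> 1" using abs_Im_le_cmod[of "x j"] nx by simp
    then have "\<bar>Re (x j)\<bar> * \<bar>Im (x j)\<bar> \<le> \<bar>Re (x j)\<bar> * 1" by (intro mult_left_mono) auto
    then show ?thesis by (simp add: power2_eq_square abs_mult mult.commute)
  qed
  have lim': "(\<lambda>j. Re (x j)) \<longlonglongrightarrow> 0" using lim by (simp add: x_def)
  have "(\<lambda>j. Re ((x j)\<^sup>2)) \<longlonglongrightarrow> -1"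
  proof -
    have "(\<lambda>j. 2 * (Re (x j))\<^sup>2 - 1) \<longlonglongrightarrow> 2 * 0\<^sup>2 - 1"
      by (intro tendsto_diff tendsto_mult tendsto_power tendsto_const lim')
    then show ?thesis by (simp add: sq)
  qed
  moreover have "(\<lambda>j. Im ((x j)\<^sup>2)) \<longlonglongrightarrow> 0"
  proof (rule Lim_null_comparison)
    show "\<forall>\<^sub>F j in sequentially. norm (Im ((x j)\<^sup>2)) \<le> 2 * \<bar>Re (x j)\<bar>"
      using imsq by simp
    show "(\<lambda>j. 2 * \<bar>Re (x j)\<bar>) \<longlonglongrightarrow> 0"
      using tendsto_mult_left[OF tendsto_rabs[OF lim'], of 2] by simp
  qed
  ultimately have l: "(\<lambda>j. (x j)\<^sup>2) \<longlonglongrightarrow> -1"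
    by (simp add: tendsto_complex_iff)
  then have l1: "(\<lambda>j. (x (Suc j))\<^sup>2) \<longlonglongrightarrow> -1" by (rule LIMSEQ_Suc)
  have e1: "(\<lambda>j. (x (Suc j))\<^sup>2) = (\<lambda>j. w\<^sup>2 * (x j)\<^sup>2)"
    by (simp add: x_def power_mult_distrib mult_ac)
  have "-1 = w\<^sup>2 * -1"
    by (rule LIMSEQ_unique[OF l1[unfolded e1] tendsto_mult_left[OF l]])
  then have w2: "w\<^sup>2 = 1" by (simp add: minus_equation_iff)
  have "(\<lambda>j. (x j)\<^sup>2) = (\<lambda>j. v\<^sup>2)"
  proof
    fix j
    have "(x j)\<^sup>2 = v\<^sup>2 * (w\<^sup>2) ^ j"
      unfolding x_def power_mult_distrib power_mult[symmetric] by (simp only: mult.commute)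
    then show "(x j)\<^sup>2 = v\<^sup>2" by (simp add: w2)
  qed
  with l have "(\<lambda>j::nat. v\<^sup>2) \<longlonglongrightarrow> -1" by simp
  then have "v\<^sup>2 = -1" by (simp only: LIMSEQ_const_iff)
  then have "Re (v\<^sup>2) = -1" by simp
  moreover have "Re (v\<^sup>2) = 2 * (Re v)\<^sup>2 - 1" using sq[of 0] by (simp add: x_def)
  ultimately show ?thesis by simp
qed

text \<open>Rescaling \<open>L\<close> by \<open>\<rho> ^ -j\<close> leaves only its leading term \<open>b * z ^ k\<close>.\<close>

lemma self_similar_zero_of_Re:
  fixes L :: "complex \<Rightarrow> complex" and \<rho> :: complex
  assumes \<rho>: "cmod \<rho> > 1" and d: "d > 0" and inv: "\<And>z. z \<in> E \<Longrightarrow> cmod z < d \<Longrightarrow> z / \<rho> \<in> E"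
    and L: "L holomorphic_on ball 0 d" "L 0 = 0" "\<not> L constant_on ball 0 d"
    and Re0: "\<And>z. z \<in> E \<Longrightarrow> cmod z < d \<Longrightarrow> Re (L z) = 0"
  obtains k b g r where "k > 0" "b \<noteq> 0" "\<And>z. z \<in> E \<Longrightarrow> cmod z < d \<Longrightarrow> Re (b * z ^ k) = 0"
    "r > 0" "g holomorphic_on ball 0 r" "g 0 = b" "\<And>z. z \<in> ball 0 r \<Longrightarrow> L z = z ^ k * g z"
proof -
  have "0 \<in> ball (0::complex) d" using d by simp
  then obtain g r k where k: "0 < k" and r: "0 < r" "ball 0 r \<subseteq> ball (0::complex) d"
    and g: "g holomorphic_on ball 0 r" "\<And>w. w \<in> ball 0 r \<Longrightarrow> L w = (w - 0) ^ k * g w" "\<And>w. w \<in> ball 0 r \<Longrightarrow> g w \<noteq> 0"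
    using holomorphic_factor_zero_nonconstant[OF L(1) open_ball connected_ball _ L(2,3)] by metis
  define b where "b = g 0"
  have b: "b \<noteq> 0" using g(3)[of 0] r by (simp add: b_def)
  have key: "Re (b * z ^ k) = 0" if z: "z \<in> E" "cmod z < d" for z :: complex
  proof (cases "z = 0")
    case True
    then show ?thesis using k by (simp add: power_0_left)
  next
    case False
    have \<rho>0: "\<rho> \<noteq> 0" using \<rho> by auto
    define y where "y j = z / \<rho> ^ j" for j :: nat
    have yE: "y j \<in> E \<and> cmod (y j) < d" for j
    proof (induction j)
      case (Suc j)
      have eq: "y (Suc j) = y j / \<rho>" by (simp add: y_def)
      have "cmod (y j / \<rho>) \<le> cmod (y j)"
      proof -
        have "cmod (y j) * 1 \<le> cmod (y j) * cmod \<rho>" using \<rho> by (intro mult_left_mono) auto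
        then show ?thesis unfolding norm_divide using \<rho> by (subst pos_divide_le_eq) auto
      qed
      then have "cmod (y (Suc j)) < d" using Suc unfolding eq by linarith
      moreover have "y (Suc j) \<in> E" unfolding eq using inv Suc by simp
      ultimately show ?case by simp
    qed (use z in \<open>simp add: y_def\<close>)
    have y0: "y \<longlonglongrightarrow> 0" unfolding y_def by (rule tendsto_divide_power[OF \<rho>])
    \<comment> \<open>Divided by the positive number |b * y j ^ k|, the value \<open>L (y j)\<close>
      becomes v * w ^ j up to the factor g (y j) / b, which tends to 1. As \<open>L (y j)\<close>
      has real part 0, the real part of v * w ^ j tends to 0.\<close>
    define v where "v = sgn (b * z ^ k)"
    define w where "w = sgn (1 / \<rho> ^ k)"
    have vw: "cmod v = 1" "cmod w = 1" 
    proof -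
      have "b * z ^ k \<noteq> 0" "1 / \<rho> ^ k \<noteq> 0" using b False \<rho>0 by simp_all
      then show "cmod v = 1" "cmod w = 1" unfolding v_def w_def norm_sgn by simp_all
    qed
    have sg: "sgn (b * y j ^ k) = v * w ^ j" for j
    proof -
      have "b * y j ^ k = (b * z ^ k) * (1 / \<rho> ^ k) ^ j"
        by (simp add: y_def power_divide mult.commute flip: power_mult)
      moreover have "sgn (a ^ n) = sgn a ^ n" for a :: complex and n :: nat
        by (induction n) (simp_all add: sgn_mult)
      ultimately show ?thesis by (simp only: v_def w_def sgn_mult)
    qed
    have gl: "(\<lambda>j. g (y j)) \<longlonglongrightarrow> b"
    proof -
      have "isCont g 0"
        using holomorphic_on_imp_continuous_on[OF g(1)] r(1) by (simp add: continuous_on_eq_continuous_at)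
      then show ?thesis unfolding b_def using y0 by (rule isCont_tendsto_compose)
    qed
    have "(\<lambda>j. v * w ^ j - v * w ^ j * (g (y j) / b)) \<longlonglongrightarrow> 0"
    proof (rule Lim_null_comparison)
      show "\<forall>\<^sub>F j in sequentially. cmod (v * w ^ j - v * w ^ j * (g (y j) / b)) \<le> cmod (1 - g (y j) / b)"
      proof (rule always_eventually, rule allI)
        fix j
        have "v * w ^ j - v * w ^ j * (g (y j) / b) = v * w ^ j * (1 - g (y j) / b)"
          by (simp add: algebra_simps)
        then show "cmod (v * w ^ j - v * w ^ j * (g (y j) / b)) \<le> cmod (1 - g (y j) / b)"
          using vw by (simp add: norm_mult norm_power)
      qed
      have "(\<lambda>j. cmod (1 - g (y j) / b)) \<longlonglongrightarrow> cmod (1 - b / b)"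
        by (intro tendsto_norm tendsto_diff tendsto_divide tendsto_const gl b)
      then show "(\<lambda>j. cmod (1 - g (y j) / b)) \<longlonglongrightarrow> 0" using b by simp
    qed
    then have "(\<lambda>j. Re (v * w ^ j - v * w ^ j * (g (y j) / b))) \<longlonglongrightarrow> Re 0"
      by (rule tendsto_Re)
    moreover have "\<forall>\<^sub>F j in sequentially. Re (v * w ^ j - v * w ^ j * (g (y j) / b)) = Re (v * w ^ j)"
    proof -
      have "\<forall>\<^sub>F j in sequentially. dist (y j) 0 < r" using y0 r(1) tendstoD by blast
      then show ?thesis
      proof eventually_elim
        case (elim j)
        have "L (y j) = (y j) ^ k * g (y j)" using g(2)[of "y j"] elim by simp
        moreover have "b * Y / N * (G / b) = 1 / N * (Y * G)" for Y N G :: complex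
          using b by simp
        ultimately have "v * w ^ j * (g (y j) / b) = of_real (1 / cmod (b * y j ^ k)) * L (y j)"
          unfolding sg[symmetric] sgn_eq by (simp only: of_real_divide of_real_1)
        moreover have "Re (of_real a * z) = a * Re z" for a z by simp
        ultimately have "Re (v * w ^ j * (g (y j) / b)) = 1 / cmod (b * y j ^ k) * Re (L (y j))"
          by (simp only:)
        also have "\<dots> = 0" using Re0[of "y j"] yE[of j] by simp
        finally show ?case by simp
      qed
    qed
    ultimately have "(\<lambda>j. Re (v * w ^ j)) \<longlonglongrightarrow> Re 0"
      by (rule Lim_transform_eventually)
    then have "(\<lambda>j. Re (v * w ^ j)) \<longlonglongrightarrow> 0" by simp
    then have "Re v = 0" by (rule unit_rotation_limit[OF vw])
    moreover have "b * z ^ k = of_real (cmod (b * z ^ k)) * v"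
      using b False by (simp add: v_def sgn_div_norm scaleR_conv_of_real)
    moreover have "Re (of_real x * v) = x * Re v" for x by simp
    ultimately show ?thesis by (metis mult_zero_right)
  qed
  show ?thesis
    by (rule that[OF k b key r(1) g(1) b_def[symmetric]]) (use g(2) in auto)
qed

text \<open>Schwarz reflection: \<open>h\<close> and its conjugate z \<mapsto> cnj (h (cnj z)) agree
  on \<open>E\<close>, which accumulates at 0, and hence on the whole disc.\<close>

lemma holomorphic_real_on_real:
  fixes h :: "complex \<Rightarrow> complex"
  assumes h: "h holomorphic_on ball 0 d" "d > 0" and E: "0 islimpt E" "E \<subseteq> \<real>"
    and re: "\<And>t. t \<in> E \<Longrightarrow> cmod t < d \<Longrightarrow> h t \<in> \<real>"
    and t: "t \<in> \<real>" "cmod t < d"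
  shows "deriv h t \<in> \<real>"
proof -
  define k where "k = cnj \<circ> h \<circ> cnj"
  have "cnj ` ball 0 d = ball 0 d"
  proof (intro equalityI subsetI)
    fix z assume "z \<in> ball (0::complex) d"
    then have "z = cnj (cnj z)" "cnj z \<in> ball 0 d" by auto
    then show "z \<in> cnj ` ball 0 d" by (rule image_eqI)
  qed auto
  then have k: "k holomorphic_on ball 0 d"
    unfolding k_def using h(1) by (intro holomorphic_on_compose_cnj_cnj) auto
  have cE: "cnj t = t" if "t \<in> E" for t using E(2) that Reals_cnj_iff by blast
  have eq: "h z - k z = 0" if "z \<in> ball 0 d" for z
  proof (rule analytic_continuation[of "\<lambda>z. h z - k z" "ball 0 d" "E \<inter> ball 0 d" 0 z])
    show "0 islimpt (E \<inter> ball 0 d)"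
      by (rule islimpt_Int_open[OF E(1) open_ball]) (use h(2) in simp)
    show "h z - k z = 0" if "z \<in> E \<inter> ball 0 d" for z
      using cE[of z] re[of z] that by (simp add: k_def Reals_cnj_iff)
  qed (use h k that in \<open>auto intro!: holomorphic_intros\<close>)
  have tb: "t \<in> ball 0 d" using t(2) by simp
  have ct: "cnj t = t" using t(1) by (simp add: Reals_cnj_iff)
  have dh: "(h has_field_derivative deriv h t) (at t)"
    using h(1) tb holomorphic_derivI by blast
  then have "(k has_field_derivative cnj (deriv h t)) (at t)"
    unfolding k_def by (intro has_field_derivative_cnj_cnj) (simp add: ct)
  moreover have "(k has_field_derivative deriv h t) (at t)"
    by (rule has_field_derivative_transform_within_open[OF dh open_ball tb]) (use eq in auto)
  ultimately have "cnj (deriv h t) = deriv h t" by (rule DERIV_unique)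
  then show ?thesis by (simp add: Reals_cnj_iff)
qed

text \<open>If \<theta>' were not constant, log (\<theta>' / \<theta>' 0) would have zero real part
  on \<open>E\<close>, and self-similarity would put \<open>E\<close> on finitely many lines through
  0. But \<theta> sends 0 to y \<noteq> 0, away from the crossing point of these lines, and maps
  \<open>E\<close> near 0 into \<open>E\<close>; so near 0 the set lies on one line. There \<theta>'
  is, up to a constant factor, real of constant modulus, and therefore constant.\<close>

lemma self_similar_constant_modulus:
  fixes \<theta> :: "complex \<Rightarrow> complex" and \<rho> y :: complex
  assumes \<rho>: "cmod \<rho> > 1" and d: "d > 0"
    and inv: "\<And>z. z \<in> E \<Longrightarrow> cmod z < d \<Longrightarrow> z / \<rho> \<in> E" and lim: "0 islimpt E"
    and \<theta>: "\<theta> holomorphic_on ball 0 e" "e > 0" "e \<le> d" "\<theta> 0 = y" "y \<noteq> 0" "y \<in> E" "deriv \<theta> 0 \<noteq> 0"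
    and yd: "cmod y < d"
    and map: "\<And>z. z \<in> E \<Longrightarrow> cmod z < e \<Longrightarrow> \<theta> z \<in> E \<and> cmod (\<theta> z) < d"
    and mod: "\<And>z. z \<in> E \<Longrightarrow> cmod z < e \<Longrightarrow> cmod (deriv \<theta> z) = cmod (deriv \<theta> 0)"
  shows "deriv \<theta> constant_on ball 0 e"
proof (rule ccontr)
  assume nc: "\<not> deriv \<theta> constant_on ball 0 e"
  have \<rho>0: "\<rho> \<noteq> 0" using \<rho> by auto
  have d\<theta>: "deriv \<theta> holomorphic_on ball 0 e" using \<theta>(1) by (simp add: holomorphic_deriv)
  have limE: "0 islimpt (E \<inter> ball 0 s)" if "s > 0" for s
    by (rule islimpt_Int_open[OF lim open_ball]) (use that in simp)
  have scale: "z / \<rho> ^ j \<in> E" if "z \<in> E" "cmod z < d" for z j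
  proof -
    have "z / \<rho> ^ j \<in> E \<and> cmod (z / \<rho> ^ j) < d"
    proof (induction j)
      case (Suc j)
      have eq: "z / \<rho> ^ Suc j = (z / \<rho> ^ j) / \<rho>" by simp
      let ?a = "z / \<rho> ^ j"
      have "cmod ?a * 1 \<le> cmod ?a * cmod \<rho>" using \<rho> by (intro mult_left_mono) auto
      then have "cmod (?a / \<rho>) \<le> cmod ?a" unfolding norm_divide[of ?a \<rho>] using \<rho> by (simp only: pos_divide_le_eq)
      then show ?case unfolding eq using Suc inv[of ?a] by linarith
    qed (use that in simp)
    then show ?thesis by simp
  qed
  \<comment> \<open>Normalised to q 0 = 1: near 0 the principal logarithm of \<open>q\<close> is
    holomorphic, and its real part log |q| vanishes on \<open>E\<close>.\<close>
  define q where "q z = deriv \<theta> z / deriv \<theta> 0" for z :: complex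
  have q: "q holomorphic_on ball 0 e" unfolding q_def by (rule holomorphic_on_divide[OF d\<theta> holomorphic_on_const \<theta>(7)])
  have q0: "q 0 = 1" using \<theta>(7) by (simp add: q_def)
  have "isCont q 0"
    using holomorphic_on_imp_continuous_on[OF q] \<theta>(2) by (simp add: continuous_on_eq_continuous_at)
  then obtain e0 where e0: "e0 > 0" "\<And>z. dist z 0 < e0 \<Longrightarrow> dist (q z) (q 0) < 1"
    unfolding continuous_at_eps_delta by (metis zero_less_one)
  define e1 where "e1 = min e0 e"
  have e1: "e1 > 0" "e1 \<le> e" "e1 \<le> d" using e0 \<theta>(2,3) by (auto simp: e1_def)
  have qpos: "Re (q z) > 0" if "z \<in> ball 0 e1" for z
  proof -
    have "cmod (q z - 1) < 1" using e0(2)[of z] that q0 by (simp add: e1_def dist_norm)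
    then have "\<bar>Re (q z - 1)\<bar> < 1" using abs_Re_le_cmod[of "q z - 1"] by linarith
    then show ?thesis by simp
  qed
  have sub1: "ball 0 e1 \<subseteq> ball (0::complex) e" using e1 by auto
  define L where "L z = Ln (q z)" for z
  have L: "L holomorphic_on ball 0 e1"
  proof -
    have "q z \<notin> \<real>\<^sub>\<le>\<^sub>0" if "z \<in> ball 0 e1" for z using qpos[OF that] by (auto simp: complex_nonpos_Reals_iff)
    then show ?thesis unfolding L_def
      by (intro holomorphic_on_Ln' holomorphic_on_subset[OF q sub1])
  qed
  have L0: "L 0 = 0" by (simp add: L_def q0)
  have qexp: "q z = exp (L z)" if "z \<in> ball 0 e1" for z
  proof -
    have "q z \<noteq> 0" using qpos[OF that] by auto
    then show ?thesis by (simp add: L_def)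
  qed
  have Lnc: "\<not> L constant_on ball 0 e1"
  proof
    assume "L constant_on ball 0 e1"
    then obtain c where c: "\<And>z. z \<in> ball 0 e1 \<Longrightarrow> L z = c" unfolding constant_on_def by metis
    have "c = 0" using c[of 0] L0 e1 by simp
    then have near: "deriv \<theta> z - deriv \<theta> 0 = 0" if "z \<in> ball 0 e1" for z
      using qexp[OF that] c[OF that] \<theta>(7) by (simp add: q_def)
    have "deriv \<theta> z - deriv \<theta> 0 = 0" if "z \<in> ball 0 e" for z
    proof (rule analytic_continuation[of "\<lambda>z. deriv \<theta> z - deriv \<theta> 0" "ball 0 e" "ball 0 e1" 0 z])
      show "0 islimpt ball (0::complex) e1" using e1 by (simp add: islimpt_ball)
      show "(\<lambda>z. deriv \<theta> z - deriv \<theta> 0) holomorphic_on ball 0 e"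
        by (intro holomorphic_on_diff holomorphic_on_const d\<theta>)
    qed (use sub1 that \<theta>(2) near in auto)
    then have "deriv \<theta> constant_on ball 0 e"
      unfolding constant_on_def by (intro exI[of _ "deriv \<theta> 0"]) auto
    with nc show False by simp
  qed
  have inv1: "z / \<rho> \<in> E" if "z \<in> E" "cmod z < e1" for z
    using inv[OF that(1)] that(2) e1 by simp
  have ReL: "Re (L z) = 0" if "z \<in> E" "cmod z < e1" for z
  proof -
    have zb: "z \<in> ball 0 e1" using that by simp
    have "cmod (q z) = 1" using mod[OF that(1)] that(2) e1 \<theta>(7) by (simp add: q_def norm_divide)
    then show ?thesis using qexp[OF zb] by (simp add: norm_exp_eq_Re)
  qed
  obtain k b where k: "(k::nat) > 0" "b \<noteq> 0" "\<And>z. z \<in> E \<Longrightarrow> cmod z < e1 \<Longrightarrow> Re (b * z ^ k) = 0"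
    using self_similar_zero_of_Re[OF \<rho> e1(1) inv1 L L0 Lnc ReL] by metis
  \<comment> \<open>scaling extends this relation from the small disc to all of \<open>E\<close>\<close>
  have "\<forall>\<^sub>F j in sequentially. dist (of_real d / \<rho> ^ j) 0 < e1"
    using tendsto_divide_power[OF \<rho>] e1(1) by (rule tendstoD)
  then obtain j where "dist (of_real d / \<rho> ^ j) 0 < e1"
    using eventually_sequentially by auto
  then have j: "d / cmod \<rho> ^ j < e1" using d by (simp add: norm_power norm_divide)
  define b' where "b' = b / (\<rho> ^ j) ^ k"
  have b': "b' \<noteq> 0" using k(2) \<rho>0 by (simp add: b'_def)
  have smallj: "cmod (z / \<rho> ^ j) < e1" if "cmod z < d" for z
  proof -
    have "cmod z / cmod \<rho> ^ j < d / cmod \<rho> ^ j" using that \<rho>0 by (intro divide_strict_right_mono) auto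
    then show ?thesis using j by (simp add: norm_divide norm_power)
  qed
  have Reb': "Re (b' * z ^ k) = 0" if "z \<in> E" "cmod z < d" for z
    using k(3)[OF scale[OF that, of j] smallj[OF that(2)]] by (simp add: b'_def power_divide)
  \<comment> \<open>so \<open>(\<theta>/y) ^ k\<close> is real on \<open>E\<close>, with nonvanishing derivative at \<open>0\<close>\<close>
  define L2 where "L2 z = \<i> * ((\<theta> z / y) ^ k - 1)" for z
  have L2: "L2 holomorphic_on ball 0 e" unfolding L2_def using \<theta>(1,5) by (intro holomorphic_intros) auto
  have L20: "L2 0 = 0" using \<theta>(4,5) by (simp add: L2_def)
  have zb0: "0 \<in> ball (0::complex) e" using \<theta>(2) by simp
  have dth: "(\<theta> has_field_derivative deriv \<theta> 0) (at 0)"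
    using \<theta>(1) zb0 holomorphic_derivI by blast
  have "(L2 has_field_derivative \<i> * (of_nat k * (deriv \<theta> 0 / y))) (at 0)"
    unfolding L2_def using dth \<theta>(4,5) by (auto intro!: derivative_eq_intros)
  then have dL2: "deriv L2 0 = \<i> * (of_nat k * (deriv \<theta> 0 / y))" by (rule DERIV_imp_deriv)
  then have dL2n: "deriv L2 0 \<noteq> 0" using k(1) \<theta>(5,7) by simp
  have L2nc: "\<not> L2 constant_on ball 0 e"
    by (rule holomorphic_nonconstant[OF L2 open_ball zb0 dL2n])
  have inv2: "z / \<rho> \<in> E" if "z \<in> E" "cmod z < e" for z
    using inv[OF that(1)] that(2) \<theta>(3) by simp
  have ReL2: "Re (L2 z) = 0" if "z \<in> E" "cmod z < e" for z
  proof -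
    define c where "c = Im (b' * y ^ k)"
    have c: "b' * y ^ k = \<i> * of_real c"
      using Reb'[OF \<theta>(6) yd] by (simp add: complex_eq_iff c_def)
    have cn: "c \<noteq> 0" using c b' \<theta>(5) by auto
    have "b' * \<theta> z ^ k = (b' * y ^ k) * (\<theta> z / y) ^ k" using \<theta>(5) by (simp add: power_divide)
    also have "\<dots> = of_real c * (\<i> * (\<theta> z / y) ^ k)" unfolding c by simp
    finally have "c * Re (\<i> * (\<theta> z / y) ^ k) = 0"
      using Reb'[of "\<theta> z"] map[OF that] by simp
    then have "Re (\<i> * (\<theta> z / y) ^ k) = 0" using cn by simp
    then show ?thesis by (simp add: L2_def right_diff_distrib)
  qed
  obtain k2 b2 g r2 where k2: "(k2::nat) > 0" "b2 \<noteq> 0" "\<And>z. z \<in> E \<Longrightarrow> cmod z < e \<Longrightarrow> Re (b2 * z ^ k2) = 0"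
    "r2 > 0" "g holomorphic_on ball 0 r2" "g 0 = b2" "\<And>z. z \<in> ball 0 r2 \<Longrightarrow> L2 z = z ^ k2 * g z"
    using self_similar_zero_of_Re[OF \<rho> \<theta>(2) inv2 L2 L20 L2nc ReL2] by metis
  \<comment> \<open>\<open>k2\<close> is the order of vanishing of \<open>L2\<close> at 0, and
    \<open>L2\<close> has nonzero derivative there because the k-th power is unramified at y / y =
    1. A single line is thus left.\<close>
  have "k2 = 1"
  proof (rule ccontr)
    assume "k2 \<noteq> 1"
    then obtain l where l: "k2 = Suc (Suc l)" using k2(1) by (metis One_nat_def gr0_conv_Suc not0_implies_Suc)
    have zr: "0 \<in> ball (0::complex) r2" using k2(4) by simp
    have "(g has_field_derivative deriv g 0) (at 0)" using k2(5) zr holomorphic_derivI by blast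
    then have "((\<lambda>z. z ^ k2 * g z) has_field_derivative 0) (at 0)"
      unfolding l by (auto intro!: derivative_eq_intros)
    then have "(L2 has_field_derivative 0) (at 0)"
      by (rule has_field_derivative_transform_within_open[OF _ open_ball zr]) (use k2(7) in simp)
    then have "deriv L2 0 = 0" by (rule DERIV_imp_deriv)
    with dL2n show False by simp
  qed
  then have line: "Re (b2 * z) = 0" if "z \<in> E" "cmod z < e" for z
    using k2(3)[OF that] by simp
  \<comment> \<open>hence \<open>E\<close> lies on the line \<open>c * \<real>\<close>, and \<open>\<theta>\<close> is real in the corresponding coordinates\<close>
  define c where "c = \<i> / b2"
  have c0: "c \<noteq> 0" using k2(2) by (simp add: c_def)
  have real_c: "z / c \<in> \<real>" if "z \<in> E" "cmod z < e" for z
    using line[OF that] k2(2) by (simp add: c_def complex_is_Real_iff field_simps)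
  have real_y: "z / y \<in> \<real>" if z: "z \<in> E" "cmod z < d" for z
  proof -
    have 1: "(z / \<rho> ^ j) / c \<in> \<real>"
      using smallj[OF z(2)] e1 by (intro real_c scale z) auto
    have 2: "(y / \<rho> ^ j) / c \<in> \<real>"
      using smallj[OF yd] e1 by (intro real_c scale \<theta>(6) yd) auto
    have "((z / \<rho> ^ j) / c) / ((y / \<rho> ^ j) / c) \<in> \<real>" using 1 2 by (rule Reals_divide)
    also have "((z / \<rho> ^ j) / c) / ((y / \<rho> ^ j) / c) = z / y" using \<rho>0 c0 by simp
    finally show ?thesis .
  qed
  define m where "m = e / cmod c"
  have m: "m > 0" using \<theta>(2) c0 by (simp add: m_def)
  have cm: "c * t \<in> ball 0 e" if "cmod t < m" for t
    using that c0 by (simp add: m_def norm_mult field_simps)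
  define h where "h t = \<theta> (c * t) / y" for t
  define E' where "E' = {t. c * t \<in> E \<and> cmod t < m}"
  have E'R: "E' \<subseteq> \<real>"
  proof
    fix t assume t: "t \<in> E'"
    then have "(c * t) / c \<in> \<real>" using cm[of t] by (intro real_c) (auto simp: E'_def)
    then show "t \<in> \<real>" using c0 by simp
  qed
  have E'lim: "0 islimpt E'"
  proof (rule islimptI)
    fix T :: "complex set" assume T: "0 \<in> T" "open T"
    have "open ((\<lambda>z. z / c) -` T)" by (intro open_vimage T continuous_intros) (use c0 in auto)
    moreover have "0 \<in> (\<lambda>z. z / c) -` T" using T by simp
    ultimately obtain z where z: "z \<in> E \<inter> ball 0 e" "z \<in> (\<lambda>z. z / c) -` T" "z \<noteq> 0"
      using islimptE[OF limE[OF \<theta>(2)]] by metis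
    then have "z / c \<in> E'" using c0 by (simp add: E'_def m_def norm_divide divide_strict_right_mono)
    then show "\<exists>t\<in>E'. t \<in> T \<and> t \<noteq> 0" using z c0 by (intro bexI[of _ "z / c"]) auto
  qed
  have hh: "h holomorphic_on ball 0 m"
  proof -
    have "(\<theta> \<circ> (\<lambda>t. c * t)) holomorphic_on ball 0 m"
      by (rule holomorphic_on_compose_gen[OF _ \<theta>(1)]) (use cm in \<open>auto intro!: holomorphic_intros\<close>)
    then show ?thesis unfolding h_def comp_def using \<theta>(5) by (intro holomorphic_intros) auto
  qed
  have dh: "deriv h t = c / y * deriv \<theta> (c * t)" if "cmod t < m" for t
  proof -
    have "(\<theta> has_field_derivative deriv \<theta> (c * t)) (at (c * t))"
      using \<theta>(1) cm[OF that] holomorphic_derivI by blast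
    moreover have "((\<lambda>t. c * t) has_field_derivative c) (at t)"
      by (auto intro!: derivative_eq_intros)
    ultimately have "((\<lambda>t. \<theta> (c * t)) has_field_derivative deriv \<theta> (c * t) * c) (at t)"
      by (rule DERIV_chain2)
    then have "(h has_field_derivative deriv \<theta> (c * t) * c / y) (at t)"
      unfolding h_def by (rule DERIV_cdivide)
    then show ?thesis by (simp add: DERIV_imp_deriv)
  qed
  have hr: "deriv h t \<in> \<real>" if "t \<in> \<real>" "cmod t < m" for t
  proof (rule holomorphic_real_on_real[OF hh m E'lim E'R _ that])
    show "h t \<in> \<real>" if "t \<in> E'" "cmod t < m" for t
      unfolding h_def using map[of "c * t"] cm[of t] that by (intro real_y) (auto simp: E'_def)
  qed
  have zm: "cmod 0 < m" using m by simp
  have "continuous_on (ball 0 m) (deriv h)"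
    using hh by (intro holomorphic_on_imp_continuous_on holomorphic_deriv) auto
  then have "isCont (deriv h) 0" using m by (simp add: continuous_on_eq_continuous_at)
  moreover have dh0: "deriv h 0 \<noteq> 0" using dh[OF zm] c0 \<theta>(5,7) by simp
  ultimately obtain m0 where m0: "m0 > 0" "\<And>t. dist t 0 < m0 \<Longrightarrow> dist (deriv h t) (deriv h 0) < cmod (deriv h 0)"
    unfolding continuous_at_eps_delta by (metis zero_less_norm_iff)
  \<comment> \<open>Two real numbers of equal modulus whose distance is less than that modulus
    coincide.\<close>
  have const: "deriv h t - deriv h 0 = 0" if t: "t \<in> E' \<inter> ball 0 m0" for t
  proof -
    have tm: "cmod t < m" "c * t \<in> E" using t by (auto simp: E'_def)
    have "t \<in> \<real>" using t E'R by blast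
    then obtain x where x: "deriv h t = of_real x" using hr[of t] tm Reals_cases by metis
    obtain x0 where x0: "deriv h 0 = of_real x0" using hr[OF Reals_0 zm] Reals_cases by metis
    have "cmod (deriv h t) = cmod (deriv h 0)"
      using dh[OF tm(1)] dh[OF zm] mod[OF tm(2)] cm[OF tm(1)] by (simp add: norm_mult norm_divide)
    then have "\<bar>x\<bar> = \<bar>x0\<bar>" unfolding x x0 by simp
    moreover have "\<bar>x - x0\<bar> < \<bar>x0\<bar>"
    proof -
      have "dist (complex_of_real x) (complex_of_real x0) < \<bar>x0\<bar>"
        using m0(2)[of t] t unfolding x x0 by simp
      then show ?thesis by (simp only: dist_of_real dist_real_def)
    qed
    ultimately have "x = x0" by linarith
    then show ?thesis by (simp add: x x0)
  qed
  have "deriv h t - deriv h 0 = 0" if t: "t \<in> ball 0 m" for t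
  proof (rule analytic_continuation[OF _ open_ball connected_ball _ _ _ const t])
    show "(\<lambda>t. deriv h t - deriv h 0) holomorphic_on ball 0 m"
      by (intro holomorphic_on_diff holomorphic_on_const holomorphic_deriv[OF hh open_ball])
    show "E' \<inter> ball 0 m0 \<subseteq> ball 0 m" by (auto simp: E'_def)
    show "0 islimpt E' \<inter> ball 0 m0"
      by (rule islimpt_Int_open[OF E'lim open_ball]) (use m0(1) in simp)
  qed (use m in auto)
  then have "deriv \<theta> z = deriv \<theta> 0" if z: "z \<in> ball 0 e" for z
  proof -
    have t: "cmod (z / c) < m" using z c0 by (simp add: m_def norm_divide divide_strict_right_mono)
    have "deriv h (z / c) = deriv h 0" using \<open>\<And>t. t \<in> ball 0 m \<Longrightarrow> _\<close>[of "z / c"] t by simp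
    then show ?thesis using dh[OF t] dh[OF zm] c0 \<theta>(5) by simp
  qed
  then have "deriv \<theta> constant_on ball 0 e"
    unfolding constant_on_def by (intro exI[of _ "deriv \<theta> 0"]) auto
  with nc show False by simp
qed

section \<open>Repellers and their Poincare functions\<close>

text \<open>\<open>m\<close> is the exponent from the definition of a CER. In contrast,
  \<open>mixing\<close> concerns every large iterate of \<open>f\<close>, not only multiples of
  \<open>m\<close>, since consecutive return times will be compared. \<open>K_ne\<close> provides a
  chart that contains \<open>K\<close>.\<close>

locale repeller =
  fixes f :: "P1 \<Rightarrow> P1" and K V :: "P1 set" and m :: nat
  assumes endo: "P1_endo f" and compact_K: "compact K" and image_K: "f ` K = K" and inf_K: "infinite K"
    and K_ne: "K \<noteq> UNIV" and m: "m \<ge> 1"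
    and V: "open V" "K \<subseteq> V" and isol: "\<And>x. (\<And>n. (f ^^ (m * n)) x \<in> V) \<Longrightarrow> x \<in> K"
    and mixing: "\<And>U. open U \<Longrightarrow> U \<inter> K \<noteq> {} \<Longrightarrow> \<exists>n0. \<forall>n\<ge>n0. (f ^^ n) ` (U \<inter> K) = K"
    and expand: "\<exists>C>0. \<exists>\<rho>>1. \<forall>x\<in>K. \<forall>n\<ge>1. spherical_deriv (f ^^ (n * m)) x \<ge> C * \<rho> ^ n"
    and sderiv_pos: "\<And>x. x \<in> K \<Longrightarrow> spherical_deriv f x > 0"

lemma funpow_image_fixed:
  assumes "f ` K = K"
  shows "(f ^^ n) ` K = K"
proof (induction n)
  case (Suc n)
  have "(f ^^ Suc n) ` K = f ` ((f ^^ n) ` K)" by (simp add: image_image)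
  then show ?case using Suc assms by simp
qed simp

lemma sderiv_pos_funpow:
  assumes "P1_endo f" "spherical_deriv (f ^^ m) x > 0" "m \<ge> 1"
  shows "spherical_deriv f x > 0"
proof -
  obtain k where k: "m = Suc k" using assms(3) by (cases m) auto
  have "f ^^ m = (f ^^ k) \<circ> f" unfolding k by (rule funpow_Suc_right)
  then have "spherical_deriv (f ^^ m) x = spherical_deriv (f ^^ k) (f x) * spherical_deriv f x"
    using sderiv_comp[OF P1_endo_funpow[OF assms(1)] assms(1)] by simp
  then have "spherical_deriv f x \<noteq> 0" using assms(2) by auto
  then show ?thesis using sderiv_nonneg[of f x] by linarith
qed

lemma is_CER_repeller:
  assumes f: "P1_morphism_of_degree f d" "d \<ge> 2" and K: "is_CER f K" "f ` K = K" "infinite K"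
  obtains m V where "repeller f K V m"
proof -
  have e: "P1_endo f" using P1_morphism_endo[OF f(1)] .
  from conjunct2[OF K(1)[unfolded is_CER_def]] obtain m where mm: "m \<ge> 1 \<and>
    (\<exists>V. K \<subseteq> interior V \<and> (f ^^ m) ` K = K \<and> K = (\<Inter>n. (f ^^ (m * n)) -` V)) \<and>
    (\<exists>C>0. \<exists>\<rho>>1. \<forall>x\<in>K. \<forall>n\<ge>1. spherical_deriv (f ^^ (n * m)) x \<ge> C * \<rho> ^ n) \<and>
    (\<forall>U. openin (top_of_set K) U \<and> U \<noteq> {} \<longrightarrow> (\<exists>n. (f ^^ (m * n)) ` U = K))"
    by (rule exE)
  note m = conjunct1[OF mm] conjunct1[OF conjunct2[OF mm]]
    and ex = conjunct1[OF conjunct2[OF conjunct2[OF mm]]]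
    and mix = conjunct2[OF conjunct2[OF conjunct2[OF mm]]]
  from m(2) obtain V where V: "K \<subseteq> interior V" "K = (\<Inter>n. (f ^^ (m * n)) -` V)" by (elim exE conjE)
  have pos: "spherical_deriv f x > 0" if x: "x \<in> K" for x
  proof -
    obtain C \<rho> where C: "C > (0::real)" "\<rho> > (1::real)" "spherical_deriv (f ^^ (1 * m)) x \<ge> C * \<rho> ^ 1"
      using ex x by (metis le_refl)
    have "C * \<rho> ^ 1 > 0" using C(1,2) by simp
    then have "spherical_deriv (f ^^ m) x > 0" using C(3) by simp
    then show ?thesis using sderiv_pos_funpow[OF e _ m(1)] by simp
  qed
  have powK: "(f ^^ n) ` K = K" for n by (rule funpow_image_fixed[OF K(2)])
  have "repeller f K (interior V) m"
  proof
    show "compact K" using K(1) unfolding is_CER_def by (rule conjunct1)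
    \<comment> \<open>The derivative is positive on \<open>K\<close>, so a critical point lies
      outside.\<close>
    obtain c where "spherical_deriv f c = 0" by (rule sderiv_has_zero[OF f])
    then have "c \<notin> K" using pos[of c] by auto
    then show "K \<noteq> UNIV" by blast
    show "x \<in> K" if x: "\<And>n. (f ^^ (m * n)) x \<in> interior V" for x
    proof -
      have "x \<in> (\<Inter>n. (f ^^ (m * n)) -` V)" using x interior_subset by blast
      then show ?thesis using V(2) by simp
    qed
    show "\<exists>n0. \<forall>n\<ge>n0. (f ^^ n) ` (U \<inter> K) = K" if U: "open U" "U \<inter> K \<noteq> {}" for U
    proof -
      have "openin (top_of_set K) (U \<inter> K)" using U(1) by (simp add: openin_open_Int Int_commute)
      then obtain n where n: "(f ^^ (m * n)) ` (U \<inter> K) = K" using mix U(2) by blast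
      have "(f ^^ N) ` (U \<inter> K) = K" if "N \<ge> m * n" for N
      proof -
        have "f ^^ N = (f ^^ (N - m * n)) \<circ> (f ^^ (m * n))" using that by (simp flip: funpow_add)
        then have "(f ^^ N) ` (U \<inter> K) = (f ^^ (N - m * n)) ` ((f ^^ (m * n)) ` (U \<inter> K))"
          by (simp add: image_comp)
        then show ?thesis unfolding n powK .
      qed
      then show ?thesis by blast
    qed
  qed (use e K m V ex pos in simp_all)
  then show ?thesis by (rule that)
qed

lemma sderiv_id: "spherical_deriv id x = 1"
proof -
  obtain q t where x: "x = mob q t" by (rule P1_point_mob)
  have "spd (mob q) t > 0" by (simp add: spd_mob mob_wt_pos)
  moreover have "spd (mob q) t = spherical_deriv id x * spd (mob q) t"
    using spd_endo[OF P1_endo_id P1hol_mob open_UNIV UNIV_I, of q t] unfolding x id_comp .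
  ultimately show ?thesis by simp
qed

section \<open>Dynamics on the repeller\<close>

context repeller
begin

lemma funpow_in_K: "x \<in> K \<Longrightarrow> (f ^^ n) x \<in> K"
  using funpow_image_fixed[OF image_K] by blast

lemma endo_pow: "P1_endo (f ^^ n)"
  by (rule P1_endo_funpow[OF endo])

lemma sderiv_funpow_pos: "x \<in> K \<Longrightarrow> spherical_deriv (f ^^ n) x > 0"
proof (induction n)
  case 0
  have "f ^^ 0 = id" by (simp add: fun_eq_iff)
  then show ?case by (simp only: sderiv_id zero_less_one)
next
  case (Suc n)
  have "spherical_deriv (f ^^ Suc n) x = spherical_deriv f ((f ^^ n) x) * spherical_deriv (f ^^ n) x"
    unfolding funpow.simps(2) by (rule sderiv_comp[OF endo endo_pow])
  then show ?case using Suc sderiv_pos[OF funpow_in_K[OF Suc.prems]] by (simp only: mult_pos_pos)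
qed

lemma open_funpow_vimage:
  assumes "open U"
  shows "open ((f ^^ n) -` U)"
  using P1_endo_continuous[where S = UNIV and g = "f ^^ n", OF endo_pow] assms
  by (simp add: continuous_on_open_vimage[OF open_UNIV])

text \<open>By isolation it suffices that all iterates of f^m stay in \<open>V\<close>. The first
  ones do so by continuity, being close to the orbit of \<open>x0\<close>; after time
  \<open>L\<close> the orbit lies in \<open>K\<close>.\<close>

lemma backward_invariant:
  assumes x0: "x0 \<in> K"
  obtains W where "open W" "x0 \<in> W" "\<And>x. x \<in> W \<Longrightarrow> (f ^^ L) x \<in> K \<Longrightarrow> x \<in> K"
proof -
  define W where "W = (\<Inter>j\<le>L. (f ^^ (m * j)) -` V)"
  have "open W" unfolding W_def by (intro open_INT ballI open_funpow_vimage V) auto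
  moreover have "x0 \<in> W" unfolding W_def using funpow_in_K[OF x0] V(2) by blast
  moreover have "x \<in> K" if x: "x \<in> W" "(f ^^ L) x \<in> K" for x
  proof (rule isol)
    fix n
    show "(f ^^ (m * n)) x \<in> V"
    proof (cases "n \<le> L")
      case True
      then show ?thesis using x(1) by (simp add: W_def)
    next
      case False
      then have "L \<le> m * n" using m by (metis le_trans mult_le_mono1 nat_le_linear nat_mult_1)
      then have "(f ^^ (m * n)) x = (f ^^ (m * n - L)) ((f ^^ L) x)"
        by (metis comp_apply funpow_add le_add_diff_inverse2)
      then show ?thesis using funpow_in_K[OF x(2)] V(2) by auto
    qed
  qed
  ultimately show ?thesis by (rule that)
qed

text \<open>By mixing, some image of an isolated point would be all of the infinite set
  \<open>K\<close>.\<close>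

lemma perfect:
  assumes "x \<in> K" "open U" "x \<in> U"
  obtains y where "y \<in> U" "y \<in> K" "y \<noteq> x"
proof -
  have "U \<inter> K \<noteq> {x}"
  proof
    assume eq: "U \<inter> K = {x}"
    then obtain n where "(f ^^ n) ` {x} = K" using mixing[OF assms(2)] by auto
    then have "finite K" by (metis finite.emptyI finite.insertI finite_imageI)
    then show False using inf_K by simp
  qed
  then show ?thesis using assms that by blast
qed

text \<open>Mixing provides an orbit that returns close to its start, the closing lemma a periodic
  orbit shadowing it. The shadowing orbit stays close to \<open>K\<close> for all time and lies in
  \<open>K\<close> by isolation.\<close>

lemma ex_periodic_point: "\<exists>x\<in>K. \<exists>n\<ge>1. (f ^^ n) x = x"
proof -
  obtain p where p: "p \<notin> K" using K_ne by blast
  have Kp: "x \<noteq> p" if "x \<in> K" for x using that p by blast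
  define X where "X = mob_inv p ` K"
  have K_sub: "K \<subseteq> - {p}" using p by blast
  have X: "compact X" unfolding X_def
    using continuous_on_subset[OF continuous_on_mob_inv K_sub] compact_K by (rule compact_continuous_image)
  have XK: "mob p z \<in> K" if "z \<in> X" for z
    using that Kp unfolding X_def by auto
  have KX: "mob_inv p x \<in> X" if "x \<in> K" for x using that by (simp add: X_def)
  have Xne: "X \<noteq> {}" using inf_K by (auto simp: X_def)
  have cw: "continuous_on X (mob_wt p)" by (rule continuous_on_mob_wt)
  obtain z1 where z1: "z1 \<in> X" "\<And>z. z \<in> X \<Longrightarrow> mob_wt p z1 \<le> mob_wt p z"
    using continuous_attains_inf[OF X Xne cw] by blast
  obtain z2 where z2: "z2 \<in> X" "\<And>z. z \<in> X \<Longrightarrow> mob_wt p z \<le> mob_wt p z2"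
    using continuous_attains_sup[OF X Xne cw] by blast
  \<comment> \<open>A lower bound for the ratio of the metric densities at two points of
    \<open>X\<close>: the most that is lost when spherical expansion is read in the Euclidean
    chart.\<close>
  define A where "A = mob_wt p z1 / mob_wt p z2"
  have A: "A > 0" by (simp add: A_def mob_wt_pos)
  obtain C \<rho> where C: "C > (0::real)" "\<rho> > (1::real)"
    "\<And>x n. x \<in> K \<Longrightarrow> n \<ge> 1 \<Longrightarrow> spherical_deriv (f ^^ (n * m)) x \<ge> C * \<rho> ^ n"
    using expand by metis
  obtain n0 where "4 / (A * C) < \<rho> ^ n0" using real_arch_pow[OF C(2)] by blast
  then have n0: "4 < A * (C * \<rho> ^ Suc n0)"
  proof -
    assume a: "4 / (A * C) < \<rho> ^ n0"
    have "\<rho> ^ n0 * 1 \<le> \<rho> ^ n0 * \<rho>" using C(2) by (intro mult_left_mono) auto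
    then have "4 / (A * C) < \<rho> ^ Suc n0" using a unfolding power_Suc2 by linarith
    then show ?thesis using A C(1) by (simp add: pos_divide_less_eq mult_ac)
  qed
  \<comment> \<open>A multiple of \<open>m\<close>, since \<open>expand\<close> speaks of such
    iterates, and since the remainders modulo \<open>N\<close> of multiples of \<open>m\<close> are
    then again multiples of \<open>m\<close>.\<close>
  define N where "N = Suc n0 * m"
  have N: "N \<ge> 1" using m by (simp add: N_def)
  define F where "F z = mob_inv p ((f ^^ N) (mob p z))" for z
  define S where "S = {z\<in>UNIV. ((f ^^ N) \<circ> mob p) z \<noteq> p}"
  have ph: "P1hol ((f ^^ N) \<circ> mob p) UNIV" by (rule P1_endoD[OF endo_pow P1hol_mob])
  have S: "open S" "F holomorphic_on S"
    unfolding S_def F_def using P1hol_mob_inv[OF ph open_UNIV, of p] by simp_all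
  have XS: "X \<subseteq> S"
  proof
    fix z assume "z \<in> X"
    then have "(f ^^ N) (mob p z) \<in> K" by (intro funpow_in_K XK)
    then show "z \<in> S" using Kp by (simp add: S_def)
  qed
  have FX: "F ` X \<subseteq> X"
  proof
    fix w assume "w \<in> F ` X"
    then obtain z where "z \<in> X" "w = F z" by blast
    then show "w \<in> X" unfolding F_def by (auto intro!: KX funpow_in_K XK)
  qed
  have mobF: "mob p (F z) = (f ^^ N) (mob p z)" if "z \<in> S" for z
    using that by (simp add: F_def S_def)
  have exp: "4 \<le> cmod (deriv F z)" if z: "z \<in> X" for z
  proof -
    have zS: "((f ^^ N) \<circ> mob p) z \<noteq> p" using z XS by (auto simp: S_def)
    have "spherical_deriv (f ^^ N) (mob p z) * mob_wt p z = cmod (deriv F z) * mob_wt p (F z)"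
      using spd_endo[OF endo_pow P1hol_mob open_UNIV UNIV_I, of N p z] spd_chart[OF ph open_UNIV UNIV_I zS]
      by (simp add: spd_mob F_def[abs_def])
    then have eq: "cmod (deriv F z) = spherical_deriv (f ^^ N) (mob p z) * (mob_wt p z / mob_wt p (F z))"
      using mob_wt_pos[of p "F z"] by (simp add: field_simps)
    have "F z \<in> X" using FX z by blast
    then have "A \<le> mob_wt p z / mob_wt p (F z)"
      unfolding A_def using z1 z2 z mob_wt_pos[of p] by (intro frac_le) (auto simp: less_imp_le)
    moreover have "C * \<rho> ^ Suc n0 \<le> spherical_deriv (f ^^ N) (mob p z)"
      unfolding N_def by (rule C(3)[OF XK[OF z]]) simp
    ultimately have "(C * \<rho> ^ Suc n0) * A \<le> cmod (deriv F z)"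
      unfolding eq using A C by (intro mult_mono) (auto simp: sderiv_nonneg)
    then show ?thesis using n0 by (simp add: mult.commute)
  qed
  obtain r0 where r0: "r0 > 0" "\<And>x. x \<in> X \<Longrightarrow> cball x r0 \<subseteq> S"
    "\<And>x z w. x \<in> X \<Longrightarrow> z \<in> cball x r0 \<Longrightarrow> w \<in> cball x r0 \<Longrightarrow> 3 * dist z w \<le> dist (F z) (F w)"
    using expanding_map_local[OF S X XS exp] by metis
  \<comment> \<open>Shadowing controls only the iterates of \<open>F\<close>, that is, of f^N.
    Points of \<open>Ob\<close> also have the intermediate iterates of f^m in \<open>V\<close>, as
    isolation demands.\<close>
  define Ob where "Ob = (\<Inter>j\<le>N. mob p -` ((f ^^ (m * j)) -` V)) \<inter> S"
  have "open Ob" unfolding Ob_def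
    by (intro open_Int open_INT ballI P1_open_mob_vimage open_funpow_vimage V S) auto
  moreover have "X \<subseteq> Ob" unfolding Ob_def using XS funpow_in_K[OF XK] V(2) by blast
  ultimately obtain r1 where r1: "r1 > 0" "(\<Union>x\<in>X. ball x r1) \<subseteq> Ob"
    using compact_subset_open_imp_ball_epsilon_subset[OF X] by metis
  define r where "r = min r0 r1"
  have r: "r > 0" "r \<le> r0" "r \<le> r1" using r0(1) r1(1) by (auto simp: r_def)
  have near: "z \<in> Ob" if "x \<in> X" "z \<in> ball x r" for x z
  proof -
    have "z \<in> ball x r1" using that(2) r(3) by simp
    then show ?thesis using r1(2) that(1) by blast
  qed
  have Fiter: "(f ^^ (N * i)) (mob p z) = mob p ((F ^^ i) z)" if "\<And>j. j < i \<Longrightarrow> (F ^^ j) z \<in> S" for i z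
    using that
  proof (induction i)
    case (Suc i)
    have "(f ^^ (N * Suc i)) (mob p z) = (f ^^ N) ((f ^^ (N * i)) (mob p z))"
      by (simp add: funpow_add)
    also have "\<dots> = (f ^^ N) (mob p ((F ^^ i) z))" using Suc by simp
    also have "\<dots> = mob p (F ((F ^^ i) z))" using mobF Suc.prems[of i] by simp
    finally show ?case by simp
  qed simp
  have iterX: "(F ^^ i) z \<in> X" if "z \<in> X" for i z
    by (induction i) (use that FX in auto)
  obtain x where x: "x \<in> X" using Xne by blast
  define U where "U = mob p ` ball x (r / 2)"
  have U: "open U" unfolding U_def by (rule open_mob_image) simp
  have "mob p x \<in> U \<inter> K" using x XK r by (simp add: U_def)
  then obtain k0 where k0: "\<And>k. k \<ge> k0 \<Longrightarrow> (f ^^ k) ` (U \<inter> K) = K" using mixing[OF U] by blast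
  define n where "n = Suc k0"
  have "k0 \<le> n" by (simp add: n_def)
  also have "n \<le> N * n" using N by simp
  finally have "(f ^^ (N * n)) ` (U \<inter> K) = K" by (rule k0)
  then obtain Y where Y: "Y \<in> U" "Y \<in> K" "(f ^^ (N * n)) Y = mob p x"
    using XK[OF x] by (metis (no_types, lifting) IntE image_iff)
  then obtain y where y: "y \<in> ball x (r / 2)" "Y = mob p y" by (auto simp: U_def)
  have yX: "y \<in> X" using KX[OF Y(2)] y(2) by simp
  have "mob p ((F ^^ n) y) = mob p x" using Fiter[of n y] iterX[OF yX] XS Y(3) y(2) by auto
  then have Fy: "(F ^^ n) y = x" by simp
  have "dist y ((F ^^ n) y) < r / 2" using y(1) Fy by (simp add: dist_commute)
  have "\<exists>u. (F ^^ n) u = u \<and> (\<forall>i\<le>n. (F ^^ i) u \<in> ball ((F ^^ i) y) r)"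
  proof (rule expanding_map_periodic_point[OF S XS FX r0(1), where r = r and y = y and n = n])
    show "cball x r0 \<subseteq> S" if "x \<in> X" for x by (rule r0(2)[OF that])
    show "3 * dist z w \<le> dist (F z) (F w)" if "x \<in> X" "z \<in> cball x r0" "w \<in> cball x r0" for x z w
      by (rule r0(3)[OF that])
    show "1 \<le> n" by (simp add: n_def)
  qed (fact r(1), fact r(2), fact yX, fact \<open>dist y ((F ^^ n) y) < r / 2\<close>, blast)
  then obtain u where u: "(F ^^ n) u = u" "\<And>i. i \<le> n \<Longrightarrow> (F ^^ i) u \<in> ball ((F ^^ i) y) r"
    by blast
  have uO: "(F ^^ i) u \<in> Ob" for i
  proof -
    have "(F ^^ i) u = (F ^^ (i mod n)) u"
    proof -
      have "(F ^^ (n * k)) u = u" for k by (induction k) (simp_all add: funpow_add u(1))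
      moreover have "(F ^^ i) u = (F ^^ (i mod n)) ((F ^^ (n * (i div n))) u)"
        by (metis comp_apply funpow_add mod_mult_div_eq)
      ultimately show ?thesis by simp
    qed
    moreover have "i mod n \<le> n" by (simp add: n_def less_imp_le)
    ultimately show ?thesis using near[OF iterX[OF yX] u(2)] by metis
  qed
  have uiter: "(f ^^ (N * i)) (mob p u) = mob p ((F ^^ i) u)" for i
    by (rule Fiter) (use uO in \<open>auto simp: Ob_def\<close>)
  have "mob p u \<in> K"
  proof (rule isol)
    fix k
    define i where "i = (m * k) div N"
    define l where "l = (m * k) mod N"
    have "m dvd N" by (simp add: N_def)
    then have "m dvd l" unfolding l_def by (simp add: dvd_mod)
    then obtain j where j: "l = m * j" by blast
    have "l < N" using N by (simp add: l_def)
    moreover have "j \<le> m * j" using m by simp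
    ultimately have jN: "j \<le> N" using j by linarith
    have "m * k = l + N * i" by (simp add: i_def l_def)
    then have "(f ^^ (m * k)) (mob p u) = (f ^^ l) ((f ^^ (N * i)) (mob p u))"
      by (simp add: funpow_add)
    also have "\<dots> = (f ^^ (m * j)) (mob p ((F ^^ i) u))" by (simp add: uiter j)
    also have "\<dots> \<in> V" using uO[of i] jN unfolding Ob_def by blast
    finally show "(f ^^ (m * k)) (mob p u) \<in> V" .
  qed
  moreover have "(f ^^ (N * n)) (mob p u) = mob p u" using uiter[of n] u(1) by simp
  moreover have "N * n \<ge> 1" using N by (simp add: n_def)
  ultimately show ?thesis by blast
qed

text \<open>The local parametrisation \<psi>0 at a repelling periodic point spreads over the plane
  by \<psi> z = g^k (\<psi>0 (z / \<rho>^k)) for \<open>k\<close> large.\<close>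

lemma poincare_function:
  obtains n \<rho> \<psi> r where "n \<ge> 1" "cmod \<rho> > 1" "P1hol \<psi> UNIV" "\<psi> 0 \<in> K" "r > 0" "inj_on \<psi> (ball 0 r)"
    "\<And>z. \<psi> (\<rho> * z) = (f ^^ n) (\<psi> z)"
proof -
  obtain x n where x: "x \<in> K" and n: "n \<ge> 1" "(f ^^ n) x = x"
    using ex_periodic_point by blast
  define g where "g = f ^^ n"
  have g: "P1_endo g" "g x = x" using endo_pow n by (simp_all add: g_def)
  obtain p where p: "p \<noteq> x" using ex_not_in_pair by blast
  define u where "u = mob_inv p x"
  have u: "mob p u = x" using p by (simp add: u_def)
  define S where "S = {z\<in>UNIV. (g \<circ> mob p) z \<noteq> p}"
  define h where "h z = mob_inv p ((g \<circ> mob p) z)" for z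
  have ph: "P1hol (g \<circ> mob p) UNIV" by (rule P1_endoD[OF g(1) P1hol_mob])
  have S: "open S" "h holomorphic_on S"
    unfolding S_def h_def using P1hol_mob_inv[OF ph open_UNIV, of p] by simp_all
  have gu: "(g \<circ> mob p) u \<noteq> p" using p g u by auto
  have uS: "u \<in> S" using gu by (simp add: S_def)
  have hu: "h u = u" using g u by (simp add: h_def u_def)
  define \<rho> where "\<rho> = deriv h u"
  have eqd: "spherical_deriv g x = cmod \<rho>"
  proof -
    have "spherical_deriv g x * mob_wt p u = spd (g \<circ> mob p) u"
      using spd_endo[OF g(1) P1hol_mob open_UNIV UNIV_I, of p u] unfolding u spd_mob by (rule sym)
    also have "\<dots> = cmod (deriv h u) * mob_wt p (h u)"
      using spd_chart[OF ph open_UNIV UNIV_I gu] unfolding h_def[abs_def] .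
    finally have "spherical_deriv g x * mob_wt p u = cmod \<rho> * mob_wt p u"
      unfolding hu \<rho>_def .
    then show ?thesis using mob_wt_pos[of p u] by simp
  qed
  have gpow: "(g ^^ k) x = x" for k by (induction k) (simp_all add: g)
  have sdpow: "spherical_deriv (g ^^ k) x = cmod \<rho> ^ k" for k
  proof (induction k)
    case 0
    have "g ^^ 0 = id" by (simp add: fun_eq_iff)
    then show ?case by (simp only: sderiv_id power_0)
  next
    case (Suc k)
    have "spherical_deriv (g ^^ Suc k) x = spherical_deriv g ((g ^^ k) x) * spherical_deriv (g ^^ k) x"
      unfolding funpow.simps(2) by (rule sderiv_comp[OF g(1) P1_endo_funpow[OF g(1)]])
    then show ?case unfolding gpow eqd Suc power_Suc .
  qed
  \<comment> \<open>\<open>expand\<close> bounds iterates of f^m, whereas \<rho> belongs to g = f^n;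
    the two are compared at exponents divisible by both \<open>m\<close> and
    \<open>n\<close>.\<close>
  have \<rho>: "cmod \<rho> > 1"
  proof (rule ccontr)
    assume "\<not> cmod \<rho> > 1"
    then have le: "cmod \<rho> ^ k \<le> 1" for k by (simp add: power_le_one)
    obtain C c where C: "C > (0::real)" "c > (1::real)"
      "\<And>k. k \<ge> 1 \<Longrightarrow> spherical_deriv (f ^^ (k * m)) x \<ge> C * c ^ k"
      using expand x by metis
    obtain k where "1 / C < c ^ k" using real_arch_pow[OF C(2)] by blast
    also have "c ^ k \<le> c ^ (n * Suc k)"
    proof (rule power_increasing)
      have "1 * Suc k \<le> n * Suc k" using n(1) by (rule mult_le_mono1)
      then show "k \<le> n * Suc k" by simp
    qed (use C(2) in simp)
    finally have "1 < C * c ^ (n * Suc k)" using C(1) by (simp add: pos_divide_less_eq mult.commute)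
    also have "\<dots> \<le> spherical_deriv (f ^^ (n * Suc k * m)) x"
      using n(1) by (intro C(3)) simp
    also have "f ^^ (n * Suc k * m) = g ^^ (Suc k * m)"
      unfolding g_def funpow_mult by (simp only: mult.assoc mult.commute[of n] mult.left_commute)
    also have "spherical_deriv (g ^^ (Suc k * m)) x \<le> 1" unfolding sdpow by (rule le)
    finally show False by simp
  qed
  then have \<rho>0: "\<rho> \<noteq> 0" by auto
  obtain r b where r: "r > 0" and b: "b holomorphic_on ball 0 r" "inj_on b (ball 0 r)" "b 0 = u"
    "b ` ball 0 r \<subseteq> S" "\<And>z. \<rho> * z \<in> ball 0 r \<Longrightarrow> h (b z) = b (\<rho> * z)"
    using repelling_linearization[OF S uS hu \<rho>_def[symmetric] \<rho>] by metis
  define \<psi>0 where "\<psi>0 z = mob p (b z)" for z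
  have \<psi>0_hol: "P1hol \<psi>0 (ball 0 r)" unfolding \<psi>0_def by (rule P1hol_mob_comp[OF b(1)]) simp
  have step: "g (\<psi>0 z) = \<psi>0 (\<rho> * z)" if z: "\<rho> * z \<in> ball 0 r" for z
  proof -
    have "cmod z * 1 \<le> cmod z * cmod \<rho>" using \<rho> by (intro mult_left_mono) auto
    then have "z \<in> ball 0 r" using z by (simp add: norm_mult mult.commute)
    then have "b z \<in> S" using b(4) by blast
    then have "mob p (h (b z)) = g (mob p (b z))" by (simp add: S_def h_def)
    then show ?thesis using b(5)[OF z] by (simp add: \<psi>0_def)
  qed
  have ex_k: "\<exists>k. cmod z < r * cmod \<rho> ^ k" for z
  proof -
    obtain k where "cmod z / r < cmod \<rho> ^ k" using real_arch_pow[OF \<rho>] by blast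
    then show ?thesis using r by (auto simp: pos_divide_less_eq mult.commute)
  qed
  have mono: "cmod z < r * cmod \<rho> ^ l" if "cmod z < r * cmod \<rho> ^ k" "k \<le> l" for z k l
  proof -
    have "cmod \<rho> ^ k \<le> cmod \<rho> ^ l" using \<rho> that(2) by (intro power_increasing) auto
    then have "r * cmod \<rho> ^ k \<le> r * cmod \<rho> ^ l" using r by (intro mult_left_mono) auto
    then show ?thesis using that(1) by linarith
  qed
  have in_ball: "z / \<rho> ^ k \<in> ball 0 r" if "cmod z < r * cmod \<rho> ^ k" for z k
    using that \<rho>0 by (simp add: norm_divide norm_power pos_divide_less_eq)
  \<comment> \<open>The least exponent is only a choice: by \<open>ext\<close> every larger one
    gives the same value.\<close>
  define \<psi> where "\<psi> z = (let k = (LEAST k. cmod z < r * cmod \<rho> ^ k) in (g ^^ k) (\<psi>0 (z / \<rho> ^ k)))" for z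
  have ext: "(g ^^ (k + j)) (\<psi>0 (z / \<rho> ^ (k + j))) = (g ^^ k) (\<psi>0 (z / \<rho> ^ k))"
    if "cmod z < r * cmod \<rho> ^ k" for z k j
  proof (induction j)
    case (Suc j)
    let ?w = "z / \<rho> ^ (k + Suc j)"
    have w: "\<rho> * ?w = z / \<rho> ^ (k + j)" using \<rho>0 by simp
    have "z / \<rho> ^ (k + j) \<in> ball 0 r" by (rule in_ball, rule mono[OF that]) simp
    then have "g (\<psi>0 ?w) = \<psi>0 (z / \<rho> ^ (k + j))" using step[of ?w] unfolding w by simp
    moreover have "(g ^^ (k + Suc j)) (\<psi>0 ?w) = (g ^^ (k + j)) (g (\<psi>0 ?w))"
      by (simp add: funpow_swap1)
    ultimately show ?case using Suc by simp
  qed simp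
  have \<psi>_eq: "\<psi> z = (g ^^ k) (\<psi>0 (z / \<rho> ^ k))" if k: "cmod z < r * cmod \<rho> ^ k" for z k
  proof -
    define l where "l = (LEAST k. cmod z < r * cmod \<rho> ^ k)"
    have l: "cmod z < r * cmod \<rho> ^ l" unfolding l_def using k by (rule LeastI)
    have "l \<le> k" unfolding l_def using k by (rule Least_le)
    then show ?thesis using ext[OF l, of "k - l"] by (simp add: \<psi>_def Let_def l_def[symmetric])
  qed
  have hol: "P1hol \<psi> UNIV"
  proof (rule P1hol_pointwise)
    fix z :: complex
    obtain k where k: "cmod z < r * cmod \<rho> ^ k" using ex_k by blast
    define B where "B = ball (0::complex) (r * cmod \<rho> ^ k)"
    have "P1hol (\<psi>0 \<circ> (\<lambda>w. w / \<rho> ^ k)) B"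
      by (rule P1hol_compose[OF \<psi>0_hol]) (use in_ball \<rho>0 in \<open>auto simp: B_def intro!: holomorphic_intros\<close>)
    then have "P1hol ((g ^^ k) \<circ> (\<psi>0 \<circ> (\<lambda>w. w / \<rho> ^ k))) B"
      by (rule P1_endoD[OF P1_endo_funpow[OF g(1)]])
    then have "P1hol \<psi> B"
      by (rule P1hol_cong) (auto simp: B_def \<psi>_eq)
    then show "P1hol \<psi> {z}" by (rule P1hol_subset) (use k in \<open>simp add: B_def\<close>)
  qed
  have \<psi>b: "\<psi> z = \<psi>0 z" if "z \<in> ball 0 r" for z using \<psi>_eq[of z 0] that by simp
  show ?thesis
  proof (rule that[OF n(1) \<rho> hol _ r])
    show "\<psi> 0 \<in> K" using \<psi>b[of 0] r b(3) u x by (simp add: \<psi>0_def)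
    show "inj_on \<psi> (ball 0 r)"
    proof (rule inj_onI)
      fix v w assume vw: "v \<in> ball 0 r" "w \<in> ball 0 r" "\<psi> v = \<psi> w"
      then have "b v = b w" using \<psi>b[OF vw(1)] \<psi>b[OF vw(2)] by (simp add: \<psi>0_def)
      then show "v = w" using b(2) vw by (auto dest: inj_onD)
    qed
    fix z
    obtain k where k: "cmod z < r * cmod \<rho> ^ k" using ex_k by blast
    have k': "cmod (\<rho> * z) < r * cmod \<rho> ^ Suc k"
    proof -
      have "cmod \<rho> * cmod z < cmod \<rho> * (r * cmod \<rho> ^ k)" using k \<rho> by (intro mult_strict_left_mono) auto
      then show ?thesis by (simp add: norm_mult mult_ac)
    qed
    have "\<psi> (\<rho> * z) = (g ^^ Suc k) (\<psi>0 (\<rho> * z / \<rho> ^ Suc k))" by (rule \<psi>_eq[OF k'])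
    also have "\<rho> * z / \<rho> ^ Suc k = z / \<rho> ^ k" using \<rho>0 by simp
    also have "(g ^^ Suc k) (\<psi>0 (z / \<rho> ^ k)) = g (\<psi> z)" using \<psi>_eq[OF k] by simp
    finally show "\<psi> (\<rho> * z) = (f ^^ n) (\<psi> z)" by (simp add: g_def)
  qed
qed

end

section \<open>Affine return maps\<close>

locale poincare = repeller +
  fixes q :: nat and \<rho> :: complex and \<psi> :: "complex \<Rightarrow> P1" and r :: real
  assumes q: "q \<ge> 1" and \<rho>: "cmod \<rho> > 1" and hol: "P1hol \<psi> UNIV" and base: "\<psi> 0 \<in> K" and r: "r > 0"
    and inj: "inj_on \<psi> (ball 0 r)" and eqn: "\<And>z. \<psi> (\<rho> * z) = (f ^^ q) (\<psi> z)"

lemma P1hol_inj_open_image: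
  assumes "P1hol \<psi> S" "open S" "inj_on \<psi> S"
  shows "open (\<psi> ` S)"
proof -
  have *: "open (\<psi> ` {z\<in>S. \<psi> z \<noteq> p})" for p
  proof -
    note h = P1hol_mob_inv[OF assms(1,2), of p]
    have "inj_on (\<lambda>z. mob_inv p (\<psi> z)) {z\<in>S. \<psi> z \<noteq> p}"
    proof (rule inj_onI)
      fix v w assume vw: "v \<in> {z\<in>S. \<psi> z \<noteq> p}" "w \<in> {z\<in>S. \<psi> z \<noteq> p}" "mob_inv p (\<psi> v) = mob_inv p (\<psi> w)"
      then have "\<psi> v = \<psi> w" using mob_inv_inject[of "\<psi> v" p "\<psi> w"] by simp
      then show "v = w" using assms(3) vw(1,2) by (auto dest: inj_onD)
    qed
    then have "open ((\<lambda>z. mob_inv p (\<psi> z)) ` {z\<in>S. \<psi> z \<noteq> p})"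
      using h by (intro open_mapping_thm3)
    then have "open (mob p ` ((\<lambda>z. mob_inv p (\<psi> z)) ` {z\<in>S. \<psi> z \<noteq> p}))" by (rule open_mob_image)
    also have "mob p ` ((\<lambda>z. mob_inv p (\<psi> z)) ` {z\<in>S. \<psi> z \<noteq> p}) = \<psi> ` {z\<in>S. \<psi> z \<noteq> p}"
      unfolding image_image by (rule image_cong) simp_all
    finally show ?thesis .
  qed
  have "\<psi> ` S = \<psi> ` {z\<in>S. \<psi> z \<noteq> Infty} \<union> \<psi> ` {z\<in>S. \<psi> z \<noteq> Aff 0}"
    unfolding image_Un[symmetric] by (rule arg_cong[where f = "(`) \<psi>"]) auto
  then show ?thesis using *[of Infty] *[of "Aff 0"] by (metis open_Un)
qed

lemma P1hol_inj_spd_pos: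
  assumes "P1hol \<psi> S" "open S" "inj_on \<psi> S" "z \<in> S"
  shows "spd \<psi> z > 0"
proof -
  obtain p where p: "p \<noteq> \<psi> z" using ex_not_in_pair by blast
  define T where "T = {z\<in>S. \<psi> z \<noteq> p}"
  note h = P1hol_mob_inv[OF assms(1,2), of p, folded T_def]
  have zT: "z \<in> T" using p assms(4) by (simp add: T_def)
  have "inj_on (\<lambda>z. mob_inv p (\<psi> z)) T"
  proof (rule inj_onI)
    fix v w assume vw: "v \<in> T" "w \<in> T" "mob_inv p (\<psi> v) = mob_inv p (\<psi> w)"
    then have "\<psi> v = \<psi> w" using mob_inv_inject[of "\<psi> v" p "\<psi> w"] by (simp add: T_def)
    then show "v = w" using assms(3) vw(1,2) by (auto simp: T_def dest: inj_onD)
  qed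
  then have "deriv (\<lambda>z. mob_inv p (\<psi> z)) z \<noteq> 0"
    using holomorphic_injective_imp_regular h zT by blast
  then show ?thesis
    unfolding spd_chart[OF assms(1,2,4) p[symmetric]] by (simp add: mob_wt_pos)
qed

lemma continuous_on_spd:
  assumes "P1hol \<psi> S" "open S"
  shows "continuous_on S (spd \<psi>)"
  unfolding continuous_on_eq_continuous_at[OF assms(2)]
proof
  fix z assume z: "z \<in> S"
  obtain p where p: "p \<noteq> \<psi> z" using ex_not_in_pair by blast
  define T where "T = {z\<in>S. \<psi> z \<noteq> p}"
  note h = P1hol_mob_inv[OF assms, of p, folded T_def]
  have zT: "z \<in> T" using p z by (simp add: T_def)
  have "continuous_on T (\<lambda>w. cmod (deriv (\<lambda>z. mob_inv p (\<psi> z)) w) * mob_wt p (mob_inv p (\<psi> w)))"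
    by (intro continuous_on_mult continuous_on_norm holomorphic_on_imp_continuous_on holomorphic_deriv h
        continuous_on_compose2[OF continuous_on_mob_wt[of UNIV]]) auto
  moreover have "spd \<psi> w = cmod (deriv (\<lambda>z. mob_inv p (\<psi> z)) w) * mob_wt p (mob_inv p (\<psi> w))" if "w \<in> T" for w
    using spd_chart[OF assms, of w p] that by (simp add: T_def)
  ultimately have "continuous_on T (spd \<psi>)" by (subst continuous_on_cong[OF refl]) auto
  then show "isCont (spd \<psi>) z" using zT h(1) by (simp add: continuous_on_eq_continuous_at)
qed

text \<open>\<open>P1_holomorphic_on\<close> knows only the charts missing \<open>Infty\<close> and
  \<open>Aff 0\<close>; at each point one of them can be used.\<close>

lemma P1_holomorphic_on_comp:
  assumes \<phi>: "P1_holomorphic_on \<phi> V" "open V" and \<psi>: "P1hol \<psi> S" "open S"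
  shows "(\<lambda>z. \<phi> (\<psi> z)) holomorphic_on {z\<in>S. \<psi> z \<in> V}"
proof -
  have o: "open {z\<in>S. \<psi> z \<in> V}"
    using continuous_open_preimage[OF P1hol_continuous[OF \<psi>] \<psi>(2) \<phi>(2)] by (simp add: vimage_def Int_def)
  have ex: "\<exists>p. p \<noteq> \<psi> z \<and> (\<phi> \<circ> mob p) holomorphic_on (mob p -` V)" for z
  proof (cases "\<psi> z = Infty")
    case True
    then show ?thesis using \<phi>(1) unfolding P1_holomorphic_on_def
      by (intro exI[of _ "Aff 0"]) (simp add: mob_Aff_0)
  next
    case False
    then show ?thesis using \<phi>(1) unfolding P1_holomorphic_on_def
      by (intro exI[of _ Infty]) (simp add: mob_Infty)
  qed
  show ?thesis
    unfolding holomorphic_on_open[OF o]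
  proof
    fix z assume z: "z \<in> {z\<in>S. \<psi> z \<in> V}"
    obtain p where p: "p \<noteq> \<psi> z" "(\<phi> \<circ> mob p) holomorphic_on (mob p -` V)" using ex by blast
    define T where "T = {z\<in>S. \<psi> z \<noteq> p} \<inter> {z\<in>S. \<psi> z \<in> V}"
    note h = P1hol_mob_inv[OF \<psi>, of p]
    have T: "open T" unfolding T_def by (intro open_Int h o)
    have "(\<phi> \<circ> mob p) \<circ> (\<lambda>z. mob_inv p (\<psi> z)) holomorphic_on T"
      by (rule holomorphic_on_compose_gen[OF holomorphic_on_subset[OF h(2)] p(2)]) (auto simp: T_def)
    then have "(\<lambda>z. \<phi> (\<psi> z)) holomorphic_on T"
      by (rule holomorphic_transform) (simp add: T_def)
    moreover have "z \<in> T" using z p(1) by (simp add: T_def)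
    ultimately show "\<exists>f'. ((\<lambda>z. \<phi> (\<psi> z)) has_field_derivative f') (at z)"
      using T holomorphic_on_open by blast
  qed
qed

text \<open>Differentiating at 0 forces a = \<rho>, so \<Phi>' is unchanged under division by
  \<rho>, and continuity at 0 makes it constant. This links an affine atlas to the Poincare
  coordinate.\<close>

lemma scaling_equivariant_affine:
  fixes \<Phi> :: "complex \<Rightarrow> complex"
  assumes \<rho>: "cmod \<rho> > 1" and \<Phi>: "\<Phi> holomorphic_on ball 0 s" "deriv \<Phi> 0 \<noteq> 0" and e: "e > 0" "e * cmod \<rho> \<le> s"
    and eq: "\<And>z. z \<in> ball 0 e \<Longrightarrow> \<Phi> (\<rho> * z) = a * \<Phi> z + b" and z: "z \<in> ball 0 e"
  shows "deriv \<Phi> z = deriv \<Phi> 0"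
proof -
  have \<rho>0: "\<rho> \<noteq> 0" using \<rho> by auto
  have "e * 1 \<le> e * cmod \<rho>" using \<rho> e by (intro mult_left_mono) auto
  then have es: "e \<le> s" using e by linarith
  have d: "(\<Phi> has_field_derivative deriv \<Phi> w) (at w)" if "w \<in> ball 0 s" for w
    using \<Phi>(1) that holomorphic_derivI by blast
  have rs: "\<rho> * w \<in> ball 0 s" if "w \<in> ball 0 e" for w
  proof -
    have "cmod \<rho> * cmod w < cmod \<rho> * e" using that \<rho> by (intro mult_strict_left_mono) auto
    then show ?thesis using e(2) by (simp add: norm_mult mult.commute)
  qed
  have 1: "\<rho> * deriv \<Phi> (\<rho> * w) = a * deriv \<Phi> w" if w: "w \<in> ball 0 e" for w
  proof -
    have "((\<lambda>t. \<rho> * t) has_field_derivative \<rho>) (at w)" by (auto intro!: derivative_eq_intros)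
    with d[OF rs[OF w]] have "((\<lambda>t. \<Phi> (\<rho> * t)) has_field_derivative deriv \<Phi> (\<rho> * w) * \<rho>) (at w)"
      by (rule DERIV_chain2)
    then have A: "((\<lambda>t. a * \<Phi> t + b) has_field_derivative deriv \<Phi> (\<rho> * w) * \<rho>) (at w)"
      by (rule has_field_derivative_transform_within_open[OF _ open_ball w]) (rule eq)
    have "w \<in> ball 0 s" using w es by simp
    from d[OF this] have "((\<lambda>t. a * \<Phi> t + b) has_field_derivative a * deriv \<Phi> w) (at w)"
      by (auto intro!: derivative_eq_intros)
    with A have "deriv \<Phi> (\<rho> * w) * \<rho> = a * deriv \<Phi> w" by (rule DERIV_unique)
    then show ?thesis by (simp add: mult.commute)
  qed
  have "a = \<rho>" using 1[of 0] e(1) \<Phi>(2) by simp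
  then have 2: "deriv \<Phi> (\<rho> * w) = deriv \<Phi> w" if "w \<in> ball 0 e" for w
    using 1[OF that] \<rho>0 by simp
  have small: "z / \<rho> ^ j \<in> ball 0 e" for j
  proof -
    have "cmod \<rho> ^ j \<ge> 1" using \<rho> by (intro one_le_power) auto
    then have "cmod z / cmod \<rho> ^ j \<le> cmod z / 1" by (intro divide_left_mono) auto
    then show ?thesis using z by (simp add: norm_divide norm_power)
  qed
  have 3: "deriv \<Phi> (z / \<rho> ^ j) = deriv \<Phi> z" for j
  proof (induction j)
    case (Suc j)
    have "\<rho> * (z / \<rho> ^ Suc j) = z / \<rho> ^ j" using \<rho>0 by simp
    then show ?case using 2[OF small[of "Suc j"]] Suc by simp
  qed simp
  have lim: "(\<lambda>j. z / \<rho> ^ j) \<longlonglongrightarrow> 0" by (rule tendsto_divide_power[OF \<rho>])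
  have "isCont (deriv \<Phi>) 0"
    using holomorphic_on_imp_continuous_on[OF holomorphic_deriv[OF \<Phi>(1) open_ball]] e es
    by (simp add: continuous_on_eq_continuous_at)
  from isCont_tendsto_compose[OF this lim] have "(\<lambda>j. deriv \<Phi> z) \<longlonglongrightarrow> deriv \<Phi> 0"
    unfolding 3 .
  then show ?thesis by (simp only: LIMSEQ_const_iff)
qed

section \<open>Return maps to the base point and the atlas form of linearity\<close>

context poincare
begin

lemma \<rho>_nonzero: "\<rho> \<noteq> 0"
  using \<rho> by auto

lemma hol_on: "P1hol \<psi> S"
  using hol by (rule P1hol_subset) simp

lemma open_vimage_\<psi>: "open U \<Longrightarrow> open (\<psi> -` U)"
  using P1hol_continuous[OF hol open_UNIV] by (simp add: continuous_on_open_vimage[OF open_UNIV])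

lemma open_image_\<psi>: "open T \<Longrightarrow> T \<subseteq> ball 0 r \<Longrightarrow> open (\<psi> ` T)"
  using P1hol_inj_open_image[OF hol_on] inj inj_on_subset by blast

lemma spd_\<psi>_pos: "z \<in> ball 0 r \<Longrightarrow> spd \<psi> z > 0"
  by (rule P1hol_inj_spd_pos[OF hol_on open_ball inj])

lemma hol_funpow: "P1hol (\<lambda>z. (f ^^ N) (\<psi> z)) S"
  using P1_endoD[OF endo_pow hol_on] by (simp add: comp_def)

lemma spd_funpow: "spd (\<lambda>z. (f ^^ N) (\<psi> z)) z = spherical_deriv (f ^^ N) (\<psi> z) * spd \<psi> z"
  using spd_endo[OF endo_pow hol open_UNIV UNIV_I, of N z] by (simp add: comp_def)

text \<open>\<theta> inverts the return map, read in the coordinate \<open>z\<close>, from near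
  \<open>y\<close> to near 0; it exists because f^N has no critical points on \<open>K\<close>. The
  set \<open>T\<close> lets later arguments confine the values of \<theta>.\<close>

lemma return_map_inverse:
  assumes y: "y \<in> ball 0 r" "\<psi> y \<in> K" "(f ^^ N) (\<psi> y) = \<psi> 0" and T: "open T" "y \<in> T"
  obtains e \<theta> where "e > 0" "\<theta> holomorphic_on ball 0 e" "\<theta> 0 = y" "\<And>w. w \<in> ball 0 e \<Longrightarrow> deriv \<theta> w \<noteq> 0"
    "\<And>w. w \<in> ball 0 e \<Longrightarrow> \<theta> w \<in> T \<and> (f ^^ N) (\<psi> (\<theta> w)) = \<psi> w"
proof -
  obtain p where p: "p \<noteq> \<psi> 0" using ex_not_in_pair by blast
  define S where "S = {z\<in>T. (f ^^ N) (\<psi> z) \<noteq> p}"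
  define G where "G z = mob_inv p ((f ^^ N) (\<psi> z))" for z
  have S: "open S" "G holomorphic_on S"
    unfolding S_def G_def using P1hol_mob_inv[OF hol_funpow T(1), where p = p] by simp_all
  have yS: "y \<in> S" using T(2) y(3) p by (simp add: S_def)
  have "spd (\<lambda>z. (f ^^ N) (\<psi> z)) y > 0"
    unfolding spd_funpow using sderiv_funpow_pos[OF y(2)] spd_\<psi>_pos[OF y(1)] by simp
  moreover have "spd (\<lambda>z. (f ^^ N) (\<psi> z)) y = cmod (deriv G y) * mob_wt p (G y)"
    using spd_chart[OF hol_funpow T, where p = p] y(3) p by (simp add: G_def[abs_def])
  ultimately have dG: "deriv G y \<noteq> 0" by auto
  obtain s where s: "s > 0" "ball y s \<subseteq> S" "open (G ` ball y s)" "inj_on G (ball y s)"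
    using has_complex_derivative_locally_invertible[OF S(2) yS S(1) dG] by metis
  have GH: "G holomorphic_on ball y s" using S(2) s(2) by (rule holomorphic_on_subset)
  obtain g where g: "g holomorphic_on (G ` ball y s)" "\<And>z. z \<in> ball y s \<Longrightarrow> deriv G z * deriv g (G z) = 1"
    "\<And>z. z \<in> ball y s \<Longrightarrow> g (G z) = z"
    using holomorphic_has_inverse[OF GH open_ball s(4)] by metis
  define S0 where "S0 = {z\<in>ball 0 r. \<psi> z \<noteq> p}"
  define h where "h z = mob_inv p (\<psi> z)" for z
  have S0: "open S0" "h holomorphic_on S0"
    unfolding S0_def h_def by (rule P1hol_mob_inv[OF hol_on open_ball])+
  have z0: "0 \<in> S0" using r p by (simp add: S0_def)
  have hG: "h 0 = G y" using y(3) by (simp add: h_def G_def)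
  define W where "W = S0 \<inter> h -` (G ` ball y s)"
  have W: "open W" unfolding W_def
    by (rule continuous_open_preimage[OF holomorphic_on_imp_continuous_on[OF S0(2)] S0(1) s(3)])
  have "0 \<in> W" using z0 s(1) hG by (auto simp: W_def)
  then obtain e where e: "e > 0" "ball 0 e \<subseteq> W" using W open_contains_ball by blast
  define \<theta> where "\<theta> w = g (h w)" for w
  have hw: "h w \<in> G ` ball y s" "w \<in> S0" if "w \<in> ball 0 e" for w
    using that e(2) by (auto simp: W_def)
  have hS: "h holomorphic_on ball 0 e" using S0(2) by (rule holomorphic_on_subset) (use hw in blast)
  have "g \<circ> h holomorphic_on ball 0 e"
    by (rule holomorphic_on_compose_gen[OF hS g(1)]) (use hw in blast)
  then have \<theta>h: "\<theta> holomorphic_on ball 0 e" by (simp add: \<theta>_def[abs_def] comp_def)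
  have key: "\<theta> w \<in> ball y s \<and> G (\<theta> w) = h w" if w: "w \<in> ball 0 e" for w
  proof -
    obtain v where "v \<in> ball y s" "h w = G v" using hw(1)[OF w] by blast
    then show ?thesis using g(3)[of v] by (simp add: \<theta>_def)
  qed
  have conj: "\<theta> w \<in> T \<and> (f ^^ N) (\<psi> (\<theta> w)) = \<psi> w" if w: "w \<in> ball 0 e" for w
  proof -
    have S': "\<theta> w \<in> S" using key[OF w] s(2) by blast
    have "mob p (G (\<theta> w)) = mob p (h w)" using key[OF w] by simp
    moreover have "mob p (G (\<theta> w)) = (f ^^ N) (\<psi> (\<theta> w))" using S' by (simp add: S_def G_def)
    moreover have "mob p (h w) = \<psi> w" using hw(2)[OF w] by (simp add: S0_def h_def)
    ultimately show ?thesis using S' by (simp add: S_def)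
  qed
  have inj\<theta>: "inj_on \<theta> (ball 0 e)"
  proof (rule inj_onI)
    fix v w assume vw: "v \<in> ball 0 e" "w \<in> ball 0 e" "\<theta> v = \<theta> w"
    then have "\<psi> v = \<psi> w" using conj[OF vw(1)] conj[OF vw(2)] by simp
    then show "v = w" using inj hw(2)[OF vw(1)] hw(2)[OF vw(2)] unfolding S0_def by (auto dest: inj_onD)
  qed
  show ?thesis
  proof (rule that[OF e(1) \<theta>h])
    show "\<theta> 0 = y" unfolding \<theta>_def hG by (rule g(3)) (use s(1) in simp)
    show "deriv \<theta> w \<noteq> 0" if "w \<in> ball 0 e" for w
      by (rule holomorphic_injective_imp_regular[OF \<theta>h open_ball inj\<theta> that])
  qed (rule conj)
qed

text \<open>One \<delta> has to serve all return times \<open>N\<close>. The return through y = 0 is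
  left out: the self-similarity argument relies on y \<noteq> 0, and a return through 0 would only
  give symmetries fixing 0.\<close>

definition affine_returns :: "real \<Rightarrow> bool" where
  "affine_returns \<delta> \<longleftrightarrow> (\<forall>y N. y \<in> ball 0 \<delta> \<longrightarrow> y \<noteq> 0 \<longrightarrow> \<psi> y \<in> K \<longrightarrow> (f ^^ N) (\<psi> y) = \<psi> 0 \<longrightarrow>
     (\<exists>a. a \<noteq> 0 \<and> (\<forall>z. (f ^^ N) (\<psi> z) = \<psi> (a * (z - y)))))"

text \<open>A local inverse return with constant derivative is affine, and the identity theorem
  spreads the resulting relation over the plane; \<open>a\<close> is 1 / \<theta>' 0.\<close>

lemma affine_return_global:
  assumes \<theta>: "e > 0" "\<theta> holomorphic_on ball 0 e" "\<theta> 0 = y" "deriv \<theta> 0 \<noteq> 0"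
    and eq: "\<And>w. w \<in> ball 0 e \<Longrightarrow> (f ^^ N) (\<psi> (\<theta> w)) = \<psi> w"
    and const: "\<And>w. w \<in> ball 0 e \<Longrightarrow> deriv \<theta> w = deriv \<theta> 0"
  shows "\<exists>a. a \<noteq> 0 \<and> (\<forall>z. (f ^^ N) (\<psi> z) = \<psi> (a * (z - y)))"
proof -
  define b where "b = deriv \<theta> 0"
  have b: "b \<noteq> 0" using \<theta>(4) by (simp add: b_def)
  have lin: "\<theta> w = y + b * w" if w: "w \<in> ball 0 e" for w
  proof -
    have "\<exists>c. \<forall>x\<in>ball 0 e. \<theta> x - b * x = c"
    proof (rule has_field_derivative_zero_constant)
      fix x :: complex assume x: "x \<in> ball 0 e"
      have "(\<theta> has_field_derivative deriv \<theta> x) (at x)" using \<theta>(2) x holomorphic_derivI by blast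
      then have "(\<theta> has_field_derivative b) (at x)" using const[OF x] by (simp add: b_def)
      then have "((\<lambda>x. \<theta> x - b * x) has_field_derivative 0) (at x)"
        by (auto intro!: derivative_eq_intros)
      then show "((\<lambda>x. \<theta> x - b * x) has_field_derivative 0) (at x within ball 0 e)"
        by (rule has_field_derivative_at_within)
    qed simp
    then obtain c where c: "\<And>x. x \<in> ball 0 e \<Longrightarrow> \<theta> x - b * x = c" by blast
    have "c = y" using c[of 0] \<theta>(1,3) by simp
    then show ?thesis using c[OF w] by (simp add: algebra_simps)
  qed
  have "P1hol ((\<lambda>z. (f ^^ N) (\<psi> z)) \<circ> (\<lambda>w. y + b * w)) UNIV"
    by (rule P1hol_compose[OF hol_funpow[of N UNIV]]) (auto intro!: holomorphic_intros)
  then have "(\<lambda>z. (f ^^ N) (\<psi> z)) \<circ> (\<lambda>w. y + b * w) = \<psi>"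
    using hol \<theta>(1) by (rule P1hol_identity_open[where \<xi> = 0]) (use eq lin in \<open>simp\<close>)
  then have g: "(f ^^ N) (\<psi> (y + b * w)) = \<psi> w" for w by (metis comp_apply)
  show ?thesis
  proof (intro exI[of _ "1 / b"] conjI allI)
    fix z
    have "y + b * (1 / b * (z - y)) = z" using b by simp
    then show "(f ^^ N) (\<psi> z) = \<psi> (1 / b * (z - y))" using g[of "1 / b * (z - y)"] by simp
  qed (use b in simp)
qed

text \<open>Return maps are affine in a chart of the atlas around the base point, and by
  \<open>scaling_equivariant_affine\<close> that chart is affine in the Poincare coordinate.\<close>

lemma affine_returns_atlas:
  assumes "has_affine_atlas f K"
  obtains \<delta> where "\<delta> > 0" "\<delta> \<le> r" "affine_returns \<delta>"
proof -
  from assms obtain k :: nat and V \<phi> where A: "\<forall>i<k. open (V i) \<and> P1_holomorphic_on (\<phi> i) (V i) \<and> inj_on (\<phi> i) (V i)"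
    "K \<subseteq> (\<Union>i<k. V i)" "\<forall>i<k. \<forall>j<k. \<exists>a b. \<forall>x \<in> V j \<inter> V i. \<phi> i x = a * \<phi> j x + b"
    "\<forall>i<k. \<forall>j<k. \<exists>a b. \<forall>x \<in> V j \<inter> f -` V i. \<phi> i (f x) = a * \<phi> j x + b"
    unfolding has_affine_atlas_def by (elim exE conjE) (rule that)
  \<comment> \<open>Affine transitions are composed along the orbit of \<open>x\<close>, choosing a
    chart at each iterate. The neighbourhood shrinks with \<open>N\<close>, which is harmless since
    only the germ at \<open>x\<close> matters.\<close>
  have chain: "\<exists>a b W. open W \<and> x \<in> W \<and> (\<forall>w\<in>W. \<phi> i ((f ^^ N) w) = a * \<phi> j w + b)"
    if "x \<in> K" "i < k" "j < k" "x \<in> V j" "(f ^^ N) x \<in> V i" for x i j N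
    using that(2,5)
  proof (induction N arbitrary: i)
    case 0
    from A(3) 0 that(3) obtain a b where "\<forall>w\<in>V j \<inter> V i. \<phi> i w = a * \<phi> j w + b" by blast
    moreover have "open (V j \<inter> V i)" using A(1) 0 that(3) by blast
    ultimately show ?case using 0 that(4) by (intro exI[of _ a] exI[of _ b] exI[of _ "V j \<inter> V i"]) simp
  next
    case (Suc N)
    have "(f ^^ N) x \<in> K" by (rule funpow_in_K[OF that(1)])
    then obtain l where l: "l < k" "(f ^^ N) x \<in> V l" using A(2) by blast
    from Suc.IH[OF l] obtain a b W where W: "open W" "x \<in> W" "\<forall>w\<in>W. \<phi> l ((f ^^ N) w) = a * \<phi> j w + b" by blast
    from A(4) Suc.prems(1) l(1) obtain a' b' where ab: "\<forall>w\<in>V l \<inter> f -` V i. \<phi> i (f w) = a' * \<phi> l w + b'" by blast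
    let ?W = "W \<inter> (f ^^ N) -` V l \<inter> (f ^^ Suc N) -` V i"
    have oV: "open (V l)" "open (V i)" using A(1) l(1) Suc.prems(1) by blast+
    have "open ?W" using W(1) open_funpow_vimage[OF oV(1)] open_funpow_vimage[OF oV(2)] by blast
    moreover have "x \<in> ?W" using W(2) l(2) Suc.prems(2) by simp
    moreover have "\<forall>w\<in>?W. \<phi> i ((f ^^ Suc N) w) = (a' * a) * \<phi> j w + (a' * b + b')"
    proof
      fix w assume w: "w \<in> ?W"
      then have "\<phi> i ((f ^^ Suc N) w) = a' * \<phi> l ((f ^^ N) w) + b'" using ab by simp
      also have "\<phi> l ((f ^^ N) w) = a * \<phi> j w + b" using W(3) w by simp
      finally show "\<phi> i ((f ^^ Suc N) w) = (a' * a) * \<phi> j w + (a' * b + b')" by (simp add: algebra_simps)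
    qed
    ultimately show ?case by blast
  qed
  obtain i where i: "i < k" "\<psi> 0 \<in> V i" using A(2) base by blast
  have Vi: "open (V i)" "P1_holomorphic_on (\<phi> i) (V i)" "inj_on (\<phi> i) (V i)" using A(1) i(1) by blast+
  define \<Phi> where "\<Phi> z = \<phi> i (\<psi> z)" for z
  have "open (\<psi> -` V i \<inter> ball 0 r)" using open_vimage_\<psi>[OF Vi(1)] by (intro open_Int) simp_all
  moreover have "0 \<in> \<psi> -` V i \<inter> ball 0 r" using i r by simp
  ultimately obtain s where s: "s > 0" "ball 0 s \<subseteq> \<psi> -` V i \<inter> ball 0 r" using open_contains_ball by blast
  have \<Phi>h: "\<Phi> holomorphic_on ball 0 s"
  proof (rule holomorphic_on_subset)
    show "\<Phi> holomorphic_on {z\<in>UNIV. \<psi> z \<in> V i}"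
      unfolding \<Phi>_def by (rule P1_holomorphic_on_comp[OF Vi(2,1) hol open_UNIV])
  qed (use s(2) in auto)
  have "inj_on \<Phi> (ball 0 s)"
  proof (rule inj_onI)
    fix v w assume vw: "v \<in> ball 0 s" "w \<in> ball 0 s" "\<Phi> v = \<Phi> w"
    then have "\<psi> v = \<psi> w" unfolding \<Phi>_def using Vi(3) s(2) by (meson IntD1 inj_onD subsetD vimageD)
    then show "v = w" using inj vw s(2) by (meson IntD2 inj_onD subsetD)
  qed
  then have d\<Phi>: "deriv \<Phi> 0 \<noteq> 0" using holomorphic_injective_imp_regular[OF \<Phi>h open_ball, of 0] s(1) by simp
  have "(f ^^ q) (\<psi> 0) = \<psi> 0" using eqn[of 0] by simp
  then obtain a b W where W: "open W" "\<psi> 0 \<in> W" "\<forall>w\<in>W. \<phi> i ((f ^^ q) w) = a * \<phi> i w + b"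
    using chain[OF base i(1) i(1) i(2), of q] i(2) by auto
  have "open (\<psi> -` W)" by (rule open_vimage_\<psi>[OF W(1)])
  then obtain e1 where e1: "e1 > 0" "ball 0 e1 \<subseteq> \<psi> -` W" using W(2) open_contains_ball by blast
  \<comment> \<open>The quotient keeps \<rho> * z in the disc on which \<Phi> is known to be
    holomorphic.\<close>
  define \<delta> where "\<delta> = min e1 (s / cmod \<rho>)"
  have \<delta>: "\<delta> > 0" "\<delta> \<le> e1" "\<delta> * cmod \<rho> \<le> s"
  proof -
    have \<rho>p: "cmod \<rho> > 0" using \<rho> by linarith
    show "\<delta> > 0" "\<delta> \<le> e1" using e1 s(1) \<rho>p by (auto simp: \<delta>_def)
    have "\<delta> \<le> s / cmod \<rho>" by (simp add: \<delta>_def)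
    then show "\<delta> * cmod \<rho> \<le> s" using \<rho>p by (simp add: pos_le_divide_eq)
  qed
  have \<delta>s: "\<delta> \<le> s"
  proof -
    have "\<delta> * 1 \<le> \<delta> * cmod \<rho>" using \<delta>(1) \<rho> by (intro mult_left_mono) auto
    then show ?thesis using \<delta>(3) by linarith
  qed
  have sub\<delta>: "ball (0::complex) \<delta> \<subseteq> ball 0 s" using \<delta>s by auto
  have const: "deriv \<Phi> z = deriv \<Phi> 0" if z: "z \<in> ball 0 \<delta>" for z
  proof (rule scaling_equivariant_affine[OF \<rho> \<Phi>h d\<Phi> \<delta>(1,3) _ z])
    fix z :: complex assume "z \<in> ball 0 \<delta>"
    then have "z \<in> ball 0 e1" using \<delta>(2) by simp
    then have "\<psi> z \<in> W" using e1(2) by blast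
    then show "\<Phi> (\<rho> * z) = a * \<Phi> z + b" using W(3) by (simp add: \<Phi>_def eqn)
  qed
  show ?thesis
  proof (rule that[OF \<delta>(1)])
    show "\<delta> \<le> r"
    proof -
      have "s \<le> r" using s by (auto simp: ball_subset_ball_iff)
      then show ?thesis using \<delta>s by linarith
    qed
    show "affine_returns \<delta>" unfolding affine_returns_def
    proof (intro allI impI)
      fix y N assume y: "y \<in> ball 0 \<delta>" "y \<noteq> 0" "\<psi> y \<in> K" "(f ^^ N) (\<psi> y) = \<psi> 0"
      have yV: "\<psi> y \<in> V i" "y \<in> ball 0 r" using y(1) sub\<delta> s(2) by blast+
      have "(f ^^ N) (\<psi> y) \<in> V i" using y(4) i(2) by simp
      then obtain a b W where W: "open W" "\<psi> y \<in> W" "\<forall>w\<in>W. \<phi> i ((f ^^ N) w) = a * \<phi> i w + b"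
        using chain[OF y(3) i(1) i(1) yV(1)] by blast
      define T where "T = \<psi> -` W \<inter> ball 0 \<delta>"
      have T: "open T" "y \<in> T" using open_vimage_\<psi>[OF W(1)] W(2) y(1) by (auto simp: T_def)
      obtain e \<theta> where \<theta>: "e > 0" "\<theta> holomorphic_on ball 0 e" "\<theta> 0 = y" "\<And>w. w \<in> ball 0 e \<Longrightarrow> deriv \<theta> w \<noteq> 0"
        "\<And>w. w \<in> ball 0 e \<Longrightarrow> \<theta> w \<in> T \<and> (f ^^ N) (\<psi> (\<theta> w)) = \<psi> w"
        using return_map_inverse[OF yV(2) y(3,4) T] by metis
      define e' where "e' = min e \<delta>"
      have e': "e' > 0" "ball (0::complex) e' \<subseteq> ball 0 e" "ball (0::complex) e' \<subseteq> ball 0 \<delta>"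
        using \<theta>(1) \<delta>(1) by (auto simp: e'_def)
      have \<theta>h': "\<theta> holomorphic_on ball 0 e'" using \<theta>(2) e'(2) by (rule holomorphic_on_subset)
      have der: "a * deriv \<theta> w = 1" if w: "w \<in> ball 0 e'" for w
      proof -
        have w1: "w \<in> ball 0 e" "w \<in> ball 0 \<delta>" using w e' by blast+
        have \<theta>T: "\<theta> w \<in> ball 0 \<delta>" using \<theta>(5)[OF w1(1)] by (simp add: T_def)
        have d: "(\<theta> has_field_derivative deriv \<theta> w) (at w)" using \<theta>h' w holomorphic_derivI by blast
        have d1: "(\<Phi> has_field_derivative deriv \<Phi> (\<theta> w)) (at (\<theta> w))"
          using \<Phi>h \<theta>T sub\<delta> holomorphic_derivI open_ball by blast
        have d2: "(\<Phi> has_field_derivative deriv \<Phi> w) (at w)"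
          using \<Phi>h w1(2) sub\<delta> holomorphic_derivI open_ball by blast
        from DERIV_chain2[OF d1 d] have "((\<lambda>w. \<Phi> (\<theta> w)) has_field_derivative deriv \<Phi> 0 * deriv \<theta> w) (at w)"
          unfolding const[OF \<theta>T] .
        then have A1: "((\<lambda>w. a * \<Phi> (\<theta> w) + b) has_field_derivative a * (deriv \<Phi> 0 * deriv \<theta> w)) (at w)"
          by (auto intro!: derivative_eq_intros)
        have "((\<lambda>w. a * \<Phi> (\<theta> w) + b) has_field_derivative deriv \<Phi> w) (at w)"
        proof (rule has_field_derivative_transform_within_open[OF d2 open_ball w])
          fix t :: complex assume "t \<in> ball 0 e'"
          then have "t \<in> ball 0 e" using e'(2) by blast
          from \<theta>(5)[OF this] have "\<psi> (\<theta> t) \<in> W" "(f ^^ N) (\<psi> (\<theta> t)) = \<psi> t" by (auto simp: T_def)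
          then have "\<phi> i (\<psi> t) = a * \<phi> i (\<psi> (\<theta> t)) + b" using W(3) by metis
          then show "\<Phi> t = a * \<Phi> (\<theta> t) + b" by (simp add: \<Phi>_def)
        qed
        with A1 have "a * (deriv \<Phi> 0 * deriv \<theta> w) = deriv \<Phi> w" by (rule DERIV_unique)
        then have "deriv \<Phi> 0 * (a * deriv \<theta> w) = deriv \<Phi> 0 * 1" unfolding const[OF w1(2)] by simp
        then show ?thesis using d\<Phi> by simp
      qed
      show "\<exists>a. a \<noteq> 0 \<and> (\<forall>z. (f ^^ N) (\<psi> z) = \<psi> (a * (z - y)))"
      proof (rule affine_return_global[OF e'(1) \<theta>h' \<theta>(3)])
        show "deriv \<theta> 0 \<noteq> 0" using \<theta>(1,4) by simp
        show "(f ^^ N) (\<psi> (\<theta> w)) = \<psi> w" if "w \<in> ball 0 e'" for w using \<theta>(5) e'(2) that by blast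
        show "deriv \<theta> w = deriv \<theta> 0" if w: "w \<in> ball 0 e'" for w
        proof -
          have "a * deriv \<theta> w = a * deriv \<theta> 0" using der[OF w] der[of 0] e'(1) by simp
          moreover have "a \<noteq> 0" using der[OF w] by auto
          ultimately show ?thesis by simp
        qed
      qed
    qed
  qed
qed

end

section \<open>The cohomological form of linearity\<close>

context repeller
begin

text \<open>The chain rule turns log |d(f^N)| into a Birkhoff sum along which the terms in
  \<open>u\<close> telescope; what remains is a finite sum of locally constant functions.\<close>

lemma birkhoff_sum_locally_constant:
  assumes u: "continuous_on K u" and lc: "locally_constant_on K (\<lambda>x. ln (spherical_deriv f x) - (u (f x) - u x))"
    and x: "x \<in> K"
  shows "\<exists>W. open W \<and> x \<in> W \<and> (\<forall>y\<in>W \<inter> K. ln (spherical_deriv (f ^^ N) y) - (u ((f ^^ N) y) - u y) =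
    ln (spherical_deriv (f ^^ N) x) - (u ((f ^^ N) x) - u x))"
proof (induction N)
  case 0
  have "f ^^ 0 = id" by (simp add: fun_eq_iff)
  then show ?case by (intro exI[of _ UNIV]) (simp only: sderiv_id, simp)
next
  case (Suc N)
  from Suc.IH obtain W where W: "open W" "x \<in> W" "\<forall>y\<in>W \<inter> K. ln (spherical_deriv (f ^^ N) y) - (u ((f ^^ N) y) - u y) =
    ln (spherical_deriv (f ^^ N) x) - (u ((f ^^ N) x) - u x)" by blast
  have xN: "(f ^^ N) x \<in> K" by (rule funpow_in_K[OF x])
  obtain U where U: "openin (top_of_set K) U" "(f ^^ N) x \<in> U"
    "\<forall>y\<in>U. ln (spherical_deriv f y) - (u (f y) - u y) =
      ln (spherical_deriv f ((f ^^ N) x)) - (u (f ((f ^^ N) x)) - u ((f ^^ N) x))"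
    using lc xN unfolding locally_constant_on_def by blast
  obtain U' where U': "open U'" "U = K \<inter> U'" using U(1) openin_open by blast
  let ?W = "W \<inter> (f ^^ N) -` U'"
  have split: "ln (spherical_deriv (f ^^ Suc N) y) = ln (spherical_deriv f ((f ^^ N) y)) + ln (spherical_deriv (f ^^ N) y)"
    if y: "y \<in> K" for y
  proof -
    have "spherical_deriv (f ^^ Suc N) y = spherical_deriv f ((f ^^ N) y) * spherical_deriv (f ^^ N) y"
      unfolding funpow.simps(2) by (rule sderiv_comp[OF endo endo_pow])
    then show ?thesis
      using sderiv_pos[OF funpow_in_K[OF y, of N]] sderiv_funpow_pos[OF y, of N] by (simp only: ln_mult_pos)
  qed
  show ?case
  proof (intro exI[of _ ?W] conjI ballI)
    show "open ?W" using W(1) open_funpow_vimage[OF U'(1)] by (rule open_Int)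
    show "x \<in> ?W" using W(2) U(2) U'(2) by simp
    fix y assume y: "y \<in> ?W \<inter> K"
    then have "(f ^^ N) y \<in> U" using U'(2) funpow_in_K[of y N] by simp
    then have 1: "ln (spherical_deriv f ((f ^^ N) y)) - (u (f ((f ^^ N) y)) - u ((f ^^ N) y)) =
      ln (spherical_deriv f ((f ^^ N) x)) - (u (f ((f ^^ N) x)) - u ((f ^^ N) x))" using U(3) by blast
    have 2: "ln (spherical_deriv (f ^^ N) y) - (u ((f ^^ N) y) - u y) =
      ln (spherical_deriv (f ^^ N) x) - (u ((f ^^ N) x) - u x)" using W(3) y by blast
    have yK: "y \<in> K" using y by simp
    have s: "(f ^^ Suc N) w = f ((f ^^ N) w)" for w by simp
    show "ln (spherical_deriv (f ^^ Suc N) y) - (u ((f ^^ Suc N) y) - u y) =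
        ln (spherical_deriv (f ^^ Suc N) x) - (u ((f ^^ Suc N) x) - u x)"
      unfolding split[OF yK] split[OF x] s using 1 2 by linarith
  qed
qed

end

context poincare
begin

text \<open>The trace of \<open>K\<close> in the linearising coordinate. Near 0 it is stable under
  division by \<rho>, so it is the set to which the lemmas on self-similar sets apply.\<close>

definition E :: "complex set" where
  "E = {z\<in>ball 0 r. \<psi> z \<in> K}"

lemma E_backward: obtains d where "d > 0" "d \<le> r" "\<And>z. z \<in> E \<Longrightarrow> cmod z < d \<Longrightarrow> z / \<rho> \<in> E"
proof -
  obtain W where W: "open W" "\<psi> 0 \<in> W" "\<And>x. x \<in> W \<Longrightarrow> (f ^^ q) x \<in> K \<Longrightarrow> x \<in> K"
    using backward_invariant[OF base] by metis
  obtain d0 where d0: "d0 > 0" "ball 0 d0 \<subseteq> \<psi> -` W"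
    using open_vimage_\<psi>[OF W(1)] W(2) open_contains_ball by blast
  define d where "d = min d0 r"
  have d: "d > 0" "d \<le> d0" "d \<le> r" using d0(1) r by (auto simp: d_def)
  show ?thesis
  proof (rule that[OF d(1,3)])
    fix z assume z: "z \<in> E" "cmod z < d"
    have "cmod z / cmod \<rho> \<le> cmod z / 1" using \<rho> by (intro divide_left_mono) auto
    then have lt: "cmod (z / \<rho>) < d" using z(2) by (simp add: norm_divide)
    then have "z / \<rho> \<in> ball 0 d0" using d by simp
    then have "\<psi> (z / \<rho>) \<in> W" using d0(2) by blast
    moreover have "(f ^^ q) (\<psi> (z / \<rho>)) \<in> K"
      using eqn[of "z / \<rho>"] z(1) \<rho>_nonzero by (simp add: E_def)
    ultimately have "\<psi> (z / \<rho>) \<in> K" by (rule W(3))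
    then show "z / \<rho> \<in> E" using lt d by (simp add: E_def)
  qed
qed

lemma E_islimpt: "0 islimpt E"
proof (rule islimptI)
  fix T :: "complex set" assume T: "0 \<in> T" "open T"
  let ?T = "T \<inter> ball 0 r"
  have "open (\<psi> ` ?T)" using T by (intro open_image_\<psi> open_Int) auto
  moreover have "\<psi> 0 \<in> \<psi> ` ?T" using T r by (intro imageI) simp
  ultimately obtain x where x: "x \<in> \<psi> ` ?T" "x \<in> K" "x \<noteq> \<psi> 0" using perfect[OF base] by metis
  then obtain z where z: "z \<in> T" "z \<in> ball 0 r" "x = \<psi> z" by blast
  then show "\<exists>y\<in>E. y \<in> T \<and> y \<noteq> 0" using x by (intro bexI[of _ z]) (auto simp: E_def)
qed

text \<open>The function \<open>v\<close>, the log speed of \<psi> corrected by \<open>u\<close>,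
  turns out to be unchanged under division by \<rho> and hence constant on \<open>E\<close> near 0.
  So an inverse return has |\<theta>'| constant on \<open>E\<close>, and
  \<open>self_similar_constant_modulus\<close> removes the modulus.\<close>

lemma affine_returns_cohomologous:
  assumes "log_deriv_cohomologous_locally_constant f K"
  obtains \<delta> where "\<delta> > 0" "\<delta> \<le> r" "affine_returns \<delta>"
proof -
  obtain u where u: "continuous_on K u"
    and lc: "locally_constant_on K (\<lambda>x. ln (spherical_deriv f x) - (u (f x) - u x))"
    using assms unfolding log_deriv_cohomologous_locally_constant_def by blast
  define c where "c N x = ln (spherical_deriv (f ^^ N) x) - (u ((f ^^ N) x) - u x)" for N x
  have c_loc: "\<exists>W. open W \<and> x \<in> W \<and> (\<forall>y\<in>W \<inter> K. c N y = c N x)" if "x \<in> K" for N x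
    unfolding c_def by (rule birkhoff_sum_locally_constant[OF u lc that])
  define v where "v z = ln (spd \<psi> z) - u (\<psi> z)" for z
  obtain d1 where d1: "d1 > 0" "d1 \<le> r" "\<And>z. z \<in> E \<Longrightarrow> cmod z < d1 \<Longrightarrow> z / \<rho> \<in> E"
    using E_backward by metis
  have zE: "0 \<in> E" using r base by (simp add: E_def)
  obtain W where W: "open W" "\<psi> 0 \<in> W" "\<forall>y\<in>W \<inter> K. c q y = c q (\<psi> 0)" using c_loc[OF base] by blast
  obtain d0 where d0: "d0 > 0" "ball 0 d0 \<subseteq> \<psi> -` W"
    using open_vimage_\<psi>[OF W(1)] W(2) open_contains_ball by blast
  define d where "d = min d0 d1"
  have d: "d > 0" "d \<le> d0" "d \<le> d1" using d0(1) d1(1) by (auto simp: d_def)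
  have shrink: "cmod (z / \<rho>) \<le> cmod z" for z
  proof -
    have "cmod z / cmod \<rho> \<le> cmod z / 1" using \<rho> by (intro divide_left_mono) auto
    then show ?thesis by (simp add: norm_divide)
  qed
  have step: "v z + ln (cmod \<rho>) = c q (\<psi> 0) + v (z / \<rho>)" if z: "z \<in> E" "cmod z < d" for z
  proof -
    let ?w = "z / \<rho>"
    have wE: "?w \<in> E" using d1(3)[OF z(1)] z(2) d(3) by simp
    have "?w \<in> ball 0 d0" using shrink[of z] z(2) d(2) by simp
    then have "\<psi> ?w \<in> W \<inter> K" using d0(2) wE by (auto simp: E_def)
    then have cq: "c q (\<psi> ?w) = c q (\<psi> 0)" using W(3) by blast
    have zz: "\<rho> * ?w = z" using \<rho>_nonzero by simp
    have "spd (\<psi> \<circ> (\<lambda>t. \<rho> * t)) ?w = cmod (deriv (\<lambda>t. \<rho> * t) ?w) * spd \<psi> (\<rho> * ?w)"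
      by (rule spd_compose[OF hol_on _ open_UNIV UNIV_I]) (intro holomorphic_intros)
    moreover have "\<psi> \<circ> (\<lambda>t. \<rho> * t) = (\<lambda>t. (f ^^ q) (\<psi> t))" using eqn by (simp add: comp_def)
    moreover have "deriv (\<lambda>t. \<rho> * t) ?w = \<rho>" by (rule DERIV_imp_deriv) (auto intro!: derivative_eq_intros)
    ultimately have "spherical_deriv (f ^^ q) (\<psi> ?w) * spd \<psi> ?w = cmod \<rho> * spd \<psi> z"
      using spd_funpow[of q ?w] zz by simp
    then have "ln (spherical_deriv (f ^^ q) (\<psi> ?w) * spd \<psi> ?w) = ln (cmod \<rho> * spd \<psi> z)" by simp
    moreover have "ln (spherical_deriv (f ^^ q) (\<psi> ?w) * spd \<psi> ?w) = ln (spherical_deriv (f ^^ q) (\<psi> ?w)) + ln (spd \<psi> ?w)"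
      using sderiv_funpow_pos[of "\<psi> ?w" q] spd_\<psi>_pos[of ?w] wE by (intro ln_mult_pos) (auto simp: E_def)
    moreover have "ln (cmod \<rho> * spd \<psi> z) = ln (cmod \<rho>) + ln (spd \<psi> z)"
      using \<rho> spd_\<psi>_pos[of z] z(1) by (intro ln_mult_pos) (auto simp: E_def)
    moreover have "(f ^^ q) (\<psi> ?w) = \<psi> z" using eqn[of ?w] zz by simp
    ultimately show ?thesis using cq by (simp add: c_def v_def)
  qed
  \<comment> \<open>At z = 0 the points z and z / \<rho> coincide, so the constant by which
    \<open>v\<close> changes is 0.\<close>
  have "ln (cmod \<rho>) = c q (\<psi> 0)" using step[OF zE] d(1) by simp
  then have step': "v (z / \<rho>) = v z" if "z \<in> E" "cmod z < d" for z using step[OF that] by simp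
  have iter: "z / \<rho> ^ j \<in> E \<and> cmod (z / \<rho> ^ j) < d \<and> v (z / \<rho> ^ j) = v z" if z: "z \<in> E" "cmod z < d" for z j
  proof (induction j)
    case (Suc j)
    let ?w = "z / \<rho> ^ j"
    have eq: "z / \<rho> ^ Suc j = ?w / \<rho>" by simp
    have w: "?w \<in> E" "cmod ?w < d" "v ?w = v z" using Suc by blast+
    have "cmod ?w < d1" using w(2) d(3) by linarith
    then have "?w / \<rho> \<in> E" by (rule d1(3)[OF w(1)])
    moreover have "cmod (?w / \<rho>) < d" using shrink[of ?w] w(2) by linarith
    moreover have "v (?w / \<rho>) = v z" using step'[OF w(1,2)] w(3) by (rule trans)
    ultimately show ?case unfolding eq by blast
  qed (use z in simp)
  have contv: "continuous_on E v"
  proof -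
    have s: "continuous_on E (spd \<psi>)"
      using continuous_on_spd[OF hol open_UNIV] by (rule continuous_on_subset) simp
    have "continuous_on E (\<lambda>z. u (\<psi> z))"
      by (rule continuous_on_compose2[OF u continuous_on_subset[OF P1hol_continuous[OF hol open_UNIV]]])
        (auto simp: E_def)
    moreover have "spd \<psi> z \<noteq> 0" if "z \<in> E" for z using spd_\<psi>_pos[of z] that by (auto simp: E_def)
    ultimately show ?thesis unfolding v_def by (intro continuous_intros s) auto
  qed
  have vconst: "v z = v 0" if z: "z \<in> E" "cmod z < d" for z
  proof -
    have lim: "(\<lambda>j. z / \<rho> ^ j) \<longlonglongrightarrow> 0" by (rule tendsto_divide_power[OF \<rho>])
    have "(\<lambda>j. v (z / \<rho> ^ j)) \<longlonglongrightarrow> v 0"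
      by (rule continuous_on_tendsto_compose[OF contv lim zE]) (use iter[OF z] in simp)
    then have "(\<lambda>j::nat. v z) \<longlonglongrightarrow> v 0" using iter[OF z] by simp
    then show ?thesis by (simp only: LIMSEQ_const_iff)
  qed
  have inv: "z / \<rho> \<in> E" if "z \<in> E" "cmod z < d" for z using d1(3)[OF that(1)] that(2) d(3) by simp
  show ?thesis
  proof (rule that[OF d(1)])
    show "d \<le> r" using d d1 by linarith
    show "affine_returns d" unfolding affine_returns_def
    proof (intro allI impI)
      fix y N assume y: "y \<in> ball 0 d" "y \<noteq> 0" "\<psi> y \<in> K" "(f ^^ N) (\<psi> y) = \<psi> 0"
      have yr: "y \<in> ball 0 r" using y(1) \<open>d \<le> r\<close> by simp
      obtain W where W: "open W" "\<psi> y \<in> W" "\<forall>x\<in>W \<inter> K. c N x = c N (\<psi> y)" using c_loc[OF y(3)] by blast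
      obtain B where B: "open B" "\<psi> y \<in> B" "\<And>x. x \<in> B \<Longrightarrow> (f ^^ N) x \<in> K \<Longrightarrow> x \<in> K"
        using backward_invariant[OF y(3)] by metis
      define T where "T = \<psi> -` (W \<inter> B) \<inter> ball 0 d"
      have T: "open T" "y \<in> T"
        using open_vimage_\<psi>[OF open_Int[OF W(1) B(1)]] W(2) B(2) y(1) by (auto simp: T_def)
      obtain e0 \<theta> where \<theta>: "e0 > 0" "\<theta> holomorphic_on ball 0 e0" "\<theta> 0 = y" "\<And>w. w \<in> ball 0 e0 \<Longrightarrow> deriv \<theta> w \<noteq> 0"
        "\<And>w. w \<in> ball 0 e0 \<Longrightarrow> \<theta> w \<in> T \<and> (f ^^ N) (\<psi> (\<theta> w)) = \<psi> w"
        using return_map_inverse[OF yr y(3,4) T] by metis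
      define e where "e = min e0 d"
      have e: "e > 0" "e \<le> d" "ball (0::complex) e \<subseteq> ball 0 e0" "ball (0::complex) e \<subseteq> ball 0 d"
        using \<theta>(1) d(1) by (auto simp: e_def)
      have \<theta>h: "\<theta> holomorphic_on ball 0 e" using \<theta>(2) e(3) by (rule holomorphic_on_subset)
      have map: "\<theta> w \<in> E \<and> cmod (\<theta> w) < d" if w: "w \<in> E" "cmod w < e" for w
      proof -
        have "w \<in> ball 0 e0" using w(2) e(3) by auto
        from \<theta>(5)[OF this] have tw: "\<theta> w \<in> T" "(f ^^ N) (\<psi> (\<theta> w)) = \<psi> w" by auto
        have "(f ^^ N) (\<psi> (\<theta> w)) \<in> K" using tw(2) w(1) by (simp add: E_def)
        then have "\<psi> (\<theta> w) \<in> K" using B(3) tw(1) by (simp add: T_def)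
        then show ?thesis using tw(1) \<open>d \<le> r\<close> by (simp add: T_def E_def)
      qed
      have lnd: "ln (cmod (deriv \<theta> w)) = - c N (\<psi> y)" if w: "w \<in> E" "cmod w < e" for w
      proof -
        have we: "w \<in> ball 0 e" "w \<in> ball 0 e0" using w(2) e(3) by auto
        have m: "\<theta> w \<in> E" "cmod (\<theta> w) < d" using map[OF w] by auto
        have "spd ((\<lambda>z. (f ^^ N) (\<psi> z)) \<circ> \<theta>) w = cmod (deriv \<theta> w) * spd (\<lambda>z. (f ^^ N) (\<psi> z)) (\<theta> w)"
          by (rule spd_compose[OF hol_funpow \<theta>h open_ball we(1)])
        moreover have "spd ((\<lambda>z. (f ^^ N) (\<psi> z)) \<circ> \<theta>) w = spd \<psi> w"
        proof (rule spd_cong)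
          have "eventually (\<lambda>t. t \<in> ball 0 e0) (nhds w)" using we(2) open_ball eventually_nhds by blast
          then show "\<forall>\<^sub>F t in nhds w. ((\<lambda>z. (f ^^ N) (\<psi> z)) \<circ> \<theta>) t = \<psi> t"
            by (rule eventually_mono) (use \<theta>(5) in simp)
        qed
        ultimately have "spd \<psi> w = cmod (deriv \<theta> w) * (spherical_deriv (f ^^ N) (\<psi> (\<theta> w)) * spd \<psi> (\<theta> w))"
          unfolding spd_funpow by simp
        then have "ln (spd \<psi> w) = ln (cmod (deriv \<theta> w) * (spherical_deriv (f ^^ N) (\<psi> (\<theta> w)) * spd \<psi> (\<theta> w)))"
          by simp
        also have "\<dots> = ln (cmod (deriv \<theta> w)) + ln (spherical_deriv (f ^^ N) (\<psi> (\<theta> w)) * spd \<psi> (\<theta> w))"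
          using \<theta>(4)[OF we(2)] sderiv_funpow_pos[of "\<psi> (\<theta> w)" N] spd_\<psi>_pos[of "\<theta> w"] m(1)
          by (intro ln_mult_pos mult_pos_pos) (auto simp: E_def)
        also have "ln (spherical_deriv (f ^^ N) (\<psi> (\<theta> w)) * spd \<psi> (\<theta> w)) =
            ln (spherical_deriv (f ^^ N) (\<psi> (\<theta> w))) + ln (spd \<psi> (\<theta> w))"
          using sderiv_funpow_pos[of "\<psi> (\<theta> w)" N] spd_\<psi>_pos[of "\<theta> w"] m(1)
          by (intro ln_mult_pos) (auto simp: E_def)
        finally have 1: "ln (spd \<psi> w) = ln (cmod (deriv \<theta> w)) +
            (ln (spherical_deriv (f ^^ N) (\<psi> (\<theta> w))) + ln (spd \<psi> (\<theta> w)))" .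
        have "v w = v (\<theta> w)" using vconst[OF w(1)] vconst[OF m] w(2) e(2) by simp
        moreover have "c N (\<psi> (\<theta> w)) = c N (\<psi> y)" using W(3) \<theta>(5)[OF we(2)] m(1) by (simp add: T_def E_def)
        moreover have "(f ^^ N) (\<psi> (\<theta> w)) = \<psi> w" using \<theta>(5)[OF we(2)] by simp
        ultimately show ?thesis using 1 by (simp add: v_def c_def)
      qed
      have "deriv \<theta> constant_on ball 0 e"
      proof (rule self_similar_constant_modulus[OF \<rho> d(1) inv E_islimpt \<theta>h e(1,2) \<theta>(3) y(2)])
        show "y \<in> E" using y(3) yr by (simp add: E_def)
        show "deriv \<theta> 0 \<noteq> 0" using \<theta>(1,4) by simp
        show "cmod y < d" using y(1) by simp
        fix w assume w: "w \<in> E" "cmod w < e"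
        show "\<theta> w \<in> E \<and> cmod (\<theta> w) < d" by (rule map[OF w])
        have "ln (cmod (deriv \<theta> w)) = ln (cmod (deriv \<theta> 0))" using lnd[OF w] lnd[OF zE] e(1) by simp
        moreover have "w \<in> ball 0 e0" using w(2) e(3) by auto
        ultimately show "cmod (deriv \<theta> w) = cmod (deriv \<theta> 0)"
          using \<theta>(4)[of w] \<theta>(4)[of 0] \<theta>(1) by simp
      qed
      then obtain k where k: "\<And>w. w \<in> ball 0 e \<Longrightarrow> deriv \<theta> w = k" unfolding constant_on_def by metis
      show "\<exists>a. a \<noteq> 0 \<and> (\<forall>z. (f ^^ N) (\<psi> z) = \<psi> (a * (z - y)))"
      proof (rule affine_return_global[OF e(1) \<theta>h \<theta>(3)])
        show "deriv \<theta> 0 \<noteq> 0" using \<theta>(1,4) by simp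
        show "(f ^^ N) (\<psi> (\<theta> w)) = \<psi> w" if "w \<in> ball 0 e" for w using \<theta>(5) e(3) that by blast
        show "deriv \<theta> w = deriv \<theta> 0" if w: "w \<in> ball 0 e" for w using k[OF w] k[of 0] e(1) by simp
      qed
    qed
  qed
qed

end

section \<open>Periods of the Poincare function\<close>

definition periods :: "(complex \<Rightarrow> P1) \<Rightarrow> complex set" where
  "periods \<psi> = {t. \<forall>z. \<psi> (z + t) = \<psi> z}"

lemma periodsD: "t \<in> periods \<psi> \<Longrightarrow> \<psi> (z + t) = \<psi> z"
  by (simp add: periods_def)

lemma periods_diff: "s \<in> periods \<psi> \<Longrightarrow> t \<in> periods \<psi> \<Longrightarrow> s - t \<in> periods \<psi>"
proof -
  assume s: "s \<in> periods \<psi>" and t: "t \<in> periods \<psi>"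
  have "\<psi> (z + (s - t)) = \<psi> z" for z
  proof -
    have "\<psi> (z + (s - t)) = \<psi> ((z + (s - t)) + t)" by (rule periodsD[OF t, symmetric])
    also have "\<dots> = \<psi> (z + s)" by simp
    also have "\<dots> = \<psi> z" by (rule periodsD[OF s])
    finally show ?thesis .
  qed
  then show ?thesis by (simp add: periods_def)
qed

lemma periods_mult:
  assumes "\<And>z. f (\<psi> z) = \<psi> (a * z + b)" "a \<noteq> 0" "t \<in> periods \<psi>"
  shows "a * t \<in> periods \<psi>"
proof -
  have "\<psi> (z + a * t) = \<psi> z" for z
  proof -
    define w where "w = (z - b) / a"
    have z: "z = a * w + b" using assms(2) by (simp add: w_def)
    have "\<psi> (z + a * t) = f (\<psi> (w + t))" unfolding assms(1) z by (simp add: algebra_simps)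
    also have "\<psi> (w + t) = \<psi> w" by (rule periodsD[OF assms(3)])
    also have "f (\<psi> w) = \<psi> z" unfolding assms(1) z ..
    finally show ?thesis .
  qed
  then show ?thesis by (simp add: periods_def)
qed

text \<open>The elliptic curve is the plane modulo the periods of \<psi>. Both \<psi> and z
  \<mapsto> a * z + b descend to it, the latter because \<open>a\<close> times a period is a
  period.\<close>

lemma is_Lattes_of_lattice_periods:
  assumes f: "P1_morphism_of_degree f d" "d \<ge> 2" and \<psi>: "P1hol \<psi> UNIV" "\<psi> z1 \<noteq> \<psi> z2"
    and eq: "\<And>z. f (\<psi> z) = \<psi> (a * z + b)" "a \<noteq> 0" and lat: "is_lattice (periods \<psi>)"
  shows "is_Lattes f"
proof -
  let ?T = "periods \<psi>"
  have zT: "0 \<in> ?T" by (simp add: periods_def)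
  define rep where "rep X = (SOME z. z \<in> X)" for X :: "complex set"
  have rep: "\<exists>t\<in>?T. rep (torus_proj ?T z) = z + t" for z
  proof -
    have "z + 0 \<in> torus_proj ?T z" unfolding torus_proj_def using zT by (rule imageI)
    then have "rep (torus_proj ?T z) \<in> torus_proj ?T z" unfolding rep_def by (rule someI)
    then show ?thesis by (auto simp: torus_proj_def)
  qed
  have proj_eq: "torus_proj ?T (z + t) = torus_proj ?T z" if t: "t \<in> ?T" for z t
  proof (intro equalityI subsetI)
    fix x assume "x \<in> torus_proj ?T (z + t)"
    then obtain s where s: "s \<in> ?T" "x = z + t + s" by (auto simp: torus_proj_def)
    have "t - (0 - s) \<in> ?T" by (intro periods_diff t zT s)
    then show "x \<in> torus_proj ?T z" unfolding torus_proj_def using s by (intro image_eqI[of _ _ "t + s"]) simp_all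
  next
    fix x assume "x \<in> torus_proj ?T z"
    then obtain s where s: "s \<in> ?T" "x = z + s" by (auto simp: torus_proj_def)
    have "s - t \<in> ?T" by (intro periods_diff t s)
    then show "x \<in> torus_proj ?T (z + t)" unfolding torus_proj_def using s by (intro image_eqI[of _ _ "s - t"]) simp_all
  qed
  define p where "p X = \<psi> (rep X)" for X
  define g where "g X = torus_proj ?T (a * rep X + b)" for X
  have p: "p (torus_proj ?T z) = \<psi> z" for z
  proof -
    obtain t where "t \<in> ?T" "rep (torus_proj ?T z) = z + t" using rep[of z] by blast
    then show ?thesis unfolding p_def by (simp only: periodsD)
  qed
  have g: "g (torus_proj ?T z) = torus_proj ?T (a * z + b)" for z
  proof -
    obtain t where t: "t \<in> ?T" "rep (torus_proj ?T z) = z + t" using rep[of z] by blast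
    have "g (torus_proj ?T z) = torus_proj ?T ((a * z + b) + a * t)"
      unfolding g_def t(2) by (simp add: algebra_simps)
    also have "\<dots> = torus_proj ?T (a * z + b)" by (rule proj_eq[OF periods_mult[OF eq t(1)]])
    finally show ?thesis .
  qed
  have "torus_endomorphism ?T g" unfolding torus_endomorphism_def
  proof
    fix z show "\<exists>U G. open U \<and> z \<in> U \<and> G holomorphic_on U \<and> (\<forall>w\<in>U. g (torus_proj ?T w) = torus_proj ?T (G w))"
      by (rule exI[of _ UNIV], rule exI[of _ "\<lambda>w. a * w + b"]) (auto simp: g intro!: holomorphic_intros)
  qed
  moreover have "torus_to_P1_morphism ?T p"
    unfolding torus_to_P1_morphism_def using holomorphic_to_P1I[OF \<psi>(1)] p by (simp add: comp_def)
  moreover have "\<not> p constant_on torus ?T"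
  proof
    assume "p constant_on torus ?T"
    then obtain y where y: "\<And>X. X \<in> torus ?T \<Longrightarrow> p X = y" unfolding constant_on_def by metis
    have "\<psi> z = y" for z using y[of "torus_proj ?T z"] p by (simp add: torus_def)
    then show False using \<psi>(2) by simp
  qed
  moreover have "\<forall>x\<in>torus ?T. f (p x) = p (g x)"
    by (simp add: torus_def p g eq(1))
  ultimately show ?thesis unfolding is_Lattes_def using f lat by blast
qed

context poincare
begin

lemma eqn_pow: "\<psi> (\<rho> ^ k * z) = (f ^^ (q * k)) (\<psi> z)"
proof (induction k)
  case (Suc k)
  have "\<psi> (\<rho> ^ Suc k * z) = \<psi> (\<rho> * (\<rho> ^ k * z))" by (simp add: mult_ac)
  also have "\<dots> = (f ^^ q) ((f ^^ (q * k)) (\<psi> z))" unfolding eqn Suc ..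
  also have "\<dots> = (f ^^ (q * Suc k)) (\<psi> z)" by (simp add: funpow_add)
  finally show ?case .
qed simp

lemma periods_discrete: "t \<in> periods \<psi> \<Longrightarrow> cmod t < r \<Longrightarrow> t = 0"
proof -
  assume t: "t \<in> periods \<psi>" "cmod t < r"
  have "\<psi> (0 + t) = \<psi> 0" using t(1) unfolding periods_def by blast
  then show "t = 0" using inj r t(2) by (auto dest: inj_onD)
qed

lemma nonconstant: obtains z where "\<psi> z \<noteq> \<psi> 0"
proof -
  have "\<psi> (of_real (r / 2)) \<noteq> \<psi> 0"
  proof
    assume "\<psi> (of_real (r / 2)) = \<psi> 0"
    then have "complex_of_real (r / 2) = 0" using inj r by (intro inj_onD[OF inj]) auto
    then show False using r by simp
  qed
  then show ?thesis by (rule that)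
qed

text \<open>The orbits of an affine contraction converge to its fixed point, so continuity would
  make \<psi> constant.\<close>

lemma no_contracting_symmetry:
  assumes \<mu>: "cmod \<mu> < 1" and sym: "\<And>z. \<psi> (\<mu> * z + c) = \<psi> z"
  shows False
proof -
  define p where "p = c / (1 - \<mu>)"
  have \<mu>1: "1 - \<mu> \<noteq> 0" using \<mu> by auto
  then have p: "\<mu> * p + c = p" by (simp add: p_def field_simps)
  have step: "\<psi> (p + \<mu> ^ k * u) = \<psi> (p + u)" for k u
  proof (induction k)
    case (Suc k)
    have "p + \<mu> ^ Suc k * u = \<mu> * (p + \<mu> ^ k * u) + c" using p by (simp add: algebra_simps)
    then have "\<psi> (p + \<mu> ^ Suc k * u) = \<psi> (p + \<mu> ^ k * u)" by (simp only: sym)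
    then show ?case using Suc by (rule trans)
  qed simp
  have const: "\<psi> (p + u) = \<psi> p" for u
  proof -
    have "(\<lambda>k. p + \<mu> ^ k * u) \<longlonglongrightarrow> p + 0 * u"
      by (intro tendsto_intros LIMSEQ_power_zero \<mu>)
    then have lim: "(\<lambda>k. p + \<mu> ^ k * u) \<longlonglongrightarrow> p" by simp
    have "(\<lambda>k. \<psi> (p + \<mu> ^ k * u)) \<longlonglongrightarrow> \<psi> p"
      by (rule continuous_on_tendsto_compose[OF P1hol_continuous[OF hol open_UNIV] lim]) simp_all
    then have "(\<lambda>k::nat. \<psi> (p + u)) \<longlonglongrightarrow> \<psi> p" unfolding step .
    then show ?thesis by (simp only: LIMSEQ_const_iff)
  qed
  obtain z where "\<psi> z \<noteq> \<psi> 0" by (rule nonconstant)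
  moreover have "\<psi> z = \<psi> p" using const[of "z - p"] by simp
  moreover have "\<psi> 0 = \<psi> p" using const[of "- p"] by simp
  ultimately show False by simp
qed

lemma affine_semiconjugacy:
  assumes \<delta>: "\<delta> > 0" "\<delta> \<le> r" "affine_returns \<delta>"
  obtains a b t where "cmod a > 1" "\<And>z. f (\<psi> z) = \<psi> (a * z + b)" "t \<in> periods \<psi>" "t \<noteq> 0"
proof -
  \<comment> \<open>Removing 0 ensures y \<noteq> 0 for the return points, hence \<beta> \<noteq> 0
    and a nonzero period.\<close>
  define U where "U = \<psi> ` (ball 0 \<delta> - {0})"
  have U: "open U" unfolding U_def using \<delta>(2) by (intro open_image_\<psi>) auto
  have "U \<inter> K \<noteq> {}"
  proof -
    have "open (\<psi> ` ball 0 \<delta>)" using \<delta>(2) by (intro open_image_\<psi>) auto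
    moreover have "\<psi> 0 \<in> \<psi> ` ball 0 \<delta>" using \<delta>(1) by (intro imageI) simp
    ultimately obtain x where "x \<in> \<psi> ` ball 0 \<delta>" "x \<in> K" "x \<noteq> \<psi> 0" using perfect[OF base] by metis
    moreover from this(1) obtain z where "x = \<psi> z" "z \<in> ball 0 \<delta>" by (rule imageE)
    ultimately have "x \<in> U \<inter> K" unfolding U_def by (intro IntI image_eqI[of _ _ z]) auto
    then show ?thesis by blast
  qed
  from mixing[OF U this] obtain k where k: "\<forall>N\<ge>k. (f ^^ N) ` (U \<inter> K) = K" by (rule exE)
  have return: "\<exists>y a. y \<noteq> 0 \<and> a \<noteq> 0 \<and> (\<forall>z. (f ^^ N) (\<psi> z) = \<psi> (a * (z - y)))" if "N \<ge> k" for N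
  proof -
    have "\<psi> 0 \<in> (f ^^ N) ` (U \<inter> K)" using k that base by simp
    then obtain x where x: "x \<in> U \<inter> K" "\<psi> 0 = (f ^^ N) x" by (rule imageE)
    have "x \<in> \<psi> ` (ball 0 \<delta> - {0})" using x(1) unfolding U_def by (rule IntD1)
    then obtain y where y: "x = \<psi> y" "y \<in> ball 0 \<delta> - {0}" by (rule imageE)
    have y: "y \<in> ball 0 \<delta> - {0}" "\<psi> y \<in> K" "(f ^^ N) (\<psi> y) = \<psi> 0"
      using x y by simp_all
    have "\<exists>a. a \<noteq> 0 \<and> (\<forall>z. (f ^^ N) (\<psi> z) = \<psi> (a * (z - y)))"
      using \<delta>(3)[unfolded affine_returns_def, rule_format, of y N] y by simp
    moreover have "y \<noteq> 0" using y(1) by simp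
    ultimately show ?thesis by blast
  qed
  \<comment> \<open>At a multiple of \<open>q\<close> the iterate of \<open>f\<close> is also given
    by a rescaling, \<psi> (\<rho>^k * z), and the two expressions can be compared.\<close>
  have kq: "q * k \<ge> k" using q by simp
  have \<rho>k: "\<rho> ^ k \<noteq> 0" using \<rho>_nonzero by simp
  obtain y a where ya: "y \<noteq> 0" "a \<noteq> 0" "\<And>z. (f ^^ (q * k)) (\<psi> z) = \<psi> (a * (z - y))"
    using return[OF kq] by (elim exE conjE) (rule that, assumption+, simp)
  obtain y' a' where ya': "a' \<noteq> 0" "\<And>z. (f ^^ Suc (q * k)) (\<psi> z) = \<psi> (a' * (z - y'))"
    using return[OF le_SucI[OF kq]] by (elim exE conjE) (rule that, assumption+, rule spec)
  define \<alpha> where "\<alpha> = a / \<rho> ^ k"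
  define \<beta> where "\<beta> = - a * y"
  have \<alpha>\<beta>: "\<alpha> \<noteq> 0" "\<beta> \<noteq> 0" using ya \<rho>k by (simp_all add: \<alpha>_def \<beta>_def)
  have sym: "\<psi> (\<alpha> * w + \<beta>) = \<psi> w" for w
  proof -
    have "\<psi> w = \<psi> (\<rho> ^ k * (w / \<rho> ^ k))" using \<rho>k by simp
    also have "\<dots> = \<psi> (a * (w / \<rho> ^ k - y))" unfolding eqn_pow ya(3) ..
    also have "a * (w / \<rho> ^ k - y) = \<alpha> * w + \<beta>" by (simp add: \<alpha>_def \<beta>_def algebra_simps)
    finally show ?thesis by simp
  qed
  have sym2: "\<psi> (\<alpha> * w + \<rho> * \<beta>) = \<psi> w" for w
  proof -
    have "\<alpha> * w + \<rho> * \<beta> = \<rho> * (\<alpha> * (w / \<rho>) + \<beta>)" using \<rho>_nonzero by (simp add: algebra_simps)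
    then have "\<psi> (\<alpha> * w + \<rho> * \<beta>) = (f ^^ q) (\<psi> (\<alpha> * (w / \<rho>) + \<beta>))" by (simp only: eqn)
    also have "\<dots> = \<psi> (\<rho> * (w / \<rho>))" unfolding sym eqn ..
    finally show ?thesis using \<rho>_nonzero by simp
  qed
  \<comment> \<open>\<open>sym2\<close> is \<open>sym\<close> conjugated by multiplication by
    \<rho>; the linear parts agree, and this is the difference of the translation parts.\<close>
  define t where "t = (\<rho> - 1) * \<beta>"
  have t: "t \<in> periods \<psi>"
  proof -
    have "\<psi> (z + t) = \<psi> z" for z
    proof -
      define w where "w = (z - \<beta>) / \<alpha>"
      have z: "z = \<alpha> * w + \<beta>" using \<alpha>\<beta> by (simp add: w_def)
      have "z + t = \<alpha> * w + \<rho> * \<beta>" unfolding z t_def by (simp add: algebra_simps)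
      then have "\<psi> (z + t) = \<psi> w" by (simp only: sym2)
      also have "\<psi> w = \<psi> z" unfolding z by (simp only: sym)
      finally show ?thesis .
    qed
    then show ?thesis by (simp add: periods_def)
  qed
  have "\<rho> \<noteq> 1" using \<rho> by auto
  then have t0: "t \<noteq> 0" using \<alpha>\<beta>(2) by (simp add: t_def)
  define A where "A = a' / \<rho> ^ k"
  define B where "B = - a' * y'"
  have semi: "f (\<psi> w) = \<psi> (A * w + B)" for w
  proof -
    have "f (\<psi> w) = f (\<psi> (\<rho> ^ k * (w / \<rho> ^ k)))" using \<rho>k by simp
    also have "\<dots> = (f ^^ Suc (q * k)) (\<psi> (w / \<rho> ^ k))" unfolding eqn_pow by simp
    also have "\<dots> = \<psi> (a' * (w / \<rho> ^ k - y'))" by (rule ya')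
    also have "a' * (w / \<rho> ^ k - y') = A * w + B" by (simp add: A_def B_def algebra_simps)
    finally show ?thesis .
  qed
  have semi_pow: "\<exists>c. \<forall>w. (f ^^ j) (\<psi> w) = \<psi> (A ^ j * w + c)" for j
  proof (induction j)
    case 0
    show ?case by (rule exI[of _ 0]) simp
  next
    case (Suc j)
    then obtain c where c: "\<And>w. (f ^^ j) (\<psi> w) = \<psi> (A ^ j * w + c)" by blast
    show ?case
      by (rule exI[of _ "A * c + B"]) (simp add: c semi algebra_simps)
  qed
  \<comment> \<open>Comparing the q-th iterate of the affine map with multiplication by \<rho> gives
    a symmetry with linear part A^q / \<rho>, which would contract if |A| <= 1.\<close>
  have A1: "cmod A > 1"
  proof (rule ccontr)
    assume "\<not> cmod A > 1"
    then have Aq: "cmod (A ^ q) \<le> 1" by (simp add: norm_power power_le_one)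
    obtain c where c: "\<And>w. (f ^^ q) (\<psi> w) = \<psi> (A ^ q * w + c)" using semi_pow by blast
    have "cmod (A ^ q / \<rho>) < 1"
    proof -
      have "cmod (A ^ q) < cmod \<rho>" using Aq \<rho> by linarith
      then show ?thesis using \<rho> unfolding norm_divide by (subst pos_divide_less_eq) auto
    qed
    moreover have "\<psi> (A ^ q / \<rho> * z + c) = \<psi> z" for z
    proof -
      have "\<psi> z = \<psi> (\<rho> * (z / \<rho>))" using \<rho>_nonzero by simp
      also have "\<dots> = \<psi> (A ^ q * (z / \<rho>) + c)" unfolding eqn c ..
      finally show ?thesis by simp
    qed
    ultimately show False by (rule no_contracting_symmetry)
  qed
  show ?thesis by (rule that[OF A1 semi t t0])
qed

end

section \<open>Singly periodic Poincare functions\<close>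

lemma P1hol_constant_local:
  assumes "P1hol \<psi> UNIV" "e > 0" "\<And>z. z \<in> ball \<xi> e \<Longrightarrow> \<psi> z = c"
  shows "\<psi> z = c"
proof -
  obtain q t where c: "c = mob q t" by (rule P1_point_mob)
  have "P1hol (\<lambda>z. mob q t) UNIV" by (rule P1hol_mob_comp) simp_all
  from P1hol_identity_open[OF assms(1) this assms(2), of \<xi>] assms(3) c
  have "\<psi> = (\<lambda>z. mob q t)" by simp
  then show ?thesis by (simp add: c)
qed

text \<open>If all real points near 0 were critical, the derivative in a chart would vanish on a
  segment and \<psi> would be constant.\<close>

lemma exists_real_injective_point:
  assumes \<psi>: "P1hol \<psi> UNIV" "\<psi> z1 \<noteq> \<psi> z2"
  obtains x :: real and e where "e > 0" "inj_on \<psi> (ball (of_real x) e)"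
proof -
  obtain p where p: "p \<noteq> \<psi> 0" using ex_not_in_pair by blast
  obtain s where s: "s > 0" "(\<lambda>w. mob_inv p (\<psi> w)) holomorphic_on ball 0 s"
    "\<And>w. w \<in> ball 0 s \<Longrightarrow> \<psi> w \<noteq> p"
    using P1hol_local_chart[OF \<psi>(1) open_UNIV UNIV_I p[symmetric]] by metis
  define h where "h w = mob_inv p (\<psi> w)" for w
  have h: "h holomorphic_on ball 0 s" using s(2) by (simp add: h_def[abs_def])
  have h_inj: "\<psi> v = \<psi> w" if "v \<in> ball 0 s" "w \<in> ball 0 s" "h v = h w" for v w
    using mob_inv_inject[OF s(3)[OF that(1)] s(3)[OF that(2)]] that(3) by (simp add: h_def)
  have dh: "deriv h holomorphic_on ball 0 s" by (rule holomorphic_deriv[OF h open_ball])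
  have "\<exists>x::real. of_real x \<in> ball (0::complex) s \<and> deriv h (of_real x) \<noteq> 0"
  proof (rule ccontr)
    assume "\<not> ?thesis"
    then have ne: "deriv h (of_real x) = 0" if "of_real x \<in> ball (0::complex) s" for x :: real
      using that by blast
    have z: "deriv h z = 0" if "z \<in> of_real ` {0<..<s}" for z
    proof -
      from that obtain x where x: "z = of_real x" "0 < x" "x < s" by auto
      then have "of_real x \<in> ball (0::complex) s" by simp
      from ne[OF this] show ?thesis unfolding x(1) .
    qed
    have lim: "0 islimpt (complex_of_real ` {0<..<s})"
      unfolding islimpt_approachable
    proof (intro allI impI)
      fix e :: real assume e: "e > 0"
      define x where "x = min e s / 2"
      have "0 < x" "x < s" "x < e" using e s(1) by (auto simp: x_def min_def)
      then show "\<exists>x'\<in>complex_of_real ` {0<..<s}. x' \<noteq> 0 \<and> dist x' 0 < e"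
        by (intro bexI[of _ "of_real x"]) auto
    qed
    have dz: "deriv h w = 0" if w: "w \<in> ball 0 s" for w
      by (rule analytic_continuation[OF dh open_ball connected_ball _ _ lim z w]) (use s(1) in auto)
    have "\<exists>c. \<forall>x\<in>ball 0 s. h x = c"
    proof (rule has_field_derivative_zero_constant)
      fix x :: complex assume x: "x \<in> ball 0 s"
      have "(h has_field_derivative deriv h x) (at x)" using h x holomorphic_derivI by blast
      then show "(h has_field_derivative 0) (at x within ball 0 s)"
        unfolding dz[OF x] by (rule has_field_derivative_at_within)
    qed simp
    then obtain c where c: "\<And>x. x \<in> ball 0 s \<Longrightarrow> h x = c" by blast
    have "\<psi> w = \<psi> 0" if "w \<in> ball 0 s" for w using h_inj[OF that, of 0] c[OF that] c[of 0] s(1) by simp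
    from P1hol_constant_local[OF \<psi>(1) s(1) this] have "\<psi> z1 = \<psi> 0" "\<psi> z2 = \<psi> 0" by blast+
    then show False using \<psi>(2) by simp
  qed
  then obtain x :: real where x: "of_real x \<in> ball (0::complex) s" "deriv h (of_real x) \<noteq> 0" by blast
  obtain e where e: "e > 0" "ball (complex_of_real x) e \<subseteq> ball 0 s" "inj_on h (ball (of_real x) e)"
    using has_complex_derivative_locally_invertible[OF h x(1) open_ball x(2)] by metis
  have "inj_on \<psi> (ball (of_real x) e)"
  proof (rule inj_onI)
    fix v w assume vw: "v \<in> ball (of_real x) e" "w \<in> ball (of_real x) e" "\<psi> v = \<psi> w"
    then have "h v = h w" by (simp add: h_def)
    then show "v = w" using e(3) vw(1,2) by (auto dest: inj_onD)
  qed
  with e(1) show ?thesis by (rule that)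
qed

text \<open>\<kappa> is \<psi> followed by its local inverse at \<open>w\<close>. Regularity is
  asked at \<open>w\<close> alone, as another point \<open>z\<close> of the same fibre may be
  critical.\<close>

lemma P1hol_local_lift:
  assumes \<psi>: "P1hol \<psi> UNIV" and inj: "inj_on \<psi> (ball w e)" "e > 0" and eq: "\<psi> z = \<psi> w"
  obtains d \<kappa> where "d > 0" "\<kappa> holomorphic_on ball z d" "\<kappa> z = w" "\<And>t. t \<in> ball z d \<Longrightarrow> \<psi> (\<kappa> t) = \<psi> t"
proof -
  obtain p where p: "p \<noteq> \<psi> w" using ex_not_in_pair by blast
  define S where "S = {t\<in>ball w e. \<psi> t \<noteq> p}"
  define h where "h t = mob_inv p (\<psi> t)" for t
  have \<psi>': "P1hol \<psi> (ball w e)" using \<psi> by (rule P1hol_subset) simp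
  have S: "open S" "h holomorphic_on S" unfolding S_def h_def by (rule P1hol_mob_inv[OF \<psi>' open_ball])+
  have wS: "w \<in> S" using inj(2) p by (simp add: S_def)
  have "inj_on h S"
  proof (rule inj_onI)
    fix a b assume ab: "a \<in> S" "b \<in> S" "h a = h b"
    then have "\<psi> a = \<psi> b" using mob_inv_inject[of "\<psi> a" p "\<psi> b"] by (simp add: S_def h_def)
    then show "a = b" using inj(1) ab(1,2) by (auto simp: S_def dest: inj_onD)
  qed
  moreover obtain g where g: "g holomorphic_on (h ` S)" "\<And>t. t \<in> S \<Longrightarrow> g (h t) = t"
    using holomorphic_has_inverse[OF S(2,1) \<open>inj_on h S\<close>] by metis
  have ohS: "open (h ` S)" by (rule open_mapping_thm3[OF S(2,1) \<open>inj_on h S\<close>])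
  define T where "T = {t\<in>UNIV. \<psi> t \<noteq> p}"
  have T: "open T" "h holomorphic_on T" unfolding T_def h_def by (rule P1hol_mob_inv[OF \<psi> open_UNIV])+
  define W where "W = T \<inter> h -` (h ` S)"
  have W: "open W" unfolding W_def
    by (rule continuous_open_preimage[OF holomorphic_on_imp_continuous_on[OF T(2)] T(1) ohS])
  have hz: "h z = h w" using eq by (simp add: h_def)
  have "h w \<in> h ` S" using wS by (rule imageI)
  then have "z \<in> W" using p eq hz by (simp add: W_def T_def)
  then obtain d where d: "d > 0" "ball z d \<subseteq> W" using W open_contains_ball by blast
  have "g \<circ> h holomorphic_on ball z d"
    by (rule holomorphic_on_compose_gen[OF holomorphic_on_subset[OF T(2)] g(1)]) (use d(2) in \<open>auto simp: W_def\<close>)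
  then have hol: "(\<lambda>t. g (h t)) holomorphic_on ball z d" by (simp add: comp_def)
  show ?thesis
  proof (rule that[OF d(1) hol])
    show "g (h z) = w" unfolding hz by (rule g(2)[OF wS])
    fix t assume "t \<in> ball z d"
    then have "t \<in> W" using d(2) by blast
    then obtain s where s: "s \<in> S" "h t = h s" and t: "\<psi> t \<noteq> p" by (auto simp: W_def T_def)
    have "g (h t) = s" unfolding s(2) by (rule g(2)[OF s(1)])
    moreover have "\<psi> t = \<psi> s" using mob_inv_inject[of "\<psi> t" p "\<psi> s"] t s by (simp add: S_def h_def)
    ultimately show "\<psi> (g (h t)) = \<psi> t" by simp
  qed
qed

locale periodic_poincare =
  fixes f :: "P1 \<Rightarrow> P1" and \<psi> :: "complex \<Rightarrow> P1" and n :: int and z1 z2 :: complex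
  assumes f: "P1_endo f" and hol: "P1hol \<psi> UNIV" and nonconst: "\<psi> z1 \<noteq> \<psi> z2" and n: "\<bar>n\<bar> \<ge> 2"
    and eqn: "\<And>z. f (\<psi> z) = \<psi> (of_int n * z)" and per: "periods \<psi> = \<int>"
begin

lemma period_int: "\<psi> (z + of_int k) = \<psi> z"
  by (rule periodsD) (simp add: per)

lemma eqn_pow: "(f ^^ k) (\<psi> z) = \<psi> (of_int n ^ k * z)"
  by (induction k) (simp_all add: eqn mult_ac)

lemma cont: "continuous_on S \<psi>"
  using P1hol_continuous[OF hol open_UNIV] continuous_on_subset by blast

text \<open>Rescaling \<open>\<kappa>\<close> around \<open>z\<close> by the powers of \<open>n\<close> turns the period \<open>1\<close> into the period \<open>\<kappa>' z\<close>;
  the limit exists because the orbit of the real point \<open>\<kappa> z\<close> is bounded modulo the integers.\<close>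

lemma lift_deriv_integer:
  assumes \<kappa>: "\<kappa> holomorphic_on ball z d" "d > 0" and eq: "\<And>t. t \<in> ball z d \<Longrightarrow> \<psi> (\<kappa> t) = \<psi> t"
    and re: "\<kappa> z = of_real x"
  shows "deriv \<kappa> z \<in> \<int>"
proof -
  define c where "c = deriv \<kappa> z"
  define N where "N k = (of_int n ^ k :: complex)" for k :: nat
  have N0: "N k \<noteq> 0" for k using n by (simp add: N_def)
  have Ninv: "(\<lambda>k. s / N k) \<longlonglongrightarrow> 0" for s
    unfolding N_def by (rule tendsto_divide_power) (use n in simp)
  have zb: "z \<in> ball z d" using \<kappa>(2) by simp
  have der: "(\<kappa> has_field_derivative c) (at z)" unfolding c_def using \<kappa>(1) zb holomorphic_derivI by blast
  have diff: "(\<lambda>k. N k * (\<kappa> (z + s / N k) - \<kappa> z)) \<longlonglongrightarrow> c * s" for s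
  proof (cases "s = 0")
    case False
    have quot: "(\<lambda>h. (\<kappa> (z + h) - \<kappa> z) / h) \<midarrow>0\<rightarrow> c" using der by (simp add: DERIV_def)
    have "\<forall>\<^sub>F k in sequentially. s / N k \<noteq> 0" using False N0 by simp
    with Ninv have "filterlim (\<lambda>k. s / N k) (at 0) sequentially" by (rule filterlim_atI)
    with quot have "(\<lambda>k. (\<kappa> (z + s / N k) - \<kappa> z) / (s / N k)) \<longlonglongrightarrow> c" by (rule filterlim_compose)
    then have "(\<lambda>k. (\<kappa> (z + s / N k) - \<kappa> z) / (s / N k) * s) \<longlonglongrightarrow> c * s" by (rule tendsto_mult_right)
    then show ?thesis using False by (simp add: mult.commute)
  qed simp
  define \<theta> where "\<theta> k = frac (of_int n ^ k * x)" for k :: nat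
  have "\<forall>k. \<theta> k \<in> {0..1}" by (simp add: \<theta>_def frac_lt_1 less_imp_le)
  then obtain l g where g: "strict_mono g" "(\<theta> \<circ> g) \<longlonglongrightarrow> l"
    using compact_Icc[of 0 "1::real"] unfolding compact_def by metis
  have shift: "\<psi> (N k * \<kappa> z + w) = \<psi> (of_real (\<theta> k) + w)" for k w
  proof -
    have "N k * \<kappa> z + w = (of_real (\<theta> k) + w) + of_int \<lfloor>of_int n ^ k * x\<rfloor>"
      unfolding re \<theta>_def frac_def N_def by simp
    then show ?thesis by (simp only: period_int)
  qed
  \<comment> \<open>Modulo the integers this is n^(g k) * \<kappa> (z + s / n^(g k)), with the real
    orbit replaced by its fractional part so that the sequence converges to l + c * s.\<close>
  define W where "W s k = of_real (\<theta> (g k)) + N (g k) * (\<kappa> (z + s / N (g k)) - \<kappa> z)" for s k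
  have Wlim: "(\<lambda>k. \<psi> (W s k)) \<longlonglongrightarrow> \<psi> (of_real l + c * s)" for s
  proof -
    have "(\<lambda>k. N (g k) * (\<kappa> (z + s / N (g k)) - \<kappa> z)) \<longlonglongrightarrow> c * s"
      using LIMSEQ_subseq_LIMSEQ[OF diff g(1), of s] by (simp add: comp_def)
    moreover have "(\<lambda>k. complex_of_real (\<theta> (g k))) \<longlonglongrightarrow> of_real l"
      using g(2) by (intro tendsto_of_real) (simp add: comp_def)
    ultimately have "W s \<longlonglongrightarrow> of_real l + c * s" unfolding W_def by (intro tendsto_add)
    then show ?thesis by (intro continuous_on_tendsto_compose[OF cont[of UNIV]]) simp_all
  qed
  have ev: "\<forall>\<^sub>F k in sequentially. \<psi> (W s k) = \<psi> (N (g k) * z + s)" for s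
  proof -
    have "\<forall>\<^sub>F k in sequentially. dist (s / N k) 0 < d" using Ninv[of s] \<kappa>(2) tendstoD by blast
    then have "\<forall>\<^sub>F k in sequentially. dist (s / N (g k)) 0 < d"
      using filterlim_subseq[OF g(1)] by (rule eventually_compose_filterlim)
    then show ?thesis
    proof eventually_elim
      case (elim k)
      then have b: "z + s / N (g k) \<in> ball z d" by (simp add: dist_norm)
      have "\<psi> (W s k) = \<psi> (N (g k) * \<kappa> z + N (g k) * (\<kappa> (z + s / N (g k)) - \<kappa> z))"
        unfolding W_def shift ..
      also have "\<dots> = \<psi> (N (g k) * \<kappa> (z + s / N (g k)))" by (simp add: algebra_simps)
      also have "\<dots> = (f ^^ g k) (\<psi> (\<kappa> (z + s / N (g k))))" unfolding eqn_pow N_def ..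
      also have "\<dots> = (f ^^ g k) (\<psi> (z + s / N (g k)))" unfolding eq[OF b] ..
      also have "\<dots> = \<psi> (N (g k) * (z + s / N (g k)))" unfolding eqn_pow N_def ..
      also have "N (g k) * (z + s / N (g k)) = N (g k) * z + s" using N0[of "g k"] by (simp add: distrib_left)
      finally show ?case .
    qed
  qed
  \<comment> \<open>\<psi> (W s k) eventually equals \<psi> (n^(g k) * z + s), which has period 1 in
    \<open>s\<close>; the limit inherits this.\<close>
  have period: "\<psi> (of_real l + c * s) = \<psi> (of_real l + c * (s + 1))" for s
  proof -
    have "\<forall>\<^sub>F k in sequentially. \<psi> (W (s + 1) k) = \<psi> (W s k)"
      using ev[of s] ev[of "s + 1"]
    proof eventually_elim
      case (elim k)
      then show ?case using period_int[of "N (g k) * z + s" 1] by (simp add: add.assoc)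
    qed
    then have "(\<lambda>k. \<psi> (W s k)) \<longlonglongrightarrow> \<psi> (of_real l + c * (s + 1))"
      by (rule Lim_transform_eventually[OF Wlim])
    with Wlim show ?thesis by (rule LIMSEQ_unique)
  qed
  show ?thesis
  proof (cases "c = 0")
    case True
    then show ?thesis by (simp add: c_def)
  next
    case False
    have "\<psi> (w + c) = \<psi> w" for w
    proof -
      define s where "s = (w - of_real l) / c"
      have "w = of_real l + c * s" using False by (simp add: s_def)
      then show ?thesis using period[of s] by (simp add: algebra_simps)
    qed
    then have "c \<in> periods \<psi>" by (simp add: periods_def)
    then show ?thesis by (simp add: per c_def)
  qed
qed

text \<open>Because \<kappa> is open, points where it is real accumulate at \<open>z\<close>. There
  \<kappa>' is an integer, close to and hence equal to its value at \<open>z\<close>, so \<kappa> is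
  affine by the identity theorem.\<close>

lemma fibre_over_real:
  assumes inj: "inj_on \<psi> (ball (of_real x) e)" "e > 0" and eq: "\<psi> z = \<psi> (of_real x)"
  shows "\<exists>m\<in>{1, -1}. \<forall>t. \<psi> (of_real x + m * (t - z)) = \<psi> t"
proof -
  obtain d \<kappa> where \<kappa>: "d > 0" "\<kappa> holomorphic_on ball z d" "\<kappa> z = of_real x" "\<And>t. t \<in> ball z d \<Longrightarrow> \<psi> (\<kappa> t) = \<psi> t"
    using P1hol_local_lift[OF hol inj eq] by metis
  have zb: "z \<in> ball z d" using \<kappa>(1) by simp
  have \<kappa>nc: "\<not> \<kappa> constant_on ball z s" if s: "s > 0" "s \<le> d" for s
  proof
    assume "\<kappa> constant_on ball z s"
    then obtain c where c: "\<And>t. t \<in> ball z s \<Longrightarrow> \<kappa> t = c" unfolding constant_on_def by metis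
    have "\<psi> t = \<psi> c" if "t \<in> ball z s" for t using \<kappa>(4)[of t] c[OF that] that s by simp
    from P1hol_constant_local[OF hol s(1) this] have "\<psi> z1 = \<psi> c" "\<psi> z2 = \<psi> c" by blast+
    then show False using nonconst by simp
  qed
  have int: "deriv \<kappa> t \<in> \<int>" if t: "t \<in> ball z d" "\<kappa> t \<in> \<real>" for t
  proof -
    obtain y where y: "\<kappa> t = of_real y" using t(2) Reals_cases by blast
    obtain d' where d': "d' > 0" "ball t d' \<subseteq> ball z d" using t(1) open_ball open_contains_ball by blast
    show ?thesis
      by (rule lift_deriv_integer[OF holomorphic_on_subset[OF \<kappa>(2) d'(2)] d'(1) \<kappa>(4) y]) (use d'(2) in blast)
  qed
  define m where "m = deriv \<kappa> z"
  have mZ: "m \<in> \<int>" unfolding m_def by (rule int[OF zb]) (simp add: \<kappa>(3))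
  have dh: "deriv \<kappa> holomorphic_on ball z d" by (rule holomorphic_deriv[OF \<kappa>(2) open_ball])
  then have "isCont (deriv \<kappa>) z" using holomorphic_on_imp_continuous_on zb continuous_on_eq_continuous_at open_ball by blast
  then obtain d1 where d1: "d1 > 0" "\<And>t. dist t z < d1 \<Longrightarrow> dist (deriv \<kappa> t) m < 1"
    unfolding continuous_at_eps_delta m_def by (metis zero_less_one)
  define d2 where "d2 = min d d1"
  have d2: "d2 > 0" "d2 \<le> d" "d2 \<le> d1" using \<kappa>(1) d1(1) by (auto simp: d2_def)
  define Z where "Z = {t\<in>ball z d2. \<kappa> t \<in> \<real>}"
  have dZ: "deriv \<kappa> t - m = 0" if t: "t \<in> Z" for t
  proof -
    have tb: "t \<in> ball z d" "dist t z < d1" using t d2 by (auto simp: Z_def dist_commute)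
    have "deriv \<kappa> t \<in> \<int>" using int[OF tb(1)] t by (simp add: Z_def)
    then have "deriv \<kappa> t - m \<in> \<int>" using mZ by (rule Ints_diff)
    then obtain k where k: "deriv \<kappa> t - m = of_int k" by (rule Ints_cases)
    have "cmod (deriv \<kappa> t - m) < 1" using d1(2)[OF tb(2)] by (simp add: dist_norm)
    then have "\<bar>k\<bar> < 1" unfolding k by simp
    then show ?thesis unfolding k by simp
  qed
  have limZ: "z islimpt Z"
    unfolding islimpt_approachable
  proof (intro allI impI)
    fix \<epsilon> :: real assume \<epsilon>: "\<epsilon> > 0"
    define s where "s = min \<epsilon> d2"
    have s: "s > 0" "s \<le> d" "s \<le> d2" "s \<le> \<epsilon>" using \<epsilon> d2 by (auto simp: s_def)
    have hs: "\<kappa> holomorphic_on ball z s" using \<kappa>(2) by (rule holomorphic_on_subset) (use s(2) in auto)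
    have "open (\<kappa> ` ball z s)"
      using open_mapping_thm[OF hs open_ball connected_ball open_ball order.refl \<kappa>nc[OF s(1,2)]] .
    moreover have "of_real x \<in> \<kappa> ` ball z s" using \<kappa>(3) s(1) by (metis centre_in_ball imageI)
    ultimately obtain \<eta> where \<eta>: "\<eta> > 0" "ball (of_real x) \<eta> \<subseteq> \<kappa> ` ball z s" using open_contains_ball by blast
    have "of_real (x + \<eta> / 2) \<in> ball (complex_of_real x) \<eta>"
      using \<eta>(1) by (simp add: dist_of_real dist_real_def del: of_real_add of_real_divide)
    then have "of_real (x + \<eta> / 2) \<in> \<kappa> ` ball z s" using \<eta>(2) by blast
    then obtain t where t: "t \<in> ball z s" "\<kappa> t = of_real (x + \<eta> / 2)" by (metis imageE)
    have "t \<noteq> z"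
    proof
      assume "t = z"
      then have "complex_of_real (x + \<eta> / 2) = of_real x" using t(2) \<kappa>(3) by simp
      then have "x + \<eta> / 2 = x" by (simp only: of_real_eq_iff)
      then show False using \<eta>(1) by simp
    qed
    moreover have "t \<in> Z" using t s(3) by (simp add: Z_def)
    moreover have "dist t z < \<epsilon>" using t(1) s(4) by (simp add: dist_commute)
    ultimately show "\<exists>x'\<in>Z. x' \<noteq> z \<and> dist x' z < \<epsilon>" by blast
  qed
  have dm: "deriv \<kappa> t - m = 0" if t: "t \<in> ball z d" for t
    by (rule analytic_continuation[of "\<lambda>t. deriv \<kappa> t - m", OF _ open_ball connected_ball _ zb limZ dZ t])
      (use dh d2 in \<open>auto simp: Z_def intro: holomorphic_on_diff holomorphic_on_const\<close>)
  have "\<exists>c. \<forall>t\<in>ball z d. \<kappa> t - m * t = c"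
  proof (rule has_field_derivative_zero_constant)
    fix t assume t: "t \<in> ball z d"
    have "(\<kappa> has_field_derivative deriv \<kappa> t) (at t)" using \<kappa>(2) t holomorphic_derivI by blast
    then have "((\<lambda>t. \<kappa> t - m * t) has_field_derivative 0) (at t)"
      using dm[OF t] by (auto intro!: derivative_eq_intros)
    then show "((\<lambda>t. \<kappa> t - m * t) has_field_derivative 0) (at t within ball z d)"
      by (rule has_field_derivative_at_within)
  qed simp
  then obtain c where c: "\<And>t. t \<in> ball z d \<Longrightarrow> \<kappa> t - m * t = c" by blast
  have lin: "\<kappa> t = of_real x + m * (t - z)" if "t \<in> ball z d" for t
    using c[OF that] c[OF zb] \<kappa>(3) by (simp add: algebra_simps)
  have m0: "m \<noteq> 0"
  proof
    assume "m = 0"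
    then have "\<kappa> constant_on ball z d" unfolding constant_on_def using lin by auto
    then show False using \<kappa>nc[of d] \<kappa>(1) by simp
  qed
  have "P1hol (\<psi> \<circ> (\<lambda>t. of_real x + m * (t - z))) UNIV"
    by (rule P1hol_compose[OF hol]) (auto intro!: holomorphic_intros)
  then have "\<psi> \<circ> (\<lambda>t. of_real x + m * (t - z)) = \<psi>"
    using hol \<kappa>(1) by (rule P1hol_identity_open[where \<xi> = z]) (use \<kappa>(4) lin in simp)
  then have glob: "\<psi> (of_real x + m * (t - z)) = \<psi> t" for t by (metis comp_apply)
  \<comment> \<open>The symmetry pulls the period 1 back to 1 / m; so \<open>m\<close> and 1 / m are
    both integers.\<close>
  have "1 / m \<in> periods \<psi>"
  proof -
    have "\<psi> (t + 1 / m) = \<psi> t" for t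
    proof -
      have "\<psi> (t + 1 / m) = \<psi> (of_real x + m * (t + 1 / m - z))" by (rule glob[symmetric])
      also have "of_real x + m * (t + 1 / m - z) = (of_real x + m * (t - z)) + of_int 1"
        using m0 by (simp add: algebra_simps)
      also have "\<psi> \<dots> = \<psi> t" unfolding period_int by (rule glob)
      finally show ?thesis .
    qed
    then show ?thesis by (simp add: periods_def)
  qed
  then have "1 / m \<in> \<int>" by (simp add: per)
  then obtain a where a: "1 / m = of_int a" by (rule Ints_cases)
  obtain b where b: "m = of_int b" using mZ by (rule Ints_cases)
  have "of_int (a * b) = (1 :: complex)" unfolding of_int_mult a[symmetric] b[symmetric] using m0 by simp
  then have "a * b = 1" by (simp only: of_int_eq_1_iff)
  then have "b = 1 \<or> b = -1" by (metis mult.commute zmult_eq_1_iff)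
  then have "m \<in> {1, -1}" using b by auto
  then show ?thesis using glob by blast
qed

text \<open>Slope 1 means congruence to \<open>x\<close> modulo the integers. All other points of
  the fibre have slope -1, and two such reflections differ by a translation, so these points are
  congruent to one another.\<close>

lemma fibre_over_real_classes:
  assumes inj: "inj_on \<psi> (ball (of_real x) e)" "e > 0"
  shows "\<exists>z0. \<forall>z. \<psi> z = \<psi> (of_real x) \<longrightarrow> z - of_real x \<in> \<int> \<or> z - z0 \<in> \<int>"
proof (cases "\<exists>z0. \<psi> z0 = \<psi> (of_real x) \<and> z0 - of_real x \<notin> \<int>")
  case False
  then show ?thesis by blast
next
  case True
  then obtain z0 where z0: "\<psi> z0 = \<psi> (of_real x)" "z0 - of_real x \<notin> \<int>" by blast
  have neg: "\<psi> (of_real x - (t - z)) = \<psi> t" if z: "\<psi> z = \<psi> (of_real x)" "z - of_real x \<notin> \<int>" for z t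
  proof -
    obtain m where m: "m \<in> {1, -1}" "\<And>t. \<psi> (of_real x + m * (t - z)) = \<psi> t"
      using fibre_over_real[OF inj z(1)] by blast
    have "m \<noteq> 1"
    proof
      assume "m = 1"
      then have "\<psi> (t + (of_real x - z)) = \<psi> t" for t using m(2)[of t] by (simp add: algebra_simps)
      then have "of_real x - z \<in> \<int>" unfolding per[symmetric] periods_def by simp
      then have "- (of_real x - z) \<in> \<int>" by (rule Ints_minus)
      then show False using z(2) by simp
    qed
    then have m1: "m = -1" using m(1) by simp
    have e: "of_real x - (t - z) = of_real x + m * (t - z)" unfolding m1 by simp
    show ?thesis unfolding e by (rule m(2))
  qed
  have "z - z0 \<in> \<int>" if z: "\<psi> z = \<psi> (of_real x)" "z - of_real x \<notin> \<int>" for z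
  proof -
    have "\<psi> (w + (z - z0)) = \<psi> w" for w
    proof -
      define t where "t = of_real x + z0 - w"
      have wz: "w + (z - z0) = of_real x - (t - z)" and w: "w = of_real x - (t - z0)" by (simp_all add: t_def)
      have "\<psi> (w + (z - z0)) = \<psi> t" unfolding wz by (rule neg[OF z])
      moreover have "\<psi> w = \<psi> t" by (subst w, rule neg[OF z0])
      ultimately show ?thesis by simp
    qed
    then show ?thesis unfolding per[symmetric] periods_def by simp
  qed
  then show ?thesis by blast
qed

end

section \<open>Rationality\<close>

lemma pole_order_bound:
  assumes iso: "isolated_singularity_at h s" and ness: "not_essential h s"
  shows "\<exists>m C d. d > 0 \<and> (\<forall>w. w \<noteq> s \<longrightarrow> dist w s < d \<longrightarrow> cmod ((w - s) ^ m * h w) \<le> C)"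
proof (cases "\<exists>\<^sub>F w in at s. h w \<noteq> 0")
  case False
  then have "eventually (\<lambda>w. h w = 0) (at s)" by (simp add: frequently_def)
  then obtain d where "d > 0" "\<forall>w. w \<noteq> s \<and> dist w s < d \<longrightarrow> h w = 0" unfolding eventually_at by auto
  then show ?thesis by (intro exI[of _ 0] exI[of _ 0] exI[of _ d]) simp
next
  case True
  define n where "n = zorder h s"
  define g where "g = zor_poly h s"
  obtain r where r: "r > 0" "g holomorphic_on cball s r"
    "\<And>w. w \<in> cball s r - {s} \<Longrightarrow> h w = g w * (w - s) powi n"
    using zorder_exist[OF iso ness True] unfolding n_def g_def by blast
  have "compact (g ` cball s r)"
    by (rule compact_continuous_image[OF holomorphic_on_imp_continuous_on[OF r(2)] compact_cball])
  from compact_imp_bounded[OF this] obtain G where "G > 0 \<and> (\<forall>x\<in>g ` cball s r. cmod x \<le> G)"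
    unfolding bounded_pos by (rule exE)
  then have G: "G > 0" "\<forall>x\<in>g ` cball s r. cmod x \<le> G" by auto
  show ?thesis
  proof (rule exI[of _ "nat (- n)"], rule exI[of _ "G * r ^ nat n"], rule exI[of _ r], intro conjI allI impI)
    fix w assume w: "w \<noteq> s" "dist w s < r"
    have wr: "w \<in> cball s r - {s}" using w by (simp add: dist_commute less_imp_le)
    have ws: "w - s \<noteq> 0" using w(1) by simp
    have "(w - s) ^ nat (- n) * (w - s) powi n = (w - s) ^ nat n"
    proof (cases "n \<ge> 0")
      case True
      then show ?thesis by (simp add: power_int_def)
    next
      case False
      then show ?thesis using ws by (simp add: power_int_def power_inverse)
    qed
    then have "(w - s) ^ nat (- n) * h w = g w * (w - s) ^ nat n"
      unfolding r(3)[OF wr] by (metis mult.left_commute)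
    then have "cmod ((w - s) ^ nat (- n) * h w) = cmod (g w) * cmod (w - s) ^ nat n"
      by (simp add: norm_mult norm_power)
    also have "\<dots> \<le> G * r ^ nat n"
    proof (intro mult_mono power_mono)
      show "cmod (g w) \<le> G" using G(2) wr by blast
      show "cmod (w - s) \<le> r" using w(2) by (simp add: dist_norm)
    qed (use G(1) in auto)
    finally show "cmod ((w - s) ^ nat (- n) * h w) \<le> G * r ^ nat n" .
  qed (rule r(1))
qed

lemma poly_growth:
  fixes Q :: "complex poly"
  shows "\<exists>B\<ge>0. \<forall>z. cmod z \<ge> 1 \<longrightarrow> cmod (poly Q z) \<le> B * cmod z ^ degree Q"
proof (intro exI[of _ "\<Sum>i\<le>degree Q. cmod (coeff Q i)"] conjI allI impI)
  show "0 \<le> (\<Sum>i\<le>degree Q. cmod (coeff Q i))" by (intro sum_nonneg) simp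
  fix z :: complex assume z: "cmod z \<ge> 1"
  have "cmod (poly Q z) \<le> (\<Sum>i\<le>degree Q. cmod (coeff Q i * z ^ i))"
    unfolding poly_altdef by (rule norm_sum)
  also have "\<dots> \<le> (\<Sum>i\<le>degree Q. cmod (coeff Q i) * cmod z ^ degree Q)"
  proof (rule sum_mono)
    fix i assume "i \<in> {..degree Q}"
    then have "cmod z ^ i \<le> cmod z ^ degree Q" using z by (intro power_increasing) auto
    then show "cmod (coeff Q i * z ^ i) \<le> cmod (coeff Q i) * cmod z ^ degree Q"
      by (simp add: norm_mult norm_power mult_left_mono)
  qed
  finally show "cmod (poly Q z) \<le> (\<Sum>i\<le>degree Q. cmod (coeff Q i)) * cmod z ^ degree Q"
    by (simp add: sum_distrib_right)
qed

text \<open>Clearing the finitely many poles leaves an entire function of polynomial growth, and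
  Liouville's theorem makes it a polynomial.\<close>

lemma rational_function_of_not_essential:
  fixes h :: "complex \<Rightarrow> complex"
  assumes S: "finite S" and h: "h holomorphic_on - S" and ness: "\<And>s. s \<in> S \<Longrightarrow> not_essential h s"
    and inf: "not_essential (\<lambda>w. h (1 / w)) 0"
  obtains P Q where "Q \<noteq> 0" "\<And>w. w \<notin> S \<Longrightarrow> poly Q w \<noteq> 0 \<and> h w = poly P w / poly Q w"
proof -
  have oS: "open (- T)" if "T \<subseteq> S" for T using finite_subset[OF that S] by (simp add: finite_imp_closed open_Compl)
  have "\<exists>m C d. d > 0 \<and> (\<forall>w. w \<noteq> s \<longrightarrow> dist w s < d \<longrightarrow> cmod ((w - s) ^ m * h w) \<le> C)" if s: "s \<in> S" for s
  proof (rule pole_order_bound[OF _ ness[OF s]])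
    have "- (S - {s}) - {s} = - S" using s by blast
    then show "isolated_singularity_at h s"
      using h oS[of "S - {s}"] by (intro isolated_singularity_at_holomorphic[of h "- (S - {s})"]) auto
  qed
  then obtain m C d where mCd: "\<And>s. s \<in> S \<Longrightarrow> d s > 0"
    "\<And>s w. s \<in> S \<Longrightarrow> w \<noteq> s \<Longrightarrow> dist w s < d s \<Longrightarrow> cmod ((w - s) ^ m s * h w) \<le> C s"
    by metis
  \<comment> \<open>One factor more than the pole bound \<open>m s\<close>: the product then tends
    to 0 at \<open>s\<close>, in agreement with the value 0 that \<open>g\<close> is given on
    \<open>S\<close>.\<close>
  define Q where "Q = (\<Prod>s\<in>S. [:- s, 1:] ^ Suc (m s))"
  have Q0: "Q \<noteq> 0" 
  proof -
    have "[:- s, 1:] ^ Suc (m s) \<noteq> 0" for s by (rule power_not_zero) simp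
    then show ?thesis unfolding Q_def prod_zero_iff[OF S] by blast
  qed
  have Qz: "poly Q w \<noteq> 0" if "w \<notin> S" for w
    using that S by (auto simp: Q_def poly_prod prod_zero_iff)
  define g where "g w = (if w \<in> S then 0 else poly Q w * h w)" for w
  have gS: "g holomorphic_on - S"
  proof (rule holomorphic_transform)
    show "(\<lambda>w. poly Q w * h w) holomorphic_on - S" by (intro holomorphic_intros h)
  qed (simp add: g_def)
  have "g holomorphic_on UNIV"
  proof (rule no_isolated_singularity'[OF _ _ open_UNIV S])
    show "g holomorphic_on UNIV - S" using gS by (simp add: Compl_eq_Diff_UNIV)
    fix s assume s: "s \<in> S"
    define R where "R = (\<Prod>t\<in>S - {s}. [:- t, 1:] ^ Suc (m t))"
    have QR: "poly Q w = (w - s) * ((w - s) ^ m s * poly R w)" for w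
      unfolding Q_def R_def prod.remove[OF S s] poly_mult power_Suc by (simp add: poly_power mult_ac)
    have "(g \<longlongrightarrow> 0) (at s)"
    proof (rule Lim_null_comparison)
      have "open (- (S - {s}))" "s \<in> - (S - {s})" using oS[of "S - {s}"] by auto
      then have "eventually (\<lambda>w. w \<in> - (S - {s})) (at s)" using eventually_at_in_open' by blast
      moreover have "eventually (\<lambda>w. w \<noteq> s \<and> dist w s < d s) (at s)"
        unfolding eventually_at using mCd(1)[OF s] by blast
      ultimately show "eventually (\<lambda>w. cmod (g w) \<le> cmod (w - s) * cmod (poly R w) * C s) (at s)"
      proof eventually_elim
        case (elim w)
        then have "w \<notin> S" by blast
        then have "cmod (g w) = cmod ((w - s) * poly R w * ((w - s) ^ m s * h w))"
          by (simp add: g_def QR mult_ac)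
        also have "\<dots> = cmod (w - s) * cmod (poly R w) * cmod ((w - s) ^ m s * h w)"
          by (simp only: norm_mult)
        also have "\<dots> \<le> cmod (w - s) * cmod (poly R w) * C s"
          using mCd(2)[OF s] elim by (intro mult_left_mono) auto
        finally show ?case .
      qed
      have "((\<lambda>w. cmod (w - s) * cmod (poly R w) * C s) \<longlongrightarrow> cmod (s - s) * cmod (poly R s) * C s) (at s)"
        by (intro tendsto_intros)
      then show "((\<lambda>w. cmod (w - s) * cmod (poly R w) * C s) \<longlongrightarrow> 0) (at s)" by simp
    qed
    then show "(g \<longlongrightarrow> g s) (at s within UNIV)" using s by (simp add: g_def)
  qed
  then have ghol: "g holomorphic_on UNIV" .
  obtain r where r: "r > 0" "\<forall>s\<in>S. cmod s \<le> r" using finite_imp_bounded[OF S] bounded_pos by blast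
  have "isolated_singularity_at (\<lambda>w. h (1 / w)) 0"
  proof (rule isolated_singularity_at_holomorphic)
    have "(h \<circ> (\<lambda>w. 1 / w)) holomorphic_on ball 0 (1 / r) - {0}"
    proof (rule holomorphic_on_compose_gen[OF _ h])
      show "(\<lambda>w. 1 / w) holomorphic_on ball 0 (1 / r) - {0}" by (intro holomorphic_intros) auto
      show "(\<lambda>w. 1 / w) ` (ball 0 (1 / r) - {0}) \<subseteq> - S"
      proof (rule image_subsetI)
        fix w :: complex assume w: "w \<in> ball 0 (1 / r) - {0}"
        then have "r < cmod (1 / w)" using r(1) by (simp add: norm_divide field_simps)
        then show "1 / w \<in> - S" using r(2) by auto
      qed
    qed
    then show "(\<lambda>w. h (1 / w)) holomorphic_on ball 0 (1 / r) - {0}" by (simp add: comp_def)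
  qed (use r in auto)
  from pole_order_bound[OF this inf] obtain M B e where e: "e > 0"
    "\<And>w. w \<noteq> 0 \<Longrightarrow> cmod w < e \<Longrightarrow> cmod (w ^ M * h (1 / w)) \<le> B" by auto
  obtain D where D: "D \<ge> 0" "\<And>z. cmod z \<ge> 1 \<Longrightarrow> cmod (poly Q z) \<le> D * cmod z ^ degree Q"
    using poly_growth by metis
  define A where "A = 1 + r + 1 / e"
  have growth: "cmod (g z) \<le> (D * \<bar>B\<bar>) * cmod z ^ (degree Q + M)" if z: "A \<le> cmod z" for z
  proof -
    have z1: "cmod z > 1" "cmod z > r" "cmod z > 1 / e"
    proof -
      have "1 / e > 0" using e(1) by simp
      then show "cmod z > 1 / e" "cmod z > r" "cmod z > 1" using z r(1) unfolding A_def by linarith+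
    qed
    have z0: "z \<noteq> 0" using z1(1) by auto
    have zS: "z \<notin> S" using r(2) z1(2) by auto
    have "cmod (1 / z) < e" using z1(3) e(1) z0 by (simp add: norm_divide field_simps)
    then have "cmod ((1 / z) ^ M * h (1 / (1 / z))) \<le> B" using z0 by (intro e(2)) auto
    then have "cmod (h z) / cmod z ^ M \<le> \<bar>B\<bar>" by (simp add: norm_mult norm_divide norm_power power_divide)
    then have hz: "cmod (h z) \<le> \<bar>B\<bar> * cmod z ^ M" using z0 by (simp add: pos_divide_le_eq)
    have "cmod (g z) = cmod (poly Q z) * cmod (h z)" using zS by (simp add: g_def norm_mult)
    also have "\<dots> \<le> (D * cmod z ^ degree Q) * (\<bar>B\<bar> * cmod z ^ M)"
      using D z1(1) hz by (intro mult_mono) auto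
    finally show ?thesis by (simp add: power_add mult_ac)
  qed
  define n where "n = degree Q + M"
  define P where "P = (\<Sum>k\<le>n. monom ((deriv ^^ k) g 0 / fact k) k)"
  have gP: "g z = poly P z" for z
    unfolding P_def poly_sum poly_monom n_def by (rule Liouville_polynomial[OF ghol growth])
  show ?thesis
  proof (rule that[OF Q0])
    fix w assume w: "w \<notin> S"
    then show "poly Q w \<noteq> 0 \<and> h w = poly P w / poly Q w"
      using Qz[OF w] gP[of w] by (simp add: g_def nonzero_eq_divide_eq mult.commute)
  qed
qed

text \<open>Great Picard gives a limit of \<open>g\<close> or of 1 / g; when 1 / g tends to 0 the
  point is a pole.\<close>

lemma picard_not_essential:
  assumes e: "e > 0" and g: "g holomorphic_on ball 0 e - {0}" and b: "b \<noteq> 0"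
    and omit: "\<And>w. w \<in> ball 0 e - {0} \<Longrightarrow> g w \<noteq> 0 \<and> g w \<noteq> b"
  shows "not_essential g 0"
proof -
  have "0 \<in> ball (0::complex) e" using e by simp
  from great_Picard[OF open_ball this b[symmetric] g omit] obtain l where
    "(g \<longlongrightarrow> l) (at 0) \<or> ((inverse \<circ> g) \<longlongrightarrow> l) (at 0)" by blast
  then show ?thesis
  proof
    assume "(g \<longlongrightarrow> l) (at 0)"
    then show ?thesis unfolding not_essential_def by blast
  next
    assume l: "((inverse \<circ> g) \<longlongrightarrow> l) (at 0)"
    show ?thesis
    proof (cases "l = 0")
      case False
      have "((\<lambda>w. inverse ((inverse \<circ> g) w)) \<longlongrightarrow> inverse l) (at 0)" by (rule tendsto_inverse[OF l False])
      then show ?thesis unfolding not_essential_def by auto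
    next
      case True
      have "eventually (\<lambda>w. w \<in> ball 0 e - {0}) (at 0)"
        by (rule eventually_at_in_open[OF open_ball]) (use e in simp)
      then have "eventually (\<lambda>w. (inverse \<circ> g) w \<noteq> 0) (at 0)"
        by (rule eventually_mono) (use omit in simp)
      with l True have "filterlim (inverse \<circ> g) (at 0) (at 0)" by (intro filterlim_atI) simp_all
      then have "filterlim (\<lambda>w. inverse ((inverse \<circ> g) w)) at_infinity (at 0)"
        by (rule filterlim_compose[OF filterlim_inverse_at_infinity])
      then have "is_pole g 0" by (simp add: is_pole_def)
      then show ?thesis unfolding not_essential_def by blast
    qed
  qed
qed

lemma P1hol_not_essential:
  assumes "P1hol \<phi> S" "s \<in> S"
  shows "not_essential (\<lambda>w. mob_inv p (\<phi> w) - a) s"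
proof -
  from P1holE[OF assms] obtain U P Q where U: "open U" "s \<in> U" "P holomorphic_on U" "Q holomorphic_on U"
    "\<And>w. w \<in> U \<Longrightarrow> P w \<noteq> 0 \<or> Q w \<noteq> 0" "\<And>w. w \<in> U \<Longrightarrow> \<phi> w = proj (P w) (Q w)" by metis
  define A where "A = (\<lambda>w. case p of Infty \<Rightarrow> P w | Aff c \<Rightarrow> Q w)"
  define B where "B = (\<lambda>w. case p of Infty \<Rightarrow> Q w | Aff c \<Rightarrow> P w - c * Q w)"
  have AB: "A holomorphic_on U" "B holomorphic_on U"
    using U by (cases p; auto simp: A_def B_def intro!: holomorphic_intros)+
  have iso: "isolated_singularity_at F s" if "F holomorphic_on U" for F
    by (rule isolated_singularity_at_holomorphic[OF holomorphic_on_subset[OF that] U(1,2)]) blast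
  have eq: "mob_inv p (\<phi> w) = A w / B w" if "w \<in> U" for w
    unfolding U(6)[OF that] mob_inv_proj(1)[OF U(5)[OF that]] by (simp add: A_def B_def split: P1.split)
  have q: "not_essential (\<lambda>w. A w / B w) s"
    by (intro not_essential_divide not_essential_holomorphic[OF _ U(2,1)] iso AB)
  have "not_essential (\<lambda>w. A w / B w - a) s"
  proof (cases "is_pole (\<lambda>w. A w / B w) s")
    case True
    then have "filterlim (\<lambda>w. A w / B w + - a) at_infinity (at s)"
      unfolding is_pole_def using tendsto_add_filterlim_at_infinity'[OF _ tendsto_const] by blast
    then show ?thesis unfolding not_essential_def is_pole_def by simp
  next
    case False
    then obtain x where "((\<lambda>w. A w / B w) \<longlongrightarrow> x) (at s)" using q unfolding not_essential_def by blast
    then have "((\<lambda>w. A w / B w - a) \<longlongrightarrow> x - a) (at s)" by (intro tendsto_diff tendsto_const)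
    then show ?thesis unfolding not_essential_def by blast
  qed
  moreover have ev: "eventually (\<lambda>w. mob_inv p (\<phi> w) - a = A w / B w - a) (at s)"
    using eventually_at_in_open'[OF U(1,2)] by (rule eventually_mono) (simp add: eq)
  ultimately show ?thesis unfolding not_essential_cong[OF ev refl] by blast
qed

section \<open>The main theorem\<close>

definition cexp :: "complex \<Rightarrow> complex" where
  "cexp z = exp (2 * of_real pi * \<i> * z)"

lemma cexp_nonzero [simp]: "cexp z \<noteq> 0"
  by (simp add: cexp_def)

lemma cexp_eq_iff: "cexp z = cexp w \<longleftrightarrow> z - w \<in> \<int>"
proof
  assume "cexp z = cexp w"
  then obtain k :: int where "2 * of_real pi * \<i> * z = 2 * of_real pi * \<i> * w + (of_int (2 * k) * pi) * \<i>"
    unfolding cexp_def exp_eq by blast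
  then have "2 * of_real pi * \<i> * z = 2 * of_real pi * \<i> * (w + of_int k)" by (simp add: algebra_simps)
  then have "z = w + of_int k" by simp
  then show "z - w \<in> \<int>" by simp
next
  assume "z - w \<in> \<int>"
  then obtain k where "z - w = of_int k" by (rule Ints_cases)
  then have "2 * of_real pi * \<i> * z = 2 * of_real pi * \<i> * w + (of_int (2 * k) * pi) * \<i>"
    by (simp add: algebra_simps)
  then show "cexp z = cexp w" unfolding cexp_def exp_eq by blast
qed

lemma norm_cexp: "cmod (cexp z) = exp (- 2 * pi * Im z)"
  by (simp add: cexp_def norm_exp_eq_Re)

text \<open>A right inverse of \<open>cexp\<close> off 0. The choice of branch is invisible to
  functions of period 1.\<close>

definition clog :: "complex \<Rightarrow> complex" where
  "clog w = Ln w / (2 * of_real pi * \<i>)"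

lemma cexp_clog: "w \<noteq> 0 \<Longrightarrow> cexp (clog w) = w"
  by (simp add: cexp_def clog_def)

lemma cexp_half: "cexp (z + 1 / 2) = - cexp z"
  by (simp add: cexp_def distrib_left exp_add)

lemma power_map_cexp: "power_map n (Aff (cexp z)) = Aff (cexp (of_int n * z))"
proof (cases "n \<ge> 0")
  case True
  have "of_int n * z = of_nat (nat n) * z" using True by simp
  then have "cexp (of_int n * z) = exp (of_nat (nat n) * (2 * of_real pi * \<i> * z))"
    unfolding cexp_def by (simp only: mult_ac)
  also have "\<dots> = cexp z ^ nat n" unfolding exp_of_nat_mult cexp_def ..
  finally show ?thesis using True by (simp add: power_map_def poly_monom)
next
  case False
  have "of_int n * z = - (of_nat (nat (- n)) * z)" using False by simp
  then have "cexp (of_int n * z) = exp (- (of_nat (nat (- n)) * (2 * of_real pi * \<i> * z)))"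
    unfolding cexp_def by (simp only: mult_ac mult_minus_right)
  also have "\<dots> = 1 / cexp z ^ nat (- n)" unfolding exp_minus exp_of_nat_mult cexp_def by (simp add: divide_simps)
  finally show ?thesis using False by (simp add: power_map_def poly_monom)
qed

lemma P1_endo_power_map: "P1_endo (power_map n)"
  unfolding power_map_def by (auto intro!: P1_endo_rat_map)

lemma connected_punctured: "connected (- {0::complex})"
  by (rule connected_punctured_universe) simp

lemma P1hol_eq_cofinite:
  assumes "P1hol \<phi> (- {0})" "P1hol \<psi> (- {0})" and F: "finite F" "\<And>w. w \<notin> F \<Longrightarrow> \<phi> w = \<psi> w" and w: "w \<noteq> 0"
  shows "\<phi> w = \<psi> w"
proof -
  have "infinite (- insert 0 F)" using F(1) by (simp add: infinite_UNIV_char_0 finite_compl)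
  then obtain x where x: "x \<in> - insert 0 F" using infinite_imp_nonempty by blast
  have "open (- insert 0 F)" using F(1) by (intro open_Compl finite_imp_closed) simp
  then obtain e where e: "e > 0" "ball x e \<subseteq> - insert 0 F" using x open_contains_ball by blast
  have "x islimpt ball x e" using e(1) by (simp add: islimpt_ball)
  then have "x islimpt {z \<in> - {0}. \<phi> z = \<psi> z}"
    by (rule islimpt_subset) (use e(2) F(2) in blast)
  then show ?thesis
    using P1hol_identity[OF assms(1,2) _ connected_punctured _ _, of x w] x w by auto
qed

text \<open>Common roots are split off one at a time. Once none is left, a common divisor has no
  root and is constant by the fundamental theorem of algebra.\<close>

lemma poly_coprime_reduction:
  fixes A B :: "complex poly"
  assumes "A \<noteq> 0 \<or> B \<noteq> 0"
  shows "\<exists>g p q. g \<noteq> 0 \<and> A = p * g \<and> B = q * g \<and> coprime p q"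
  using assms
proof (induction "degree A + degree B" arbitrary: A B rule: less_induct)
  case less
  show ?case
  proof (cases "\<exists>r. poly A r = 0 \<and> poly B r = 0")
    case True
    then obtain r where "poly A r = 0" "poly B r = 0" by blast
    then obtain A' B' where AB: "A = [:- r, 1:] * A'" "B = [:- r, 1:] * B'"
      unfolding poly_eq_0_iff_dvd dvd_def by blast
    have ne: "A' \<noteq> 0 \<or> B' \<noteq> 0" using less.prems AB by auto
    have deg: "degree ([:- r, 1:] * C) = Suc (degree C)" if "C \<noteq> 0" for C
      using that by (subst degree_mult_eq) simp_all
    have "degree A' + degree B' < degree A + degree B"
      using ne deg[of A'] deg[of B'] unfolding AB by (cases "A' = 0"; cases "B' = 0") auto
    from less.hyps[OF this ne] obtain g p q where g: "g \<noteq> 0" and pq: "A' = p * g" "B' = q * g" "coprime p q"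
      by (elim exE conjE) (rule that)
    show ?thesis
    proof (rule exI[of _ "[:- r, 1:] * g"], rule exI[of _ p], rule exI[of _ q], intro conjI)
      show "[:- r, 1:] * g \<noteq> 0" using g by (intro no_zero_divisors) simp_all
      show "A = p * ([:- r, 1:] * g)" "B = q * ([:- r, 1:] * g)"
        unfolding AB pq(1,2) by (simp_all only: mult.left_commute)
    qed (rule pq(3))
  next
    case False
    have "coprime A B"
    proof (rule coprimeI)
      fix c assume c: "c dvd A" "c dvd B"
      then have c0: "c \<noteq> 0" using less.prems by auto
      have "constant (poly c)"
      proof (rule ccontr)
        assume "\<not> constant (poly c)"
        then obtain r where "poly c r = 0" using fundamental_theorem_of_algebra by blast
        then have "poly A r = 0 \<and> poly B r = 0" using c by (auto simp: dvd_def)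
        with False show False by blast
      qed
      then have "degree c = 0" by (simp add: constant_degree)
      then show "is_unit c" using c0 by (simp add: is_unit_iff_degree)
    qed
    then show ?thesis
      by (intro exI[of "\<lambda>g. \<exists>p q. g \<noteq> 0 \<and> A = p * g \<and> B = q * g \<and> coprime p q" 1] exI[of "\<lambda>p. \<exists>q. 1 \<noteq> 0 \<and> A = p * 1 \<and> B = q * 1 \<and> coprime p q" A] exI[of _ B]) simp
  qed
qed

section \<open>The function induced by \<psi> on the punctured plane\<close>

context periodic_poincare
begin

text \<open>The 1-periodic \<psi> viewed on the quotient of the plane by the integers, which
  \<open>cexp\<close> identifies with the punctured plane; \<open>R 0\<close> is a default
  value.\<close>

definition R :: "complex \<Rightarrow> P1" where
  "R w = \<psi> (clog w)"

lemma R_cexp: "R (cexp z) = \<psi> z"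
proof -
  have "cexp (clog (cexp z)) = cexp z" by (rule cexp_clog) simp
  then have "clog (cexp z) - z \<in> \<int>" by (simp add: cexp_eq_iff)
  then obtain k where "clog (cexp z) - z = of_int k" by (rule Ints_cases)
  then have "clog (cexp z) = z + of_int k" by (simp add: algebra_simps)
  then show ?thesis by (simp add: R_def period_int)
qed

text \<open>For holomorphy across the cut of \<open>Ln\<close>: there the logarithm of -w is
  holomorphic, and half a period makes up for the sign.\<close>

lemma R_minus: "w \<noteq> 0 \<Longrightarrow> R w = \<psi> (clog (- w) + 1 / 2)"
  using R_cexp[of "clog (- w) + 1 / 2"] cexp_clog[of "- w"] by (simp add: cexp_half)

lemma P1hol_R: "P1hol R (- {0})"
proof (rule P1hol_pointwise)
  fix w :: complex assume w: "w \<in> - {0}"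
  show "P1hol R {w}"
  proof (cases "w \<in> \<real>\<^sub>\<le>\<^sub>0")
    case False
    have "clog holomorphic_on - \<real>\<^sub>\<le>\<^sub>0" unfolding clog_def by (intro holomorphic_intros) auto
    then have "P1hol (\<psi> \<circ> clog) (- \<real>\<^sub>\<le>\<^sub>0)" by (rule P1hol_compose[OF hol]) auto
    then have "P1hol R (- \<real>\<^sub>\<le>\<^sub>0)" by (simp add: R_def[abs_def] comp_def)
    then show ?thesis by (rule P1hol_subset) (use False in simp)
  next
    case True
    let ?S = "{w. 0 < Re (- w)}"
    have oS: "open ?S" by (intro open_Collect_less continuous_intros)
    have "(\<lambda>w. clog (- w) + 1 / 2) holomorphic_on ?S"
      unfolding clog_def by (intro holomorphic_intros) (auto simp: complex_nonpos_Reals_iff)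
    then have "P1hol (\<psi> \<circ> (\<lambda>w. clog (- w) + 1 / 2)) ?S" by (rule P1hol_compose[OF hol _ oS]) auto
    then have "P1hol R ?S" by (rule P1hol_cong[OF _ oS]) (auto intro!: R_minus[symmetric])
    then show ?thesis
      by (rule P1hol_subset) (use True w in \<open>auto simp: complex_nonpos_Reals_iff complex_eq_iff\<close>)
  qed
qed

lemma R_fibre:
  assumes "inj_on \<psi> (ball (of_real x) e)" "e > 0"
  shows "\<exists>L. (\<forall>w. w \<noteq> 0 \<longrightarrow> R w = \<psi> (of_real x) \<longrightarrow> exp (- L) \<le> cmod w \<and> cmod w \<le> exp L) \<and>
    finite {w. w \<noteq> 0 \<and> R w = \<psi> (of_real x)}"
proof -
  obtain z0 where z0: "\<And>z. \<psi> z = \<psi> (of_real x) \<Longrightarrow> z - of_real x \<in> \<int> \<or> z - z0 \<in> \<int>"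
    using fibre_over_real_classes[OF assms] by blast
  have *: "w = cexp (of_real x) \<or> w = cexp z0" if w: "w \<noteq> 0" "R w = \<psi> (of_real x)" for w
  proof -
    have "clog w - of_real x \<in> \<int> \<or> clog w - z0 \<in> \<int>" using w(2) by (intro z0) (simp add: R_def)
    then show ?thesis using cexp_eq_iff[of "clog w"] cexp_clog[OF w(1)] by auto
  qed
  \<comment> \<open>Of the at most two points of the fibre, the image of the real point has modulus
    1, so only \<open>z0\<close> enters the bound.\<close>
  define L where "L = 2 * pi * \<bar>Im z0\<bar>"
  have L0: "L \<ge> 0" by (simp add: L_def)
  have "exp (- L) \<le> cmod w \<and> cmod w \<le> exp L" if w: "w \<noteq> 0" "R w = \<psi> (of_real x)" for w
    using *[OF w]
  proof
    assume "w = cexp (of_real x)"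
    then show ?thesis using L0 by (simp add: norm_cexp)
  next
    assume w: "w = cexp z0"
    have "\<bar>2 * pi * Im z0\<bar> = L" by (simp add: L_def abs_mult)
    then have "- L \<le> - 2 * pi * Im z0" "- 2 * pi * Im z0 \<le> L" by linarith+
    then show ?thesis unfolding w norm_cexp by simp
  qed
  moreover have "{w. w \<noteq> 0 \<and> R w = \<psi> (of_real x)} \<subseteq> {cexp (of_real x), cexp z0}" using * by blast
  then have "finite {w. w \<noteq> 0 \<and> R w = \<psi> (of_real x)}" by (rule finite_subset) simp
  ultimately show ?thesis by blast
qed

text \<open>Two omitted values are for Picard's theorem; \<open>p3\<close> is the value to be sent
  to infinity, and its finite fibre keeps the number of poles finite.\<close>

lemma R_omits_near_ends:
  obtains L and p1 p2 p3 :: P1 where "p1 \<noteq> p2" "p1 \<noteq> p3" "p2 \<noteq> p3" "finite {w. w \<noteq> 0 \<and> R w = p3}"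
    "\<And>w. w \<noteq> 0 \<Longrightarrow> cmod w < exp (- L) \<or> cmod w > exp L \<Longrightarrow> R w \<noteq> p1 \<and> R w \<noteq> p2 \<and> R w \<noteq> p3"
proof -
  obtain x :: real and e where e: "e > 0" "inj_on \<psi> (ball (of_real x) e)"
    by (rule exists_real_injective_point[OF hol nonconst])
  \<comment> \<open>With spacing and radius e / 4 the balls about \<open>y 0\<close>,
    \<open>y 1\<close>, \<open>y 2\<close> stay inside the ball on which \<psi> is injective; so the
    three values are distinct and each satisfies \<open>R_fibre\<close>.\<close>
  define y where "y k = x + of_nat k * (e / 4)" for k :: nat
  have yb: "ball (complex_of_real (y k)) (e / 4) \<subseteq> ball (of_real x) e" if "k < 3" for k
  proof -
    have "dist (complex_of_real (y k)) (of_real x) = of_nat k * (e / 4)"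
      unfolding dist_of_real y_def dist_real_def using e(1) by simp
    moreover have "real k \<le> 2" using that by simp
    then have "real k * (e / 4) \<le> 2 * (e / 4)" using e(1) by (intro mult_right_mono) auto
    ultimately have "dist (complex_of_real (y k)) (of_real x) + e / 4 \<le> e" using e(1) by linarith
    then show ?thesis by (simp only: ball_subset_ball_iff simp_thms)
  qed
  have yin: "complex_of_real (y k) \<in> ball (of_real x) e" if "k < 3" for k
    by (rule subsetD[OF yb[OF that]]) (use e(1) in simp)
  have inj: "inj_on \<psi> (ball (of_real (y k)) (e / 4))" if "k < 3" for k
    using e(2) yb[OF that] by (rule inj_on_subset)
  have fibre: "\<exists>L. (\<forall>w. w \<noteq> 0 \<longrightarrow> R w = \<psi> (of_real (y k)) \<longrightarrow> exp (- L) \<le> cmod w \<and> cmod w \<le> exp L) \<and>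
    finite {w. w \<noteq> 0 \<and> R w = \<psi> (of_real (y k))}" if "k < 3" for k
    by (rule R_fibre[OF inj[OF that]]) (use e(1) in simp)
  define bnd where "bnd k L \<longleftrightarrow> (\<forall>w. w \<noteq> 0 \<longrightarrow> R w = \<psi> (of_real (y k)) \<longrightarrow> exp (- L) \<le> cmod w \<and> cmod w \<le> exp L)"
    for k L
  have fin: "finite {w. w \<noteq> 0 \<and> R w = \<psi> (of_real (y 2))}" using fibre[of 2] by auto
  have "\<forall>k. \<exists>L. k < 3 \<longrightarrow> bnd k L" using fibre unfolding bnd_def by blast
  from choice[OF this] obtain L where "\<forall>k. k < 3 \<longrightarrow> bnd k (L k)" by (rule exE)
  then have L: "exp (- L k) \<le> cmod w \<and> cmod w \<le> exp (L k)"
    if "k < 3" "w \<noteq> 0" "R w = \<psi> (of_real (y k))" for k w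
    using that unfolding bnd_def by simp
  define M where "M = \<bar>L 0\<bar> + \<bar>L 1\<bar> + \<bar>L 2\<bar>"
  have LM: "L k \<le> M" if "k < 3" for k
  proof -
    have "k = 0 \<or> k = 1 \<or> k = 2" using that by auto
    then show ?thesis by (auto simp: M_def)
  qed
  have ne: "\<psi> (of_real (y j)) \<noteq> \<psi> (of_real (y k))" if "j < 3" "k < 3" "j \<noteq> k" for j k
  proof
    assume "\<psi> (of_real (y j)) = \<psi> (of_real (y k))"
    then have "complex_of_real (y j) = of_real (y k)" by (rule inj_onD[OF e(2) _ yin[OF that(1)] yin[OF that(2)]])
    then have "y j = y k" by (simp only: of_real_eq_iff)
    then show False using that(3) e(1) by (simp add: y_def)
  qed
  have omit: "R w \<noteq> \<psi> (of_real (y k))" if "k < 3" "w \<noteq> 0" "cmod w < exp (- M) \<or> cmod w > exp M" for k w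
  proof
    assume "R w = \<psi> (of_real (y k))"
    then have "exp (- L k) \<le> cmod w" "cmod w \<le> exp (L k)" using L[OF that(1,2)] by auto
    moreover have "exp (L k) \<le> exp M" "exp (- M) \<le> exp (- L k)" using LM[OF that(1)] by simp_all
    ultimately show False using that(3) by linarith
  qed
  show ?thesis
    by (rule that[of "\<psi> (of_real (y 0))" "\<psi> (of_real (y 1))" "\<psi> (of_real (y 2))" M])
      (use ne[of 0 1] ne[of 0 2] ne[of 1 2] fin omit[of 0] omit[of 1] omit[of 2] in simp_all)
qed

text \<open>In the chart that sends \<open>p3\<close> to infinity, shifted so that \<open>p1\<close>
  becomes 0 and \<open>p2\<close> becomes \<open>b\<close>, neither 0 nor infinity is an essential
  singularity by Picard; the other singularities lie over \<open>p3\<close> and are not essential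
  either.\<close>

lemma R_rational:
  obtains A B :: "complex poly" and F :: "complex set"
  where "A \<noteq> 0 \<or> B \<noteq> 0" "finite F" "\<And>w. w \<notin> F \<Longrightarrow> R w = proj (poly A w) (poly B w)"
proof -
  obtain L and p1 p2 p3 :: P1 where p: "p1 \<noteq> p2" "p1 \<noteq> p3" "p2 \<noteq> p3" and fin: "finite {w. w \<noteq> 0 \<and> R w = p3}"
    and omit: "\<And>w. w \<noteq> 0 \<Longrightarrow> cmod w < exp (- L) \<or> cmod w > exp L \<Longrightarrow> R w \<noteq> p1 \<and> R w \<noteq> p2 \<and> R w \<noteq> p3"
    by (rule R_omits_near_ends) (rule that; assumption)
  define a where "a = mob_inv p3 p1"
  define b where "b = mob_inv p3 p2 - a"
  have b: "b \<noteq> 0" using mob_inv_inject[of p1 p3 p2] p by (auto simp: a_def b_def)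
  define h where "h w = mob_inv p3 (R w) - a" for w
  define S where "S = insert 0 {w. w \<noteq> 0 \<and> R w = p3}"
  have S: "finite S" using fin by (simp add: S_def)
  have hS: "h holomorphic_on - S"
  proof -
    have "{w \<in> - {0}. R w \<noteq> p3} = - S" by (auto simp: S_def)
    then have "(\<lambda>w. mob_inv p3 (R w)) holomorphic_on - S"
      using P1hol_mob_inv(2)[OF P1hol_R, of p3] by (simp add: open_Compl)
    then show ?thesis unfolding h_def by (intro holomorphic_on_diff holomorphic_on_const)
  qed
  have hne: "h w \<noteq> 0 \<and> h w \<noteq> b" if "w \<noteq> 0" "cmod w < exp (- L) \<or> cmod w > exp L" for w
    using omit[OF that] mob_inv_inject[of "R w" p3 p1] mob_inv_inject[of "R w" p3 p2] p
    by (auto simp: h_def a_def b_def)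
  have notS: "w \<notin> S" if "w \<noteq> 0" "cmod w < exp (- L) \<or> cmod w > exp L" for w
    using omit[OF that] that(1) by (simp add: S_def)
  have eL: "exp (- L) > 0" by simp
  have ness0: "not_essential h 0"
  proof (rule picard_not_essential[OF eL _ b])
    show "h holomorphic_on ball 0 (exp (- L)) - {0}"
      using hS by (rule holomorphic_on_subset) (use notS in auto)
  qed (use hne in auto)
  have ness_inf: "not_essential (\<lambda>w. h (1 / w)) 0"
  proof (rule picard_not_essential[OF eL _ b])
    have big: "1 / w \<noteq> 0" "cmod (1 / w) > exp L" if "w \<in> ball 0 (exp (- L)) - {0}" for w :: complex
      using that by (auto simp: norm_divide exp_minus field_simps)
    have "(h \<circ> (\<lambda>w. 1 / w)) holomorphic_on ball 0 (exp (- L)) - {0}"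
    proof (rule holomorphic_on_compose_gen[OF _ hS])
      show "(\<lambda>w. 1 / w) holomorphic_on ball 0 (exp (- L)) - {0}" by (intro holomorphic_intros) auto
      show "(\<lambda>w. 1 / w) ` (ball 0 (exp (- L)) - {0}) \<subseteq> - S"
        by (rule image_subsetI) (use big notS in simp)
    qed
    then show "(\<lambda>w. h (1 / w)) holomorphic_on ball 0 (exp (- L)) - {0}" by (simp add: comp_def)
    show "h (1 / w) \<noteq> 0 \<and> h (1 / w) \<noteq> b" if "w \<in> ball 0 (exp (- L)) - {0}" for w
      using big[OF that] by (intro hne) auto
  qed
  have ness: "not_essential h s" if s: "s \<in> S" for s
  proof (cases "s = 0")
    case True
    then show ?thesis using ness0 by simp
  next
    case False
    then show ?thesis unfolding h_def by (intro P1hol_not_essential[OF P1hol_R]) simp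
  qed
  obtain P Q where PQ: "Q \<noteq> 0" "\<And>w. w \<notin> S \<Longrightarrow> poly Q w \<noteq> 0 \<and> h w = poly P w / poly Q w"
  proof (rule rational_function_of_not_essential[OF S hS _ ness_inf])
    show "not_essential h s" if "s \<in> S" for s by (rule ness[OF that])
  qed (rule that; assumption)
  \<comment> \<open>This undoes the shift by \<open>a\<close>; the chart itself is undone below by
    \<open>mob p3\<close>.\<close>
  define N where "N = P + smult a Q"
  have Rw: "R w = mob p3 (poly N w / poly Q w)" and Qw: "poly Q w \<noteq> 0" if w: "w \<notin> S" for w
  proof -
    show Qw: "poly Q w \<noteq> 0" using PQ(2)[OF w] by simp
    have "mob_inv p3 (R w) = poly N w / poly Q w"
      using PQ(2)[OF w] by (simp add: N_def h_def add_divide_distrib diff_eq_eq)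
    moreover have "R w \<noteq> p3" using w unfolding S_def by blast
    ultimately show "R w = mob p3 (poly N w / poly Q w)" by (metis mob_mob_inv)
  qed
  show ?thesis
  proof (cases p3)
    case Infty
    show ?thesis
    proof (rule that[OF _ S, of N Q])
      show "R w = proj (poly N w) (poly Q w)" if "w \<notin> S" for w
        using Rw[OF that] Qw[OF that] Infty by (simp add: mob_def proj_def)
    qed (use PQ(1) in simp)
  next
    case (Aff c)
    show ?thesis
    proof (rule that[OF _ S, of "smult c N + Q" N])
      show "R w = proj (poly (smult c N + Q) w) (poly N w)" if "w \<notin> S" for w
        using Rw[OF that] Qw[OF that] Aff by (auto simp: mob_def proj_def field_simps)
      show "smult c N + Q \<noteq> 0 \<or> N \<noteq> 0" using PQ(1) by auto
    qed
  qed
qed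

lemma R_rat_map:
  obtains p q :: "complex poly" where "coprime p q" "\<And>w. w \<noteq> 0 \<Longrightarrow> R w = rat_map p q (Aff w)"
proof -
  obtain A B and F :: "complex set" where AB: "A \<noteq> 0 \<or> B \<noteq> 0" and F: "finite F"
    "\<And>w. w \<notin> F \<Longrightarrow> R w = proj (poly A w) (poly B w)" by (rule R_rational) (rule that; assumption)
  obtain g p q where g0: "g \<noteq> 0" and pq: "A = p * g" "B = q * g" "coprime p q"
    using poly_coprime_reduction[OF AB] by blast
  have "P1hol (rat_map p q \<circ> Aff) (- {0})"
    using P1_endoD[OF P1_endo_rat_map[OF pq(3)] P1hol_mob[of Infty]] by (simp add: mob_Infty)
  moreover have "finite (F \<union> {w. poly g w = 0})" using F(1) g0 poly_roots_finite by blast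
  moreover have "R w = (rat_map p q \<circ> Aff) w" if "w \<notin> F \<union> {w. poly g w = 0}" for w
    using F(2)[of w] that by (simp add: pq proj_def)
  ultimately have "R w = (rat_map p q \<circ> Aff) w" if "w \<noteq> 0" for w
    using P1hol_eq_cofinite[OF P1hol_R _ _ _ that] by blast
  then show ?thesis using that[OF pq(3)] by simp
qed

theorem is_monomial_type:
  assumes "P1_morphism_of_degree f d" "d \<ge> 2"
  shows "is_monomial_type f"
proof -
  obtain p q where pq: "coprime p q" "\<And>w. w \<noteq> 0 \<Longrightarrow> R w = rat_map p q (Aff w)" by (rule R_rat_map) (rule that; assumption)
  define \<pi> where "\<pi> = rat_map p q"
  have \<pi>: "P1_endo \<pi>" unfolding \<pi>_def by (rule P1_endo_rat_map[OF pq(1)])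
  have \<pi>e: "\<pi> (Aff (cexp z)) = \<psi> z" for z using pq(2)[of "cexp z"] R_cexp by (simp add: \<pi>_def)
  have fp: "f (\<pi> (Aff w)) = \<pi> (power_map n (Aff w))" if "w \<noteq> 0" for w
  proof -
    have w: "w = cexp (clog w)" using cexp_clog[OF that] by simp
    have "f (\<pi> (Aff (cexp z))) = \<pi> (power_map n (Aff (cexp z)))" for z
      unfolding power_map_cexp \<pi>e eqn ..
    then show ?thesis by (subst (1 2) w)
  qed
  have limpt: "(0::complex) islimpt - {0}"
  proof -
    have "(0::complex) islimpt (ball 0 1 - {0})" by (simp add: islimpt_ball flip: islimpt_punctured)
    then show ?thesis by (rule islimpt_subset) auto
  qed
  have h1: "P1hol (f \<circ> (\<pi> \<circ> mob c)) UNIV" and h2: "P1hol (\<pi> \<circ> (power_map n \<circ> mob c)) UNIV" for c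
    by (intro P1_endoD f \<pi> P1_endo_power_map P1hol_mob)+
  \<comment> \<open>The semiconjugacy is known on the punctured plane only. The identity theorem in
    the chart around 0 and in the chart around infinity supplies the two missing points.\<close>
  have all: "(f \<circ> (\<pi> \<circ> mob c)) w = (\<pi> \<circ> (power_map n \<circ> mob c)) w"
    if "\<And>w. w \<noteq> 0 \<Longrightarrow> (f \<circ> (\<pi> \<circ> mob c)) w = (\<pi> \<circ> (power_map n \<circ> mob c)) w" for c w
  proof -
    have "0 islimpt {z \<in> UNIV. (f \<circ> (\<pi> \<circ> mob c)) z = (\<pi> \<circ> (power_map n \<circ> mob c)) z}"
      using limpt by (rule islimpt_subset) (use that in auto)
    then show ?thesis by (rule P1hol_identity[OF h1 h2 open_UNIV connected_UNIV UNIV_I _ UNIV_I])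
  qed
  have "f (\<pi> x) = \<pi> (power_map n x)" for x
  proof (cases x)
    case (Aff w)
    have "(f \<circ> (\<pi> \<circ> mob Infty)) w = (\<pi> \<circ> (power_map n \<circ> mob Infty)) w"
      by (rule all) (simp add: mob_Infty fp)
    then show ?thesis by (simp add: mob_Infty Aff)
  next
    case Infty
    have "(f \<circ> (\<pi> \<circ> mob (Aff 0))) 0 = (\<pi> \<circ> (power_map n \<circ> mob (Aff 0))) 0"
      by (rule all) (simp add: mob_Aff_0 Aff_inf_def fp)
    then show ?thesis by (simp add: mob_Aff_0 Aff_inf_def Infty)
  qed
  moreover have "P1_morphism \<pi>" unfolding P1_morphism_def P1_morphism_of_degree_def \<pi>_def using pq(1) by blast
  moreover have "\<not> \<pi> constant_on UNIV"
  proof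
    assume "\<pi> constant_on UNIV"
    then obtain c where "\<And>x. \<pi> x = c" unfolding constant_on_def by auto
    then have "\<psi> z1 = c" "\<psi> z2 = c" using \<pi>e by metis+
    then show False using nonconst by simp
  qed
  ultimately show ?thesis unfolding is_monomial_type_def using assms n by blast
qed

end

context poincare
begin

theorem is_exceptional:
  assumes f: "P1_morphism_of_degree f d" "d \<ge> 2" and lin: "is_linear_CER f K"
  shows "is_exceptional f"
proof -
  obtain \<delta> where \<delta>: "\<delta> > 0" "\<delta> \<le> r" "affine_returns \<delta>"
    using lin affine_returns_atlas affine_returns_cohomologous unfolding is_linear_CER_def by metis
  obtain a b t where a: "cmod a > 1" and semi: "\<And>z. f (\<psi> z) = \<psi> (a * z + b)" and t: "t \<in> periods \<psi>" "t \<noteq> 0"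
    using affine_semiconjugacy[OF \<delta>] by metis
  have a0: "a \<noteq> 0" using a by auto
  obtain z1 where z1: "\<psi> z1 \<noteq> \<psi> 0" by (rule nonconstant)
  consider \<omega> where "\<omega> \<noteq> 0" "periods \<psi> = range (\<lambda>n::int. of_int n * \<omega>)" | "is_lattice (periods \<psi>)"
    using discrete_subgroup_cases[OF periods_diff r periods_discrete t] by blast
  then show ?thesis
  proof cases
    case 2
    have "is_Lattes f" by (rule is_Lattes_of_lattice_periods[OF f hol z1 semi a0 2])
    then show ?thesis by (simp add: is_exceptional_def)
  next
    case 1
    have "1 * \<omega> \<in> periods \<psi>" unfolding 1(2) by (rule range_eqI[of _ _ 1]) simp
    then have "a * \<omega> \<in> periods \<psi>" using periods_mult[where f = f and \<psi> = \<psi> and a = a and b = b, OF semi a0] by simp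
    then obtain n :: int where "a * \<omega> = of_int n * \<omega>" unfolding 1(2) by auto
    then have an: "a = of_int n" using 1(1) by simp
    \<comment> \<open>The fixed point of z \<mapsto> a * z + b. Centring there and scaling by
      \<omega> turns this map into multiplication by the integer \<open>n\<close> and the period
      group into the integers.\<close>
    define c where "c = b / (1 - a)"
    have a1: "1 - a \<noteq> 0" using a by auto
    have c: "a * c + b = c" using a1 by (simp add: c_def field_simps)
    define \<Psi> where "\<Psi> z = \<psi> (c + \<omega> * z)" for z
    have "periodic_poincare f \<Psi> n ((z1 - c) / \<omega>) (- c / \<omega>)"
    proof
      show "P1_endo f" by (rule endo)
      have "P1hol (\<psi> \<circ> (\<lambda>z. c + \<omega> * z)) UNIV"
        by (rule P1hol_compose[OF hol]) (auto intro!: holomorphic_intros)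
      then show "P1hol \<Psi> UNIV" by (simp add: \<Psi>_def[abs_def] comp_def)
      show "\<Psi> ((z1 - c) / \<omega>) \<noteq> \<Psi> (- c / \<omega>)" using z1 1(1) by (simp add: \<Psi>_def)
      have "\<bar>real_of_int n\<bar> > 1" using a by (simp add: an)
      then show "2 \<le> \<bar>n\<bar>" by linarith
      show "f (\<Psi> z) = \<Psi> (of_int n * z)" for z
      proof -
        have "a * (c + \<omega> * z) + b = (a * c + b) + \<omega> * (a * z)" by (simp add: algebra_simps)
        then show ?thesis unfolding \<Psi>_def semi c an[symmetric] by simp
      qed
      show "periods \<Psi> = \<int>"
      proof (intro equalityI subsetI)
        fix s assume s: "s \<in> periods \<Psi>"
        have "\<psi> (z + \<omega> * s) = \<psi> z" for z
        proof -
          define y where "y = (z - c) / \<omega>"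
          have z: "z = c + \<omega> * y" using 1(1) by (simp add: y_def)
          have "z + \<omega> * s = c + \<omega> * (y + s)" unfolding z by (simp add: algebra_simps)
          then have "\<psi> (z + \<omega> * s) = \<Psi> (y + s)" by (simp add: \<Psi>_def)
          also have "\<dots> = \<Psi> y" by (rule periodsD[OF s])
          finally show ?thesis by (simp add: \<Psi>_def z)
        qed
        then have "\<omega> * s \<in> periods \<psi>" by (simp add: periods_def)
        then obtain k :: int where "\<omega> * s = of_int k * \<omega>" unfolding 1(2) by blast
        then have "s = of_int k" using 1(1) by simp
        then show "s \<in> \<int>" by simp
      next
        fix s :: complex assume "s \<in> \<int>"
        then obtain k where k: "s = of_int k" by (rule Ints_cases)
        have "of_int k * \<omega> \<in> periods \<psi>" unfolding 1(2) by blast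
        then have "\<psi> ((c + \<omega> * z) + of_int k * \<omega>) = \<psi> (c + \<omega> * z)" for z by (rule periodsD)
        moreover have "(c + \<omega> * z) + of_int k * \<omega> = c + \<omega> * (z + s)" for z by (simp add: k algebra_simps)
        ultimately have "\<psi> (c + \<omega> * (z + s)) = \<psi> (c + \<omega> * z)" for z by metis
        then show "s \<in> periods \<Psi>" unfolding periods_def \<Psi>_def by blast
      qed
    qed
    then have "is_monomial_type f" using periodic_poincare.is_monomial_type f by blast
    then show ?thesis by (simp add: is_exceptional_def)
  qed
qed

end

theorem theorem1p1:
  fixes f :: "P1 \<Rightarrow> P1" and d :: nat and K :: "P1 set"
  assumes "P1_morphism_of_degree f d" and "d \<ge> 2"
    and "is_linear_CER f K" and "infinite K"
  shows "is_exceptional f"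
proof -
  have K: "is_CER f K" "f ` K = K" using assms(3) by (simp_all add: is_linear_CER_def)
  obtain m V where rep: "repeller f K V m" by (rule is_CER_repeller[OF assms(1,2) K assms(4)])
  obtain n \<rho> \<psi> r where "n \<ge> 1" "cmod \<rho> > 1" "P1hol \<psi> UNIV" "\<psi> 0 \<in> K" "r > 0" "inj_on \<psi> (ball 0 r)"
    "\<And>z. \<psi> (\<rho> * z) = (f ^^ n) (\<psi> z)"
    using repeller.poincare_function[OF rep] by metis
  then have "poincare f K V m n \<rho> \<psi> r"
    using rep by (simp add: poincare_def poincare_axioms_def)
  then show ?thesis using poincare.is_exceptional assms(1-3) by blast
qed

end
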